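(* For every sufficiently large constant $d$ there exist a constant $\gamma>0$, a family $\{G_n=([n],E_n)\}_{n\in\mathbb{N}}$ of graphs of maximum degree $d$ with every $G_n$ $\gamma$-robustly self-ordered, and a polynomial-time algorithm that on input $1^n$ outputs $G_n$. Furthermore, $G_n$ consists of connected components of size $O(\log n)/\log\log n$.
   Context: A graph $G=(V,E)$ is $\gamma$-robustly self-ordered if for every permutation $\pi:V\to V$, $|E\triangle\{\{\pi(u),\pi(v)\}:\{u,v\}\in E\}|\ge\gamma\cdot|\{v:\pi(v)\ne v\}|$.
   Formalization: Robust self-ordering is claimed for every n except 2, 3, 4, 5, since no graph on that many vertices is free of nontrivial automorphisms; maximum degree exactly d is claimed for n > d, as graphs on n ≤ d vertices cannot attain it. *)

theory Defs
  imports
    Complex_Main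
    "HOL-Combinatorics.Permutations"
    "HOL-Computational_Algebra.Polynomial"
    "HOL-Library.Landau_Symbols"
begin

section \<open>Graphs\<close>

definition graph :: "'a set \<Rightarrow> 'a set set \<Rightarrow> bool" where
  "graph V E \<longleftrightarrow> finite V \<and> E \<subseteq> {{u, v} | u v. u \<in> V \<and> v \<in> V \<and> u \<noteq> v}"

definition degree_in :: "'a set set \<Rightarrow> 'a \<Rightarrow> nat" where
  "degree_in E v = card {e \<in> E. v \<in> e}"

definition max_degree :: "'a set \<Rightarrow> 'a set set \<Rightarrow> nat" where
  "max_degree V E = Max (degree_in E ` V)"

text \<open>The image \<open>\<pi> ` e\<close> of an edge \<open>e = {u, v}\<close> is \<open>{\<pi> u, \<pi> v}\<close>.
  For \<open>\<gamma> > 0\<close> the property implies that the graph has no nontrivial automorphism; hence no graph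
  on 2, 3, 4 or 5 vertices has it.\<close>

definition robustly_self_ordered :: "real \<Rightarrow> 'a set \<Rightarrow> 'a set set \<Rightarrow> bool" where
  "robustly_self_ordered \<gamma> V E \<longleftrightarrow>
     (\<forall>\<pi>. \<pi> permutes V \<longrightarrow>
        real (card (sym_diff E ((\<lambda>e. \<pi> ` e) ` E))) \<ge> \<gamma> * real (card {v \<in> V. \<pi> v \<noteq> v}))"

definition connected_components :: "'a set \<Rightarrow> 'a set set \<Rightarrow> 'a set set" where
  "connected_components V E = V // {(u, v). u \<in> V \<and> v \<in> V \<and> (u, v) \<in> {(x, y). {x, y} \<in> E}\<^sup>*}"

definition max_component_size :: "'a set \<Rightarrow> 'a set set \<Rightarrow> nat" where
  "max_component_size V E = Max (card ` connected_components V E)"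


section \<open>Polynomial-time computation\<close>

text \<open>
  The machine model is the random access machine of Cook and Reckhow (1973) with a read-only
  input tape and a write-only output tape, presented with structured control flow. A program uses
  finitely many registers and arrays of natural numbers.

  Every executed basic command and every evaluated test costs one time unit; since the expressions
  occurring in a program have bounded size, charging for the individual operations would change
  running times by a constant factor only. There is deliberately no multiplication (and no shift):
  with addition and truncated subtraction alone, all numbers arising within \<open>t\<close> steps have
  \<open>O(t)\<close> bits (for input symbols of bounded size), so that the unit-cost measure is polynomially
  related to the time of multitape Turing machines.
\<close>

datatype aexp =
    Num nat
  | Reg nat
  | Cell nat aexp   \<comment> \<open>\<open>Cell a i\<close>: the entry with index \<open>i\<close> of array number \<open>a\<close>\<close>
  | Plus aexp aexp
  | Minus aexp aexp

datatype com =
    Skip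
  | Assign nat aexp
  | Store nat aexp aexp   \<comment> \<open>\<open>Store a i e\<close>: write \<open>e\<close> to index \<open>i\<close> of array number \<open>a\<close>\<close>
  | Read nat
  | Print aexp
  | Seq com com
  | Cond aexp com com
  | While aexp com

record state =
  regs :: "nat \<Rightarrow> nat"
  arrs :: "nat \<Rightarrow> nat \<Rightarrow> nat"
  inp :: "nat list"
  outp :: "nat list"

fun aval :: "aexp \<Rightarrow> state \<Rightarrow> nat" where
  "aval (Num k) s = k"
| "aval (Reg r) s = regs s r"
| "aval (Cell a i) s = arrs s a (aval i s)"
| "aval (Plus e f) s = aval e s + aval f s"
| "aval (Minus e f) s = aval e s - aval f s"

text \<open>
  \<open>exec c s t s'\<close>: started in state \<open>s\<close>, the program \<open>c\<close> halts in state \<open>s'\<close> after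
  exactly \<open>t\<close> time units. A test succeeds if its value is nonzero. Reading at the end of the
  input delivers the blank symbol \<open>0\<close>.
\<close>

inductive exec :: "com \<Rightarrow> state \<Rightarrow> nat \<Rightarrow> state \<Rightarrow> bool" where
  Skip: "exec Skip s 1 s"
| Assign: "exec (Assign r e) s 1 (s\<lparr>regs := (regs s)(r := aval e s)\<rparr>)"
| Store: "exec (Store a i e) s 1
    (s\<lparr>arrs := (arrs s)(a := (arrs s a)(aval i s := aval e s))\<rparr>)"
| Read: "exec (Read r) s 1
    (s\<lparr>regs := (regs s)(r := (if inp s = [] then 0 else hd (inp s))), inp := tl (inp s)\<rparr>)"
| Print: "exec (Print e) s 1 (s\<lparr>outp := outp s @ [aval e s]\<rparr>)"
| Seq: "exec c1 s t1 s' \<Longrightarrow> exec c2 s' t2 s'' \<Longrightarrow> exec (Seq c1 c2) s (t1 + t2) s''"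
| CondTrue: "aval e s \<noteq> 0 \<Longrightarrow> exec c1 s t s' \<Longrightarrow> exec (Cond e c1 c2) s (t + 1) s'"
| CondFalse: "aval e s = 0 \<Longrightarrow> exec c2 s t s' \<Longrightarrow> exec (Cond e c1 c2) s (t + 1) s'"
| WhileFalse: "aval e s = 0 \<Longrightarrow> exec (While e c) s 1 s"
| WhileTrue: "aval e s \<noteq> 0 \<Longrightarrow> exec c s t1 s' \<Longrightarrow> exec (While e c) s' t2 s'' \<Longrightarrow>
    exec (While e c) s (t1 + t2 + 1) s''"

inductive_cases SkipE: "exec Skip s t s'"
inductive_cases AssignE: "exec (Assign r e) s t s'"
inductive_cases StoreE: "exec (Store a i e) s t s'"
inductive_cases ReadE: "exec (Read r) s t s'"
inductive_cases PrintE: "exec (Print e) s t s'"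
inductive_cases SeqE: "exec (Seq c1 c2) s t s'"
inductive_cases CondE: "exec (Cond e c1 c2) s t s'"
inductive_cases WhileE: "exec (While e c) s t s'"

lemma exec_deterministic:
  "exec c s t s' \<Longrightarrow> exec c s u s'' \<Longrightarrow> t = u \<and> s' = s''"
proof (induction arbitrary: u s'' rule: exec.induct)
  case (Skip s)
  then show ?case by (rule SkipE) simp
next
  case (Assign r e s)
  then show ?case by (rule AssignE) simp
next
  case (Store a i e s)
  then show ?case by (rule StoreE) simp
next
  case (Read r s)
  then show ?case by (rule ReadE) simp
next
  case (Print e s)
  then show ?case by (rule PrintE) simp
next
  case (Seq c1 s t1 s' c2 t2 s2)
  from Seq.prems show ?case by (rule SeqE) (metis Seq.IH)
next
  case (CondTrue e s c1 t s' c2)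
  from CondTrue.prems show ?case by (rule CondE) (auto simp: CondTrue.hyps(1) dest: CondTrue.IH)
next
  case (CondFalse e s c2 t s' c1)
  from CondFalse.prems show ?case by (rule CondE) (auto simp: CondFalse.hyps(1) dest: CondFalse.IH)
next
  case (WhileFalse e s c)
  from WhileFalse.prems show ?case by (rule WhileE) (simp_all add: WhileFalse.hyps)
next
  case (WhileTrue e s c t1 s' t2 s2)
  from WhileTrue.prems show ?case by (rule WhileE) (auto simp: WhileTrue.hyps(1) dest: WhileTrue.IH)
qed

definition init_state :: "nat list \<Rightarrow> state" where
  "init_state xs = \<lparr>regs = (\<lambda>_. 0), arrs = (\<lambda>_ _. 0), inp = xs, outp = []\<rparr>"

definition polytime_on_unary :: "(nat \<Rightarrow> nat list) \<Rightarrow> bool" where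
  "polytime_on_unary f \<longleftrightarrow>
     (\<exists>(c :: com) (q :: nat poly). \<forall>n. \<exists>t s.
        exec c (init_state (replicate n 1)) t s \<and> outp s = f n \<and> t \<le> poly q n)"

text \<open>A graph on \<open>{1..n}\<close> is output as its adjacency matrix, row by row.\<close>

definition encode_graph :: "nat \<Rightarrow> nat set set \<Rightarrow> nat list" where
  "encode_graph n E = concat (map (\<lambda>u. map (\<lambda>v. of_bool ({u, v} \<in> E)) [1..<n + 1]) [1..<n + 1])"

end

theory Submission
  imports Defs "HOL-Library.FuncSet" "HOL-Real_Asymp.Real_Asymp"
begin

text \<open>
  A component on \<open>s\<close> cells is given by 24 permutations of the cells. For most such tuples a set
  of at most half of the cells is enlarged by a factor above \<open>3/2\<close>, and no permutation moving half
  of the cells almost commutes with the tuple; moreover few tuples are close to conjugates of a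
  given one. A greedy choice therefore yields at least \<open>s!\<close> tuples that are pairwise far from being
  conjugate, so that \<open>s\<close> may be of order \<open>log n / log log n\<close>, and then all tuples and all maps
  between components can be enumerated in polynomial time. In a vertex permutation with few violated
  edges, expansion forces the bulk of every component into a single component, which must be the
  component itself; rigidity and again expansion show that hardly any of its cells moves.

  Each cell is blown up to 28 vertices, the vertex of role \<open>a\<close> having degree exactly \<open>a\<close>, so that
  the permutations can be recovered from the plain graph. One block of bounded size with a vertex of
  degree \<open>d\<close> and one component of up to twice the regular size absorb the remaining vertices.
\<close>

text \<open>Two demands meet in the component size \<open>s\<close>. Distinct codes are needed for
  all components, so \<open>s!\<close> must exceed their number; yet brute force runs through
  \<open>s ^ (24 * s)\<close> codes, which must stay polynomial in \<open>n\<close>. Since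
  \<open>s ^ s \<le> 3 ^ s * s!\<close>, twice the largest \<open>h\<close> with
  \<open>h! \<le> n\<close> meets both. The number 24 comes from union bounds: for a fixed witness,
  a bad event restricts each of 24 independent permutations, so its probability is a 24th power. For
  expansion this must beat the choice of a set and of an enlargement of it. For rigidity it must
  beat \<open>s!\<close> maps, although almost commuting with such a map removes only about
  \<open>s / 6\<close> of the \<open>s\<close> free values of a permutation. A plain graph shows
  neither labels nor directions, so roles are made visible by degree: a vertex whose adjacencies all
  survive keeps its degree, hence its role, and every other vertex is charged to a changed edge. The
  block may have any rigid shape, because its size is bounded independently of \<open>n\<close>: one
  changed edge pays for moving all of it.\<close>

section \<open>Polynomial-time computation of tables\<close>

text \<open>Variables are de Bruijn indices; \<open>TSum b e\<close> binds the summation index in \<open>e\<close>.\<close>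

datatype tm =
    TNum nat
  | TVar nat
  | TCell nat tm
  | TPlus tm tm
  | TMinus tm tm
  | TSum tm tm

primrec tval :: "tm \<Rightarrow> (nat \<Rightarrow> nat) \<Rightarrow> (nat \<Rightarrow> nat \<Rightarrow> nat) \<Rightarrow> nat" where
  "tval (TNum c) \<eta> A = c"
| "tval (TVar j) \<eta> A = \<eta> j"
| "tval (TCell a e) \<eta> A = A a (tval e \<eta> A)"
| "tval (TPlus e f) \<eta> A = tval e \<eta> A + tval f \<eta> A"
| "tval (TMinus e f) \<eta> A = tval e \<eta> A - tval f \<eta> A"
| "tval (TSum b e) \<eta> A = (\<Sum>i<tval b \<eta> A. tval e (case_nat i \<eta>) A)"

text \<open>The value is left in register \<open>t\<close>, all registers from \<open>t\<close> on being scratch space.\<close>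

primrec compile :: "tm \<Rightarrow> (nat \<Rightarrow> nat) \<Rightarrow> nat \<Rightarrow> com" where
  "compile (TNum c) \<rho> t = Assign t (Num c)"
| "compile (TVar j) \<rho> t = Assign t (Reg (\<rho> j))"
| "compile (TCell a e) \<rho> t = Seq (compile e \<rho> t) (Assign t (Cell a (Reg t)))"
| "compile (TPlus e f) \<rho> t =
    Seq (compile e \<rho> t) (Seq (compile f \<rho> (t + 1)) (Assign t (Plus (Reg t) (Reg (t + 1)))))"
| "compile (TMinus e f) \<rho> t =
    Seq (compile e \<rho> t) (Seq (compile f \<rho> (t + 1)) (Assign t (Minus (Reg t) (Reg (t + 1)))))"
| "compile (TSum b e) \<rho> t =
    Seq (compile b \<rho> t) (Seq (Assign (t + 1) (Num 0)) (Seq (Assign (t + 2) (Num 0)) (Seq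
      (While (Minus (Reg t) (Reg (t + 2)))
        (Seq (compile e (case_nat (t + 2) \<rho>) (t + 3))
          (Seq (Assign (t + 1) (Plus (Reg (t + 1)) (Reg (t + 3))))
            (Assign (t + 2) (Plus (Reg (t + 2)) (Num 1))))))
      (Assign t (Reg (t + 1))))))"

text \<open>All loops executed below make a number of passes known beforehand. An invariant indexed
  by the completed passes and one time bound \<open>T\<close> per pass therefore suffice; the
  induction is on the remaining passes.\<close>

lemma exec_counting_loop:
  assumes step: "\<And>i s. i < b \<Longrightarrow> I i s \<Longrightarrow>
      aval e s \<noteq> 0 \<and> (\<exists>t s'. exec c s t s' \<and> t \<le> T \<and> I (Suc i) s')"
    and stop: "\<And>s. I b s \<Longrightarrow> aval e s = 0"
    and "I 0 s"
  shows "\<exists>t s'. exec (While e c) s t s' \<and> t \<le> b * (T + 1) + 1 \<and> I b s'"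
proof -
  have "\<exists>t s'. exec (While e c) s t s' \<and> t \<le> m * (T + 1) + 1 \<and> I b s'"
    if "I i s" "i + m = b" for i m s
    using that
  proof (induction m arbitrary: i s)
    case 0
    then have I: "I b s" by simp
    have "exec (While e c) s 1 s" using stop[OF I] by (rule WhileFalse)
    with I show ?case by (intro exI[of _ 1] exI[of _ s]) simp
  next
    case (Suc m)
    then obtain t1 s1 where 1: "aval e s \<noteq> 0" "exec c s t1 s1" "t1 \<le> T" "I (Suc i) s1"
      using step[of i s] by auto
    obtain t2 s2 where 2: "exec (While e c) s1 t2 s2" "t2 \<le> m * (T + 1) + 1" "I b s2"
      using Suc.IH[OF 1(4)] Suc.prems by auto
    have "t1 + t2 + 1 \<le> Suc m * (T + 1) + 1" using 1(3) 2(2) by simp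
    with WhileTrue[OF 1(1,2) 2(1)] 2(3) show ?case by blast
  qed
  from this[of 0 s b] assms(3) show ?thesis by simp
qed

section \<open>Time and value bounds for compiled terms\<close>

text \<open>A single \<open>B\<close> bounds both time and value, since the value of one term may be
  the number of passes of a loop around another.\<close>

definition evaluates :: "tm \<Rightarrow> (nat \<Rightarrow> nat) \<Rightarrow> nat \<Rightarrow> state \<Rightarrow> nat \<Rightarrow> bool" where
  "evaluates e \<rho> t s B \<longleftrightarrow> (\<exists>u r. exec (compile e \<rho> t) s u (s\<lparr>regs := r\<rparr>) \<and> u \<le> B \<and>
     (\<forall>q<t. r q = regs s q) \<and> r t = tval e (\<lambda>j. regs s (\<rho> j)) (arrs s) \<and> r t \<le> B)"

lemma evaluatesI:
  assumes "exec (compile e \<rho> t) s u (s\<lparr>regs := r\<rparr>)" "u \<le> B" "\<And>q. q < t \<Longrightarrow> r q = regs s q"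
    "r t = tval e (\<lambda>j. regs s (\<rho> j)) (arrs s)" "r t \<le> B"
  shows "evaluates e \<rho> t s B"
  using assms unfolding evaluates_def by blast

text \<open>The exponent depends on the term alone, while \<open>X\<close> bounds everything the
  term can read, so composing terms becomes arithmetic on exponents. With base \<open>X + 2\<close>
  a factor 2 costs one more power.\<close>

definition compiles_within :: "tm \<Rightarrow> nat \<Rightarrow> bool" where
  "compiles_within e k \<longleftrightarrow> (\<forall>\<rho> t s X. (\<forall>j. \<rho> j < t) \<longrightarrow> (\<forall>j. regs s (\<rho> j) \<le> X) \<longrightarrow>
     (\<forall>a i. arrs s a i \<le> X) \<longrightarrow> evaluates e \<rho> t s ((X + 2) ^ k))"

lemma compiles_withinD:
  assumes "compiles_within e k" "\<And>j. \<rho> j < t" "\<And>j. regs s (\<rho> j) \<le> X" "\<And>a i. arrs s a i \<le> X"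
  obtains u r where "exec (compile e \<rho> t) s u (s\<lparr>regs := r\<rparr>)" "u \<le> (X + 2) ^ k"
    "\<And>q. q < t \<Longrightarrow> r q = regs s q" "r t = tval e (\<lambda>j. regs s (\<rho> j)) (arrs s)" "r t \<le> (X + 2) ^ k"
  using assms unfolding compiles_within_def evaluates_def by blast

lemma two_le_power_Suc: "2 * (X + 2 :: nat) ^ k \<le> (X + 2) ^ (k + 1)"
  by simp

lemma power_double_add: "(X + 2 :: nat) ^ k + (X + 2) ^ l \<le> (X + 2) ^ (k + l + 1)"
proof -
  have "(X + 2 :: nat) ^ k \<le> (X + 2) ^ (k + l)" "(X + 2 :: nat) ^ l \<le> (X + 2) ^ (k + l)"
    by (rule power_increasing; simp)+
  then have "(X + 2 :: nat) ^ k + (X + 2) ^ l \<le> 2 * (X + 2) ^ (k + l)" by linarith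
  also have "\<dots> \<le> (X + 2) ^ (k + l + 1)" using two_le_power_Suc[of X "k + l"] by simp
  finally show ?thesis .
qed

lemma power_add_bound:
  assumes "u \<le> (X + 2 :: nat) ^ k" "v \<le> (X + 2) ^ l"
  shows "u + (v + 1) \<le> (X + 2) ^ (k + l + 2)" "u + v \<le> (X + 2) ^ (k + l + 2)"
proof -
  have "2 * (X + 2) ^ (k + l + 1) \<le> (X + 2) ^ (k + l + 2)"
    using two_le_power_Suc[of X "k + l + 1"] by (simp add: add.assoc del: power_Suc)
  moreover have "1 \<le> (X + 2) ^ (k + l + 1)" by (rule one_le_power) simp
  ultimately show "u + (v + 1) \<le> (X + 2) ^ (k + l + 2)" "u + v \<le> (X + 2) ^ (k + l + 2)"
    using assms power_double_add[of X k l] by linarith+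
qed

text \<open>Addition and subtraction share this case: the right operand is compiled from register
  \<open>t + 1\<close> on, so the left value in register \<open>t\<close> survives.\<close>

lemma compiles_within_binop:
  assumes k: "compiles_within e k" and l: "compiles_within f l"
    and g: "\<And>\<rho> t. compile g \<rho> t = Seq (compile e \<rho> t) (Seq (compile f \<rho> (t + 1)) (Assign t (h t)))"
    and h: "\<And>t s. aval (h t) s = op (regs s t) (regs s (t + 1))"
    and val: "\<And>\<eta> A. tval g \<eta> A = op (tval e \<eta> A) (tval f \<eta> A)"
    and op: "\<And>x y. op x y \<le> x + y"
  shows "compiles_within g (k + l + 2)"
  unfolding compiles_within_def
proof (intro allI impI)
  fix \<rho> :: "nat \<Rightarrow> nat" and t X :: nat and s :: state
  assume \<rho>: "\<forall>j. \<rho> j < t" "\<forall>j. regs s (\<rho> j) \<le> X" and A: "\<forall>a i. arrs s a i \<le> X"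
  obtain u r where r: "exec (compile e \<rho> t) s u (s\<lparr>regs := r\<rparr>)" "u \<le> (X + 2) ^ k"
      "\<And>q. q < t \<Longrightarrow> r q = regs s q" "r t = tval e (\<lambda>j. regs s (\<rho> j)) (arrs s)" "r t \<le> (X + 2) ^ k"
    by (rule compiles_withinD[OF k, of \<rho> t s X]) (use \<rho> A in auto)
  obtain u' r' where r': "exec (compile f \<rho> (t + 1)) (s\<lparr>regs := r\<rparr>) u' (s\<lparr>regs := r'\<rparr>)" "u' \<le> (X + 2) ^ l"
      "\<And>q. q < t + 1 \<Longrightarrow> r' q = r q" "r' (t + 1) = tval f (\<lambda>j. regs s (\<rho> j)) (arrs s)"
      "r' (t + 1) \<le> (X + 2) ^ l"
    using compiles_withinD[OF l, of \<rho> "t + 1" "s\<lparr>regs := r\<rparr>" X] \<rho> A r(3)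
    by (auto simp: less_Suc_eq)
  let ?r = "r'(t := op (r' t) (r' (t + 1)))"
  show "evaluates g \<rho> t s ((X + 2) ^ (k + l + 2))"
  proof (rule evaluatesI[where u = "u + (u' + 1)" and r = ?r])
    show "exec (compile g \<rho> t) s (u + (u' + 1)) (s\<lparr>regs := ?r\<rparr>)"
      using exec.Seq[OF r(1) exec.Seq[OF r'(1) exec.Assign[of t "h t"]]] by (simp add: g h)
    show "u + (u' + 1) \<le> (X + 2) ^ (k + l + 2)" by (rule power_add_bound(1)[OF r(2) r'(2)])
    show "?r t \<le> (X + 2) ^ (k + l + 2)"
      using power_add_bound(2)[OF r(5) r'(5)] op[of "r' t" "r' (t + 1)"] r'(3)[of t] by simp
  qed (use r(3,4) r'(3,4) in \<open>auto simp: val\<close>)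
qed

lemma compiles_within_exists: "\<exists>k. compiles_within e k"
proof (induction e)
  case (TNum c)
  have "compiles_within (TNum c) (c + 1)"
    unfolding compiles_within_def
  proof (intro allI impI)
    fix \<rho> :: "nat \<Rightarrow> nat" and t X :: nat and s :: state
    have "c + 1 < (X + 2) ^ (c + 1)"
      by (rule order.strict_trans2[OF less_exp[of "c + 1"]]) (rule power_mono, auto)
    then show "evaluates (TNum c) \<rho> t s ((X + 2) ^ (c + 1))"
      using exec.Assign[of t "Num c" s] by (intro evaluatesI[where u = 1 and r = "(regs s)(t := c)"]) auto
  qed
  then show ?case ..
next
  case (TVar j)
  have "compiles_within (TVar j) 1"
    unfolding compiles_within_def
  proof (intro allI impI)
    fix \<rho> :: "nat \<Rightarrow> nat" and t X :: nat and s :: state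
    assume "\<forall>j. \<rho> j < t" "\<forall>j. regs s (\<rho> j) \<le> X"
    then show "evaluates (TVar j) \<rho> t s ((X + 2) ^ 1)"
      using exec.Assign[of t "Reg (\<rho> j)" s]
      by (intro evaluatesI[where u = 1 and r = "(regs s)(t := regs s (\<rho> j))"]) (auto intro: order_trans)
  qed
  then show ?case ..
next
  case (TCell a e)
  then obtain k where k: "compiles_within e k" ..
  have "compiles_within (TCell a e) (k + 1)"
    unfolding compiles_within_def
  proof (intro allI impI)
    fix \<rho> :: "nat \<Rightarrow> nat" and t X :: nat and s :: state
    assume \<rho>: "\<forall>j. \<rho> j < t" "\<forall>j. regs s (\<rho> j) \<le> X" and A: "\<forall>a i. arrs s a i \<le> X"
    obtain u r where r: "exec (compile e \<rho> t) s u (s\<lparr>regs := r\<rparr>)" "u \<le> (X + 2) ^ k"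
        "\<And>q. q < t \<Longrightarrow> r q = regs s q" "r t = tval e (\<lambda>j. regs s (\<rho> j)) (arrs s)"
      by (rule compiles_withinD[OF k, of \<rho> t s X]) (use \<rho> A in auto)
    let ?r = "r(t := arrs s a (r t))"
    show "evaluates (TCell a e) \<rho> t s ((X + 2) ^ (k + 1))"
    proof (rule evaluatesI[where u = "u + 1" and r = ?r])
      show "exec (compile (TCell a e) \<rho> t) s (u + 1) (s\<lparr>regs := ?r\<rparr>)"
        using exec.Seq[OF r(1) exec.Assign[of t "Cell a (Reg t)"]] by simp
      show "u + 1 \<le> (X + 2) ^ (k + 1)"
        using r(2) two_le_power_Suc[of X k] one_le_power[of "X + 2" k] by linarith
      have "(X + 2) ^ 1 \<le> (X + 2) ^ (k + 1)" by (rule power_increasing) auto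
      then have "X \<le> (X + 2) ^ (k + 1)" by simp
      then show "?r t \<le> (X + 2) ^ (k + 1)" unfolding fun_upd_same using A order_trans by blast
    qed (use r(3,4) in auto)
  qed
  then show ?case ..
next
  case (TPlus e f)
  then show ?case
    using compiles_within_binop[of e _ f _ "TPlus e f" "\<lambda>t. Plus (Reg t) (Reg (t + 1))" "(+)"] by force
next
  case (TMinus e f)
  then show ?case
    using compiles_within_binop[of e _ f _ "TMinus e f" "\<lambda>t. Minus (Reg t) (Reg (t + 1))" "(-)"] by force
next
  case (TSum b e)
  then obtain k l where k: "compiles_within b k" and l: "compiles_within e l" by auto
  \<comment> \<open>Inside the sum the index can come close to the bound, hence to
    \<open>(X + 2) ^ k\<close>. The body is therefore run with \<open>X'\<close> in place of
    \<open>X\<close>, where \<open>X' + 2 \<le> (X + 2) ^ (k + 2)\<close>.\<close>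
  define m where "m = (k + 2) * l"
  have "compiles_within (TSum b e) (k + m + 5)"
    unfolding compiles_within_def
  proof (intro allI impI)
    fix \<rho> :: "nat \<Rightarrow> nat" and t X :: nat and s :: state
    assume \<rho>: "\<forall>j. \<rho> j < t" "\<forall>j. regs s (\<rho> j) \<le> X" and A: "\<forall>a i. arrs s a i \<le> X"
    define \<eta> where "\<eta> = (\<lambda>j. regs s (\<rho> j))"
    obtain u r where r: "exec (compile b \<rho> t) s u (s\<lparr>regs := r\<rparr>)" "u \<le> (X + 2) ^ k"
        "\<And>q. q < t \<Longrightarrow> r q = regs s q" "r t = tval b \<eta> (arrs s)" "r t \<le> (X + 2) ^ k"
      by (rule compiles_withinD[OF k, of \<rho> t s X]) (use \<rho> A in \<open>auto simp: \<eta>_def\<close>)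
    define B where "B = tval b \<eta> (arrs s)"
    define X' where "X' = X + (X + 2) ^ k"
    have "X' + 2 \<le> (X + 2) ^ (k + 2)"
      using power_double_add[of X 1 k] by (simp add: X'_def)
    then have X': "(X' + 2) ^ l \<le> (X + 2) ^ m"
      unfolding m_def power_mult by (rule power_mono) simp
    have Bk: "B \<le> (X + 2) ^ k" using r(4,5) by (simp add: B_def)
    define F where "F i = tval e (case_nat i \<eta>) (arrs s)" for i
    define body where "body = Seq (compile e (case_nat (t + 2) \<rho>) (t + 3))
          (Seq (Assign (t + 1) (Plus (Reg (t + 1)) (Reg (t + 3))))
            (Assign (t + 2) (Plus (Reg (t + 2)) (Num 1))))"
    define I where "I i s' \<longleftrightarrow> (\<exists>r'. s' = s\<lparr>regs := r'\<rparr> \<and> (\<forall>q<t. r' q = regs s q) \<and> r' t = B \<and>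
      r' (t + 1) = (\<Sum>j<i. F j) \<and> r' (t + 2) = i \<and> r' (t + 1) \<le> i * (X + 2) ^ m)" for i s'
    define e0 where "e0 = Minus (Reg t) (Reg (t + 2))"
    have "\<exists>w s'. exec (While e0 body) (s\<lparr>regs := r(t + 1 := 0, t + 2 := 0)\<rparr>) w s' \<and>
        w \<le> B * ((X + 2) ^ m + 2 + 1) + 1 \<and> I B s'"
    proof (rule exec_counting_loop)
      show "I 0 (s\<lparr>regs := r(t + 1 := 0, t + 2 := 0)\<rparr>)"
        unfolding I_def using r(3,4) by (intro exI[of _ "r(t + 1 := 0, t + 2 := 0)"]) (auto simp: B_def)
      show "aval e0 s' = 0" if "I B s'" for s'
        using that unfolding I_def e0_def by auto
      show "aval e0 s' \<noteq> 0 \<and> (\<exists>w s''. exec body s' w s'' \<and> w \<le> (X + 2) ^ m + 2 \<and> I (Suc i) s'')"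
        if i: "i < B" and Ii: "I i s'" for i s'
      proof -
        from Ii obtain r' where r': "s' = s\<lparr>regs := r'\<rparr>" "\<And>q. q < t \<Longrightarrow> r' q = regs s q" "r' t = B"
            "r' (t + 1) = (\<Sum>j<i. F j)" "r' (t + 2) = i" "r' (t + 1) \<le> i * (X + 2) ^ m"
          unfolding I_def by auto
        let ?\<rho> = "case_nat (t + 2) \<rho>"
        have reg: "(\<lambda>j. r' (?\<rho> j)) = case_nat i \<eta>"
          using r'(2,5) \<rho>(1) by (auto simp: fun_eq_iff \<eta>_def split: nat.split)
        have \<rho>': "?\<rho> j < t + 3" for j
          using \<rho>(1) by (cases j) (simp_all add: trans_less_add1)
        have le: "r' (?\<rho> j) \<le> X'" for j
          using fun_cong[OF reg, of j] \<rho>(2) Bk i by (auto simp: X'_def \<eta>_def intro: trans_le_add1 split: nat.split)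
        obtain v r'' where r'': "exec (compile e ?\<rho> (t + 3)) s' v (s'\<lparr>regs := r''\<rparr>)" "v \<le> (X' + 2) ^ l"
            "\<And>q. q < t + 3 \<Longrightarrow> r'' q = r' q" "r'' (t + 3) = F i" "r'' (t + 3) \<le> (X' + 2) ^ l"
        proof (rule compiles_withinD[OF l, of ?\<rho> "t + 3" s' X'])
          show "regs s' (?\<rho> j) \<le> X'" for j using le by (simp add: r'(1))
          show "arrs s' a j \<le> X'" for a j using A by (auto simp: r'(1) X'_def intro: trans_le_add1)
        qed (use \<rho>' reg in \<open>auto simp: F_def r'(1)\<close>)
        let ?r = "r''(t + 1 := r'' (t + 1) + r'' (t + 3), t + 2 := r'' (t + 2) + 1)"
        have "exec body s' (v + (1 + 1)) (s'\<lparr>regs := ?r\<rparr>)"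
          using exec.Seq[OF r''(1) exec.Seq[OF exec.Assign[of "t + 1" "Plus (Reg (t + 1)) (Reg (t + 3))"]
            exec.Assign[of "t + 2" "Plus (Reg (t + 2)) (Num 1)"]]]
          by (simp add: body_def)
        moreover have "v + (1 + 1) \<le> (X + 2) ^ m + 2" using r''(2) X' by simp
        moreover have "I (Suc i) (s'\<lparr>regs := ?r\<rparr>)"
          unfolding I_def using r'(1,2,3,4,5,6) r''(3,4,5) X'
          by (intro exI[of _ ?r]) auto
        moreover have "aval e0 s' \<noteq> 0" using i r' by (simp add: e0_def)
        ultimately show ?thesis by blast
      qed
    qed
    then obtain w r' where w: "exec (While e0 body) (s\<lparr>regs := r(t + 1 := 0, t + 2 := 0)\<rparr>) w (s\<lparr>regs := r'\<rparr>)"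
        "w \<le> B * ((X + 2) ^ m + 2 + 1) + 1" "\<And>q. q < t \<Longrightarrow> r' q = regs s q"
        "r' (t + 1) = (\<Sum>j<B. F j)" "r' (t + 1) \<le> B * (X + 2) ^ m"
      unfolding I_def by auto
    let ?r = "r'(t := r' (t + 1))"
    have "exec (compile (TSum b e) \<rho> t) s (u + (1 + (1 + (w + 1)))) (s\<lparr>regs := ?r\<rparr>)"
    proof -
      have a1: "exec (Assign (t + 1) (Num 0)) (s\<lparr>regs := r\<rparr>) 1 (s\<lparr>regs := r(t + 1 := 0)\<rparr>)"
        using exec.Assign[of "t + 1" "Num 0" "s\<lparr>regs := r\<rparr>"] by simp
      have a2: "exec (Assign (t + 2) (Num 0)) (s\<lparr>regs := r(t + 1 := 0)\<rparr>) 1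
          (s\<lparr>regs := r(t + 1 := 0, t + 2 := 0)\<rparr>)"
        using exec.Assign[of "t + 2" "Num 0" "s\<lparr>regs := r(t + 1 := 0)\<rparr>"] by simp
      have a3: "exec (Assign t (Reg (t + 1))) (s\<lparr>regs := r'\<rparr>) 1 (s\<lparr>regs := ?r\<rparr>)"
        using exec.Assign[of t "Reg (t + 1)" "s\<lparr>regs := r'\<rparr>"] by simp
      show ?thesis
        using exec.Seq[OF r(1) exec.Seq[OF a1 exec.Seq[OF a2 exec.Seq[OF w(1) a3]]]]
        by (simp only: compile.simps e0_def body_def)
    qed
    moreover
    let ?P = "(X + 2) ^ (k + m)"
    have P: "B * (X + 2) ^ m \<le> ?P" "1 \<le> ?P" "B \<le> ?P" "u \<le> ?P"
    proof -
      show "B * (X + 2) ^ m \<le> ?P" using Bk by (simp add: power_add)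
      show "1 \<le> ?P" by simp
      have "(X + 2) ^ k \<le> ?P" by (rule power_increasing) auto
      then show "B \<le> ?P" "u \<le> ?P" using order_trans[OF Bk] order_trans[OF r(2)] by blast+
    qed
    \<comment> \<open>Five extra powers absorb the constants; the total time is at most nine times
      \<open>?P\<close>.\<close>
    have "32 * ?P \<le> (X + 2) ^ (k + m + 5)"
    proof -
      have "(2::nat) ^ 5 \<le> (X + 2) ^ 5" by (rule power_mono) auto
      then show ?thesis by (simp add: power_add mult.commute)
    qed
    then have "u + (1 + (1 + (w + 1))) \<le> (X + 2) ^ (k + m + 5)" "r' (t + 1) \<le> (X + 2) ^ (k + m + 5)"
    proof -
      have "B * ((X + 2) ^ m + 2 + 1) = B * (X + 2) ^ m + 3 * B" by (simp add: algebra_simps)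
      then show "u + (1 + (1 + (w + 1))) \<le> (X + 2) ^ (k + m + 5)" "r' (t + 1) \<le> (X + 2) ^ (k + m + 5)"
        using w(2,5) P \<open>32 * ?P \<le> (X + 2) ^ (k + m + 5)\<close> by linarith+
    qed
    ultimately show "evaluates (TSum b e) \<rho> t s ((X + 2) ^ (k + m + 5))"
      using w(3,4) by (intro evaluatesI[where u = "u + (1 + (1 + (w + 1)))" and r = ?r])
        (auto simp: B_def F_def \<eta>_def)
  qed
  then show ?case ..
qed

section \<open>Closure properties of term-definable functions\<close>

text \<open>Passing from terms to the functions they denote lets an algorithm be recognised by
  unfolding it and applying \<open>cmp_intros\<close>. Predicates enter through
  \<open>of_bool\<close>.\<close>

definition cmp :: "((nat \<Rightarrow> nat) \<Rightarrow> (nat \<Rightarrow> nat \<Rightarrow> nat) \<Rightarrow> nat) \<Rightarrow> bool" where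
  "cmp f \<longleftrightarrow> (\<exists>e. \<forall>\<eta> A. tval e \<eta> A = f \<eta> A)"

named_theorems cmp_intros

lemma cmp_num [cmp_intros]: "cmp (\<lambda>\<eta> A. c)"
  unfolding cmp_def by (intro exI[of _ "TNum c"]) simp

lemma cmp_var [cmp_intros]: "cmp (\<lambda>\<eta> A. \<eta> j)"
  unfolding cmp_def by (intro exI[of _ "TVar j"]) simp

lemma cmp_cell [cmp_intros]: "cmp f \<Longrightarrow> cmp (\<lambda>\<eta> A. A a (f \<eta> A))"
  unfolding cmp_def by (metis tval.simps(3))

lemma cmp_plus [cmp_intros]: "cmp f \<Longrightarrow> cmp g \<Longrightarrow> cmp (\<lambda>\<eta> A. f \<eta> A + g \<eta> A)"
  unfolding cmp_def by (metis tval.simps(4))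

lemma cmp_minus [cmp_intros]: "cmp f \<Longrightarrow> cmp g \<Longrightarrow> cmp (\<lambda>\<eta> A. f \<eta> A - g \<eta> A)"
  unfolding cmp_def by (metis tval.simps(5))

lemma cmp_sum [cmp_intros]:
  assumes "cmp b" "cmp (\<lambda>\<eta> A. g (\<eta> 0) (\<lambda>j. \<eta> (Suc j)) A)"
  shows "cmp (\<lambda>\<eta> A. \<Sum>i<b \<eta> A. g i \<eta> A)"
proof -
  from assms obtain e f where "\<And>\<eta> A. tval e \<eta> A = b \<eta> A"
    and "\<And>\<eta> A. tval f \<eta> A = g (\<eta> 0) (\<lambda>j. \<eta> (Suc j)) A"
    unfolding cmp_def by auto
  then show ?thesis unfolding cmp_def by (intro exI[of _ "TSum e f"]) simp
qed

text \<open>Renaming of variables, lifted under binders; it serves to place a term below one more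
  summation sign.\<close>

primrec shift :: "(nat \<Rightarrow> nat) \<Rightarrow> tm \<Rightarrow> tm" where
  "shift r (TNum c) = TNum c"
| "shift r (TVar j) = TVar (r j)"
| "shift r (TCell a e) = TCell a (shift r e)"
| "shift r (TPlus e f) = TPlus (shift r e) (shift r f)"
| "shift r (TMinus e f) = TMinus (shift r e) (shift r f)"
| "shift r (TSum b e) = TSum (shift r b) (shift (case_nat 0 (\<lambda>j. Suc (r j))) e)"

lemma tval_shift: "tval (shift r e) \<eta> A = tval e (\<lambda>j. \<eta> (r j)) A"
proof (induction e arbitrary: r \<eta>)
  case (TSum b e)
  have "(\<lambda>j. case_nat i \<eta> (case_nat 0 (\<lambda>j. Suc (r j)) j)) = case_nat i (\<lambda>j. \<eta> (r j))" for i
    by (auto simp: fun_eq_iff split: nat.split)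
  then show ?case by (simp add: TSum)
qed auto

lemma cmp_shift: "cmp f \<Longrightarrow> cmp (\<lambda>\<eta> A. f (\<lambda>j. \<eta> (Suc j)) A)"
  unfolding cmp_def by (metis tval_shift)

text \<open>The machine has no multiplication, so a product is a sum of equal terms; the second
  factor moves under the binder, hence \<open>cmp_shift\<close>.\<close>

lemma cmp_times [cmp_intros]:
  assumes "cmp f" "cmp g" shows "cmp (\<lambda>\<eta> A. f \<eta> A * g \<eta> A)"
  using cmp_sum[OF assms(1) cmp_shift[OF assms(2)]] by simp

lemma cmp_le [cmp_intros]:
  assumes "cmp f" "cmp g" shows "cmp (\<lambda>\<eta> A. of_bool (f \<eta> A \<le> g \<eta> A))"
proof -
  have "(\<lambda>\<eta> A. of_bool (f \<eta> A \<le> g \<eta> A)) = (\<lambda>\<eta> A. 1 - (f \<eta> A - g \<eta> A))"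
    by (auto simp: fun_eq_iff)
  then show ?thesis by (simp only:) (intro cmp_intros assms)
qed

lemma cmp_less [cmp_intros]:
  assumes "cmp f" "cmp g" shows "cmp (\<lambda>\<eta> A. of_bool (f \<eta> A < g \<eta> A))"
  using cmp_le[OF cmp_plus[OF assms(1) cmp_num[of 1]] assms(2)] by (simp add: Suc_le_eq)

lemma cmp_conj [cmp_intros]:
  assumes "cmp (\<lambda>\<eta> A. of_bool (P \<eta> A))" "cmp (\<lambda>\<eta> A. of_bool (Q \<eta> A))"
  shows "cmp (\<lambda>\<eta> A. of_bool (P \<eta> A \<and> Q \<eta> A))"
  using cmp_times[OF assms] by (simp only: of_bool_conj)

lemma cmp_not [cmp_intros]:
  assumes "cmp (\<lambda>\<eta> A. of_bool (P \<eta> A))" shows "cmp (\<lambda>\<eta> A. of_bool (\<not> P \<eta> A))"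
  proof -
  have "(\<lambda>\<eta> A. of_bool (\<not> P \<eta> A)) = (\<lambda>\<eta> A. 1 - (of_bool (P \<eta> A) :: nat))"
    by (auto simp: fun_eq_iff of_bool_def)
  then show ?thesis by (simp only:) (intro cmp_num cmp_minus assms)
qed

lemma cmp_disj [cmp_intros]:
  assumes "cmp (\<lambda>\<eta> A. of_bool (P \<eta> A))" "cmp (\<lambda>\<eta> A. of_bool (Q \<eta> A))"
  shows "cmp (\<lambda>\<eta> A. of_bool (P \<eta> A \<or> Q \<eta> A))"
  using cmp_not[OF cmp_conj[OF cmp_not[OF assms(1)] cmp_not[OF assms(2)]]] by (simp only: de_Morgan_conj not_not)

lemma cmp_imp [cmp_intros]:
  assumes "cmp (\<lambda>\<eta> A. of_bool (P \<eta> A))" "cmp (\<lambda>\<eta> A. of_bool (Q \<eta> A))"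
  shows "cmp (\<lambda>\<eta> A. of_bool (P \<eta> A \<longrightarrow> Q \<eta> A))"
  using cmp_disj[OF cmp_not[OF assms(1)] assms(2)] by (simp only: imp_conv_disj)

lemma cmp_eq [cmp_intros]:
  assumes "cmp f" "cmp g" shows "cmp (\<lambda>\<eta> A. of_bool (f \<eta> A = g \<eta> A))"
  using cmp_conj[OF cmp_le[OF assms] cmp_le[OF assms(2,1)]] by (simp only: order.eq_iff)

text \<open>The sum counts violations, and truncated subtraction from 1 tests whether there are
  none.\<close>

lemma cmp_all [cmp_intros]:
  assumes "cmp b" "cmp (\<lambda>\<eta> A. of_bool (P (\<eta> 0) (\<lambda>j. \<eta> (Suc j)) A))"
  shows "cmp (\<lambda>\<eta> A. of_bool (\<forall>i<b \<eta> A. P i \<eta> A))"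
proof -
  have "cmp (\<lambda>\<eta> A. 1 - (\<Sum>i<b \<eta> A. 1 - of_bool (P i \<eta> A)))"
    by (intro cmp_intros assms)
  moreover have "1 - (\<Sum>i<b \<eta> A. 1 - of_bool (P i \<eta> A)) = (of_bool (\<forall>i<b \<eta> A. P i \<eta> A) :: nat)" for \<eta> A
  proof (cases "\<forall>i<b \<eta> A. P i \<eta> A")
    case False
    then have "(\<Sum>i<b \<eta> A. 1 - of_bool (P i \<eta> A)) > (0::nat)" by (auto intro!: sum_pos2)
    then have "1 - (\<Sum>i<b \<eta> A. 1 - of_bool (P i \<eta> A)) = (0::nat)" by linarith
    also have "0 = of_bool (\<forall>i<b \<eta> A. P i \<eta> A)" using False by auto
    finally show ?thesis .
  qed simp
  ultimately show ?thesis by simp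
qed

lemma cmp_ex [cmp_intros]:
  assumes "cmp b" "cmp (\<lambda>\<eta> A. of_bool (P (\<eta> 0) (\<lambda>j. \<eta> (Suc j)) A))"
  shows "cmp (\<lambda>\<eta> A. of_bool (\<exists>i<b \<eta> A. P i \<eta> A))"
  using cmp_not[OF cmp_all[OF assms(1) cmp_not[OF assms(2)]]] by simp

lemma cmp_if [cmp_intros]:
  assumes "cmp (\<lambda>\<eta> A. of_bool (P \<eta> A))" "cmp f" "cmp g"
  shows "cmp (\<lambda>\<eta> A. if P \<eta> A then f \<eta> A else g \<eta> A)"
proof -
  have "(\<lambda>\<eta> A. if P \<eta> A then f \<eta> A else g \<eta> A) =
      (\<lambda>\<eta> A. of_bool (P \<eta> A) * f \<eta> A + (1 - of_bool (P \<eta> A)) * g \<eta> A)"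
    by (auto simp: fun_eq_iff)
  then show ?thesis by (simp only:) (intro cmp_intros assms)
qed

lemma cmp_of_bool_if [cmp_intros]:
  assumes "cmp (\<lambda>\<eta> A. of_bool (P \<eta> A))" "cmp (\<lambda>\<eta> A. of_bool (Q \<eta> A))" "cmp (\<lambda>\<eta> A. of_bool (R \<eta> A))"
  shows "cmp (\<lambda>\<eta> A. of_bool (if P \<eta> A then Q \<eta> A else R \<eta> A))"
proof -
  have "(\<lambda>\<eta> A. of_bool (if P \<eta> A then Q \<eta> A else R \<eta> A)) =
      (\<lambda>\<eta> A. if P \<eta> A then of_bool (Q \<eta> A) else (of_bool (R \<eta> A) :: nat))"
    by (auto simp: fun_eq_iff)
  then show ?thesis by (simp only:) (intro cmp_intros assms)
qed

lemma cmp_card [cmp_intros]: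
  assumes "cmp b" "cmp (\<lambda>\<eta> A. of_bool (P (\<eta> 0) (\<lambda>j. \<eta> (Suc j)) A))"
  shows "cmp (\<lambda>\<eta> A. card {i. i < b \<eta> A \<and> P i \<eta> A})"
proof -
  have "card {i. i < B \<and> Q i} = (\<Sum>i<B. of_bool (Q i))" for B and Q :: "nat \<Rightarrow> bool"
    by (simp add: Collect_conj_eq lessThan_def)
  then show ?thesis by (simp only:) (intro cmp_intros assms)
qed

text \<open>Counting positive multiples of \<open>y\<close> turns division into a case of
  \<open>cmp_card\<close>; the conjunct \<open>0 < y\<close> reproduces
  \<open>x div 0 = 0\<close>.\<close>

lemma div_eq_card: "x div y = card {i. i < x \<and> 0 < y \<and> (i + 1) * y \<le> (x::nat)}"
proof (cases "y = 0")
  case False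
  have "{i. i < x \<and> 0 < y \<and> (i + 1) * y \<le> x} = {..<x div y}"
  proof (intro set_eqI iffI)
    fix i assume "i \<in> {i. i < x \<and> 0 < y \<and> (i + 1) * y \<le> x}"
    then have "(i + 1) * y \<le> x" by simp
    then show "i \<in> {..<x div y}" using False by (simp add: less_eq_div_iff_mult_less_eq flip: Suc_le_eq)
  next
    fix i assume i: "i \<in> {..<x div y}"
    then have "(i + 1) * y \<le> x" using False by (simp add: less_eq_div_iff_mult_less_eq flip: Suc_le_eq)
    moreover have "i < x" using i div_le_dividend[of x y] by (simp del: div_le_dividend)
    ultimately show "i \<in> {i. i < x \<and> 0 < y \<and> (i + 1) * y \<le> x}" using False by simp
  qed
  then show ?thesis by simp
qed simp

lemma cmp_div [cmp_intros]:
  assumes "cmp f" "cmp g" shows "cmp (\<lambda>\<eta> A. f \<eta> A div g \<eta> A)"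
  unfolding div_eq_card by (intro cmp_intros assms cmp_shift)

lemma cmp_mod [cmp_intros]:
  assumes "cmp f" "cmp g" shows "cmp (\<lambda>\<eta> A. f \<eta> A mod g \<eta> A)"
  unfolding minus_div_mult_eq_mod[symmetric] by (intro cmp_intros assms)

lemma cmp_min [cmp_intros]:
  assumes "cmp f" "cmp g" shows "cmp (\<lambda>\<eta> A. min (f \<eta> A) (g \<eta> A))"
  unfolding min_def by (intro cmp_intros assms)

section \<open>Programs that fill arrays\<close>

text \<open>Apart from the registers the final state is described completely, with zeros in all
  further arrays. So a program for one more table can be appended, and entries not yet filled are
  known to read 0.\<close>

definition tables :: "nat \<Rightarrow> (nat \<Rightarrow> nat \<Rightarrow> nat \<Rightarrow> nat) \<Rightarrow> bool" where
  "tables m T \<longleftrightarrow> (\<exists>c k. \<forall>n. (\<forall>a<m. \<forall>i. T n a i \<le> (n + 2) ^ k) \<and>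
     (\<exists>t r. exec c (init_state (replicate n 1)) t
        \<lparr>regs = r, arrs = (\<lambda>a i. if a < m then T n a i else 0), inp = [], outp = []\<rparr> \<and>
        r 0 = n \<and> t \<le> (n + 2) ^ k))"

text \<open>The unary input becomes a number: register 1 holds the last symbol read, so the blank 0
  after the input ends the loop when register 0 has reached \<open>n\<close>.\<close>

lemma tables_0: "tables 0 T"
proof -
  define body where "body = Seq (Assign 0 (Plus (Reg 0) (Num 1))) (Read 1)"
  define S :: "(nat \<Rightarrow> nat) \<Rightarrow> nat \<Rightarrow> state"
    where "S r j = \<lparr>regs = r, arrs = (\<lambda>_ _. 0), inp = replicate j 1, outp = []\<rparr>" for r j
  have rd: "exec (Read 1) (S r j) 1 (S (r(1 := of_bool (0 < j))) (j - 1))" for r j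
    using exec.Read[of 1 "S r j"] by (cases j) (simp_all add: S_def)
  have as: "exec (Assign 0 (Plus (Reg 0) (Num 1))) (S r j) 1 (S (r(0 := r 0 + 1)) j)" for r j
    using exec.Assign[of 0 "Plus (Reg 0) (Num 1)" "S r j"] by (simp add: S_def)
  have bd: "exec body (S r j) 2 (S (r(0 := r 0 + 1, 1 := of_bool (0 < j))) (j - 1))" for r j
    using exec.Seq[OF as rd, of r j] unfolding body_def one_add_one .
  define I where "I n i s \<longleftrightarrow> (\<exists>r. s = S r (n - i - 1) \<and> r 0 = i \<and> r 1 = of_bool (i < n))" for n i s
  have "\<exists>t r. exec (Seq (Read 1) (While (Reg 1) body)) (init_state (replicate n 1)) t
        \<lparr>regs = r, arrs = (\<lambda>_ _. 0), inp = [], outp = []\<rparr> \<and>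
        r 0 = n \<and> t \<le> (n + 2) ^ 3" for n
  proof -
    let ?s = "S ((\<lambda>_. 0)(1 := of_bool (0 < n))) (n - 1)"
    have "\<exists>t s'. exec (While (Reg 1) body) ?s t s' \<and> t \<le> n * (2 + 1) + 1 \<and> I n n s'"
    proof (rule exec_counting_loop[where I = "I n"])
      show "I n 0 ?s"
        unfolding I_def by (rule exI[of _ "(\<lambda>_. 0)(1 := of_bool (0 < n))"]) simp
      show "aval (Reg 1) s = 0" if "I n n s" for s using that by (auto simp: I_def S_def)
      show "aval (Reg 1) s \<noteq> 0 \<and> (\<exists>t s'. exec body s t s' \<and> t \<le> 2 \<and> I n (Suc i) s')"
        if "i < n" "I n i s" for i s
      proof -
        from that obtain r where r: "s = S r (n - i - 1)" "r 0 = i" "r 1 = of_bool (i < n)"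
          unfolding I_def by auto
        have "I n (Suc i) (S (r(0 := r 0 + 1, 1 := of_bool (0 < n - i - 1))) (n - i - 1 - 1))"
          unfolding I_def using r
          by (intro exI[of _ "r(0 := r 0 + 1, 1 := of_bool (0 < n - i - 1))"]) (simp add: less_diff_conv)
        with bd[of r "n - i - 1"] r that(1) show ?thesis
          by (auto simp: S_def)
      qed
    qed
    then obtain t r where t: "exec (While (Reg 1) body) ?s t (S r 0)" "t \<le> n * 3 + 1" "r 0 = n"
      unfolding I_def by auto
    have "exec (Read 1) (init_state (replicate n 1)) 1 ?s"
      using rd[of "\<lambda>_. 0" n] by (simp add: init_state_def S_def)
    from exec.Seq[OF this t(1)] have "exec (Seq (Read 1) (While (Reg 1) body)) (init_state (replicate n 1)) (1 + t)
        \<lparr>regs = r, arrs = (\<lambda>_ _. 0), inp = [], outp = []\<rparr>" by (simp add: S_def)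
    moreover have "1 + (n * 3 + 1) \<le> (n + 2) ^ 3" by (simp add: power3_eq_cube algebra_simps)
    ultimately show ?thesis using t by (intro exI[of _ "1 + t"] exI[of _ r]) linarith
  qed
  then show ?thesis unfolding tables_def
    by (intro exI[of _ "Seq (Read 1) (While (Reg 1) body)"] exI[of _ 3]) simp
qed

lemma poly_time_combine:
  assumes "B \<le> (n + 2 :: nat) ^ k" "C \<le> (n + 2) ^ l" "D \<le> (n + 2) ^ m"
  shows "D + B + B * (C + 5) + 10 \<le> (n + 2) ^ (k + l + m + 6)"
proof -
  let ?P = "(n + 2) ^ (k + l + m)"
  have P: "(n + 2) ^ j \<le> ?P" if "j \<le> k + l + m" for j using that by (intro power_increasing) auto
  have "B * C \<le> (n + 2) ^ k * (n + 2) ^ l" using assms by (intro mult_mono) auto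
  also have "\<dots> \<le> ?P" using P[of "k + l"] by (simp add: power_add)
  finally have "B * C \<le> ?P" .
  moreover have "B \<le> ?P" "D \<le> ?P" "1 \<le> ?P"
    using order_trans[OF assms(1) P[of k]] order_trans[OF assms(3) P[of m]] by simp_all
  moreover have "B * (C + 5) = B * C + 5 * B" by (simp add: algebra_simps)
  ultimately have "D + B + B * (C + 5) + 10 \<le> 64 * ?P" by linarith
  also have "(64::nat) \<le> (n + 2) ^ 6" using power_mono[of 2 "n + 2" 6] by simp
  then have "64 * ?P \<le> (n + 2) ^ 6 * ?P" by (rule mult_le_mono1)
  also have "\<dots> = (n + 2) ^ (k + l + m + 6)" by (simp add: power_add)
  finally show ?thesis .
qed

text \<open>Registers 0 and 1 hold the size \<open>n\<close> and the index of the current entry; register 2 holds the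
  number of entries.\<close>

lemma exec_bound:
  assumes "cmp (\<lambda>\<eta>. b (\<eta> 0))" "cmp (\<lambda>\<eta>. f (\<eta> 0) (\<eta> 1))"
  shows "\<exists>cb cf k.
    (\<forall>s X. regs s 0 \<le> X \<longrightarrow> (\<forall>a i. arrs s a i \<le> X) \<longrightarrow>
      (\<exists>u r. exec cb s u (s\<lparr>regs := r\<rparr>) \<and> u \<le> (X + 2) ^ k \<and> r 0 = regs s 0 \<and> r 1 = 0 \<and>
        r 2 = b (regs s 0) (arrs s) \<and> r 2 \<le> (X + 2) ^ k)) \<and>
    (\<forall>s X. regs s 0 \<le> X \<longrightarrow> regs s 1 \<le> X \<longrightarrow> (\<forall>a i. arrs s a i \<le> X) \<longrightarrow>
      (\<exists>u r. exec cf s u (s\<lparr>regs := r\<rparr>) \<and> u \<le> (X + 2) ^ k \<and> r 0 = regs s 0 \<and> r 1 = regs s 1 \<and>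
        r 2 = regs s 2 \<and> r 3 = f (regs s 0) (regs s 1) (arrs s)))"
proof -
  obtain eb ef where eb: "\<And>\<eta> A. tval eb \<eta> A = b (\<eta> 0) A" and ef: "\<And>\<eta> A. tval ef \<eta> A = f (\<eta> 0) (\<eta> 1) A"
    using assms unfolding cmp_def by blast
  obtain kb kf where kb: "compiles_within eb kb" and kf: "compiles_within ef kf"
    using compiles_within_exists by meson
  define k where "k = kb + kf + 1"
  have k: "(X + 2) ^ kb \<le> (X + 2) ^ k" "(X + 2) ^ kf \<le> (X + 2) ^ k" for X :: nat
    unfolding k_def by (rule power_increasing; simp)+
  \<comment> \<open>The environment must be total, so all variables from 1 on share register 1;
    \<open>f\<close> looks only at variables 0 and 1.\<close>
  let ?\<rho> = "\<lambda>j::nat. if j = 0 then 0 else 1 :: nat"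
  show ?thesis
  proof (rule exI[of _ "Seq (compile eb (\<lambda>_. 0) 2) (Assign 1 (Num 0))"],
      rule exI[of _ "compile ef ?\<rho> 3"], rule exI[of _ k], intro conjI allI impI)
    fix s :: state and X assume X: "regs s 0 \<le> X" "\<forall>a i. arrs s a i \<le> X"
    obtain u r where r: "exec (compile eb (\<lambda>_. 0) 2) s u (s\<lparr>regs := r\<rparr>)" "u \<le> (X + 2) ^ kb"
      "\<And>q. q < 2 \<Longrightarrow> r q = regs s q" "r 2 = tval eb (\<lambda>j. regs s 0) (arrs s)" "r 2 \<le> (X + 2) ^ kb"
      by (rule compiles_withinD[OF kb, of "\<lambda>_. 0" 2 s X]) (use X in auto)
    have "exec (Seq (compile eb (\<lambda>_. 0) 2) (Assign 1 (Num 0))) s (u + 1) (s\<lparr>regs := r(1 := 0)\<rparr>)"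
      using exec.Seq[OF r(1) exec.Assign[of 1 "Num 0"]] by simp
    moreover have "(X + 2) ^ kb + 1 \<le> (X + 2) ^ k"
    proof -
      have "1 \<le> (X + 2) ^ kf" by (rule one_le_power) simp
      then show ?thesis using power_double_add[of X kb kf] unfolding k_def by linarith
    qed
    ultimately show "\<exists>u r. exec (Seq (compile eb (\<lambda>_. 0) 2) (Assign 1 (Num 0))) s u (s\<lparr>regs := r\<rparr>) \<and>
        u \<le> (X + 2) ^ k \<and> r 0 = regs s 0 \<and> r 1 = 0 \<and> r 2 = b (regs s 0) (arrs s) \<and> r 2 \<le> (X + 2) ^ k"
      using r(2-5) k(1)[of X]
      by (intro exI[of _ "u + 1"] exI[of _ "r(1 := 0)"]) (auto simp: eb)
  next
    fix s :: state and X assume X: "regs s 0 \<le> X" "regs s 1 \<le> X" "\<forall>a i. arrs s a i \<le> X"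
    obtain u r where r: "exec (compile ef ?\<rho> 3) s u (s\<lparr>regs := r\<rparr>)" "u \<le> (X + 2) ^ kf"
      "\<And>q. q < 3 \<Longrightarrow> r q = regs s q" "r 3 = tval ef (\<lambda>j. regs s (?\<rho> j)) (arrs s)"
      by (rule compiles_withinD[OF kf, of ?\<rho> 3 s X]) (use X in auto)
    then show "\<exists>u r. exec (compile ef ?\<rho> 3) s u (s\<lparr>regs := r\<rparr>) \<and> u \<le> (X + 2) ^ k \<and> r 0 = regs s 0 \<and>
        r 1 = regs s 1 \<and> r 2 = regs s 2 \<and> r 3 = f (regs s 0) (regs s 1) (arrs s)"
      using order_trans[OF r(2) k(2)] by (intro exI[of _ u] exI[of _ r]) (auto simp: ef)
  qed
qed

text \<open>\<open>w\<close> is the single command, \<open>Store\<close> or \<open>Print\<close>, by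
  which a pass uses the value in register 3. The contents \<open>A i\<close> and the output
  \<open>Q i\<close> before pass \<open>i\<close> are prescribed, so one loop serves both purposes;
  every intermediate content is bounded because the expressions read it.\<close>

definition runs_for where
  "runs_for w b f c k \<longleftrightarrow> (\<forall>n X A Q r0. n \<le> X \<longrightarrow> (\<forall>i\<le>b n (A 0). \<forall>a j. A i a j \<le> X) \<longrightarrow>
     r0 0 = n \<longrightarrow>
     (\<forall>i<b n (A 0). \<forall>r. r 1 = i \<longrightarrow> r 3 = f n i (A i) \<longrightarrow>
        exec w \<lparr>regs = r, arrs = A i, inp = [], outp = Q i\<rparr> 1
          \<lparr>regs = r, arrs = A (Suc i), inp = [], outp = Q (Suc i)\<rparr>) \<longrightarrow>
     (\<exists>t r. exec c \<lparr>regs = r0, arrs = A 0, inp = [], outp = Q 0\<rparr> t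
          \<lparr>regs = r, arrs = A (b n (A 0)), inp = [], outp = Q (b n (A 0))\<rparr> \<and>
        t \<le> (X + 2) ^ k \<and> r 0 = n))"

lemma runs_forD:
  assumes "runs_for w b f c k" "n \<le> X" "\<And>i a j. i \<le> b n (A 0) \<Longrightarrow> A i a j \<le> X" "r0 0 = n"
    "\<And>i r. i < b n (A 0) \<Longrightarrow> r 1 = i \<Longrightarrow> r 3 = f n i (A i) \<Longrightarrow>
        exec w \<lparr>regs = r, arrs = A i, inp = [], outp = Q i\<rparr> 1
          \<lparr>regs = r, arrs = A (Suc i), inp = [], outp = Q (Suc i)\<rparr>"
  shows "\<exists>t r. exec c \<lparr>regs = r0, arrs = A 0, inp = [], outp = Q 0\<rparr> t
          \<lparr>regs = r, arrs = A (b n (A 0)), inp = [], outp = Q (b n (A 0))\<rparr> \<and>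
        t \<le> (X + 2) ^ k \<and> r 0 = n"
  using assms(1)[unfolded runs_for_def, rule_format, of n X A r0 Q] assms(2-) by blast

lemma exec_for:
  assumes "cmp (\<lambda>\<eta>. b (\<eta> 0))" "cmp (\<lambda>\<eta>. f (\<eta> 0) (\<eta> 1))"
  shows "\<exists>c k. runs_for w b f c k"
proof -
  obtain cb cf k where cb: "\<forall>s X. regs s 0 \<le> X \<longrightarrow> (\<forall>a i. arrs s a i \<le> X) \<longrightarrow>
      (\<exists>u r. exec cb s u (s\<lparr>regs := r\<rparr>) \<and> u \<le> (X + 2) ^ k \<and> r 0 = regs s 0 \<and> r 1 = 0 \<and>
        r 2 = b (regs s 0) (arrs s) \<and> r 2 \<le> (X + 2) ^ k)"
    and cf: "\<forall>s X. regs s 0 \<le> X \<longrightarrow> regs s 1 \<le> X \<longrightarrow> (\<forall>a i. arrs s a i \<le> X) \<longrightarrow>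
      (\<exists>u r. exec cf s u (s\<lparr>regs := r\<rparr>) \<and> u \<le> (X + 2) ^ k \<and> r 0 = regs s 0 \<and> r 1 = regs s 1 \<and>
        r 2 = regs s 2 \<and> r 3 = f (regs s 0) (regs s 1) (arrs s))"
    using exec_bound[OF assms] by (elim exE conjE)
  define body where "body = Seq cf (Seq w (Assign 1 (Plus (Reg 1) (Num 1))))"
  define e where "e = Minus (Reg 2) (Reg 1)"
  have "runs_for w b f (Seq cb (While e body)) (k + (k + 2) * k + k + 6)"
    unfolding runs_for_def
  proof (intro allI impI)
    fix n X :: nat and A :: "nat \<Rightarrow> nat \<Rightarrow> nat \<Rightarrow> nat" and r0 :: "nat \<Rightarrow> nat" and Q :: "nat \<Rightarrow> nat list"
    assume n: "n \<le> X" and A: "\<forall>i\<le>b n (A 0). \<forall>a j. A i a j \<le> X" and r0: "r0 0 = n"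
      and w: "\<forall>i<b n (A 0). \<forall>r. r 1 = i \<longrightarrow> r 3 = f n i (A i) \<longrightarrow>
        exec w \<lparr>regs = r, arrs = A i, inp = [], outp = Q i\<rparr> 1
          \<lparr>regs = r, arrs = A (Suc i), inp = [], outp = Q (Suc i)\<rparr>"
    define B where "B = b n (A 0)"
    define I where "I i s \<longleftrightarrow> (\<exists>r. s = \<lparr>regs = r, arrs = A i, inp = [], outp = Q i\<rparr> \<and>
        r 0 = n \<and> r 1 = i \<and> r 2 = B)" for i s
    let ?s0 = "\<lparr>regs = r0, arrs = A 0, inp = [], outp = Q 0\<rparr>"
    obtain u r where r: "exec cb ?s0 u (?s0\<lparr>regs := r\<rparr>)" "u \<le> (X + 2) ^ k" "r 0 = n" "r 1 = 0" "r 2 = B"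
      "B \<le> (X + 2) ^ k"
      using cb[rule_format, of ?s0 X] n A r0 by (auto simp: B_def)
    \<comment> \<open>The number \<open>B\<close> of passes may exceed \<open>X\<close>, and the
      index register runs up to it; the passes are therefore bounded in terms of
      \<open>X'\<close>.\<close>
    define X' where "X' = X + (X + 2) ^ k"
    have "X' + 2 \<le> (X + 2) ^ (k + 2)"
      using power_double_add[of X 1 k] by (simp add: X'_def)
    then have X': "(X' + 2) ^ k \<le> (X + 2) ^ ((k + 2) * k)"
      unfolding power_mult by (rule power_mono) simp
    have "\<exists>t s'. exec (While e body) (?s0\<lparr>regs := r\<rparr>) t s' \<and> t \<le> B * (((X' + 2) ^ k + 2) + 1) + 1 \<and> I B s'"
    proof (rule exec_counting_loop)
      show "I 0 (?s0\<lparr>regs := r\<rparr>)" using r by (auto simp: I_def)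
      show "aval e s = 0" if "I B s" for s using that by (auto simp: I_def e_def)
      show "aval e s \<noteq> 0 \<and> (\<exists>t s'. exec body s t s' \<and> t \<le> (X' + 2) ^ k + 2 \<and> I (Suc i) s')"
        if i: "i < B" and "I i s" for i s
      proof -
        obtain q where q: "s = \<lparr>regs = q, arrs = A i, inp = [], outp = Q i\<rparr>" "q 0 = n" "q 1 = i" "q 2 = B"
          using \<open>I i s\<close> unfolding I_def by auto
        have "n \<le> X'" "i \<le> X'" "A i a j \<le> X'" for a j
          using n i r(6) A[rule_format, of i a j] by (auto simp: X'_def B_def)
        then have pre: "regs s 0 \<le> X'" "regs s 1 \<le> X'" "arrs s a j \<le> X'" for a j
          by (simp_all only: q state.simps)
        obtain v p where p: "exec cf s v (s\<lparr>regs := p\<rparr>)" "v \<le> (X' + 2) ^ k" "p 0 = n" "p 1 = i" "p 2 = B"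
            "p 3 = f n i (A i)"
          using cf[rule_format, OF pre] q(2-4) by (auto simp: q(1))
        have "exec body s (v + (1 + 1)) \<lparr>regs = p(1 := i + 1), arrs = A (Suc i), inp = [], outp = Q (Suc i)\<rparr>"
          unfolding body_def
        proof (rule exec.Seq[OF p(1) exec.Seq])
          show "exec w (s\<lparr>regs := p\<rparr>) 1 \<lparr>regs = p, arrs = A (Suc i), inp = [], outp = Q (Suc i)\<rparr>"
            using w[rule_format, of i p] i p(4,6) by (simp add: q(1) B_def)
          show "exec (Assign 1 (Plus (Reg 1) (Num 1))) \<lparr>regs = p, arrs = A (Suc i), inp = [], outp = Q (Suc i)\<rparr> 1
              \<lparr>regs = p(1 := i + 1), arrs = A (Suc i), inp = [], outp = Q (Suc i)\<rparr>"
            using exec.Assign[of 1 "Plus (Reg 1) (Num 1)"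
                "\<lparr>regs = p, arrs = A (Suc i), inp = [], outp = Q (Suc i)\<rparr>"] p(4) by simp
        qed
        moreover have "I (Suc i) \<lparr>regs = p(1 := i + 1), arrs = A (Suc i), inp = [], outp = Q (Suc i)\<rparr>"
          using p by (auto simp: I_def)
        moreover have "v + (1 + 1) \<le> (X' + 2) ^ k + 2" using p(2) by simp
        moreover have "aval e s \<noteq> 0" using i q by (simp add: e_def)
        ultimately show ?thesis by blast
      qed
    qed
    then obtain t s' where t: "exec (While e body) (?s0\<lparr>regs := r\<rparr>) t s'"
        "t \<le> B * ((X' + 2) ^ k + 2 + 1) + 1" "I B s'" by blast
    from t(3) obtain r' where r': "s' = \<lparr>regs = r', arrs = A B, inp = [], outp = Q B\<rparr>" "r' 0 = n"
      unfolding I_def by blast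
    have "u + t \<le> (X + 2) ^ (k + (k + 2) * k + k + 6)"
    proof -
      have "B * ((X' + 2) ^ k + 2 + 1) \<le> B * ((X' + 2) ^ k + 5)" by (rule mult_le_mono2) simp
      then show ?thesis using t(2) poly_time_combine[OF r(6) X' r(2)] by linarith
    qed
    with exec.Seq[OF r(1) t(1)] r' show "\<exists>t r. exec (Seq cb (While e body)) ?s0 t
          \<lparr>regs = r, arrs = A (b n (A 0)), inp = [], outp = Q (b n (A 0))\<rparr> \<and>
        t \<le> (X + 2) ^ (k + (k + 2) * k + k + 6) \<and> r 0 = n"
      unfolding B_def by blast
  qed
  then show ?thesis by blast
qed

text \<open>Course-of-values recursion: when entry \<open>i\<close> of table \<open>m\<close> is computed, its earlier entries are
  available and all others still read 0.\<close>

lemma tables_Suc: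
  assumes T: "tables m T" and "cmp (\<lambda>\<eta>. b (\<eta> 0))" "cmp (\<lambda>\<eta>. f (\<eta> 0) (\<eta> 1))"
    and bnd: "\<And>n. b n (\<lambda>a i. if a < m then T n a i else 0) = bnd n"
    and step: "\<And>n i. i < bnd n \<Longrightarrow>
      T n m i = f n i (\<lambda>a j. if a < m \<or> a = m \<and> j < i then T n a j else 0)"
    and zero: "\<And>n i. bnd n \<le> i \<Longrightarrow> T n m i = 0"
    and le: "\<And>n i. T n m i \<le> (n + 2) ^ p"
    and m': "m' = Suc m"
  shows "tables m' T"
proof -
  obtain c k where c: "\<And>n. (\<forall>a<m. \<forall>i. T n a i \<le> (n + 2) ^ k) \<and>
     (\<exists>t r. exec c (init_state (replicate n 1)) t
        \<lparr>regs = r, arrs = (\<lambda>a i. if a < m then T n a i else 0), inp = [], outp = []\<rparr> \<and>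
        r 0 = n \<and> t \<le> (n + 2) ^ k)"
    using T unfolding tables_def by blast
  from exec_for[OF assms(2,3)] obtain d l where d: "runs_for (Store m (Reg 1) (Reg 3)) b f d l"
    by blast
  define M where "M = k + p + 1"
  have M: "n \<le> (n + 2) ^ M" "(n + 2) ^ k \<le> (n + 2) ^ M" "(n + 2) ^ p \<le> (n + 2) ^ M" "(n + 2) ^ M + 2 \<le> (n + 2) ^ (M + 2)" for n :: nat
  proof -
    show *: "(n + 2) ^ k \<le> (n + 2) ^ M" "(n + 2) ^ p \<le> (n + 2) ^ M"
      unfolding M_def by (rule power_increasing; simp)+
    have "(n + 2) ^ 1 \<le> (n + 2) ^ M" unfolding M_def by (rule power_increasing) auto
    then show "n \<le> (n + 2) ^ M" by simp
    show "(n + 2) ^ M + 2 \<le> (n + 2) ^ (M + 2)"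
      using power_double_add[of n 1 M] by simp
  qed
  define K where "K = k + (M + 2) * l + p + 1"
  have "(\<forall>a<Suc m. \<forall>i. T n a i \<le> (n + 2) ^ K) \<and>
     (\<exists>t r. exec (Seq c d) (init_state (replicate n 1)) t
        \<lparr>regs = r, arrs = (\<lambda>a i. if a < Suc m then T n a i else 0), inp = [], outp = []\<rparr> \<and>
        r 0 = n \<and> t \<le> (n + 2) ^ K)" for n
  proof
    have "(n + 2) ^ k \<le> (n + 2) ^ K" "(n + 2) ^ p \<le> (n + 2) ^ K"
      unfolding K_def by (rule power_increasing; simp)+
    then show "\<forall>a<Suc m. \<forall>i. T n a i \<le> (n + 2) ^ K"
      using c[of n] le[of n] by (metis less_Suc_eq order_trans)
    define A where "A i = (\<lambda>a j. if a < m \<or> a = m \<and> j < i then T n a j else 0)" for i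
    have A0: "(\<lambda>a i. if a < m then T n a i else 0) = A 0" by (auto simp: A_def fun_eq_iff)
    have b0: "b n (A 0) = bnd n" using bnd[of n] by (simp add: A0)
    have AB: "(\<lambda>a i. if a < Suc m then T n a i else 0) = A (bnd n)"
      by (auto simp: A_def fun_eq_iff less_Suc_eq zero)
    obtain t r where t: "exec c (init_state (replicate n 1)) t
        \<lparr>regs = r, arrs = A 0, inp = [], outp = []\<rparr>" "r 0 = n" "t \<le> (n + 2) ^ k"
      using c[of n] unfolding A0 by blast
    have "\<exists>t r'. exec d \<lparr>regs = r, arrs = A 0, inp = [], outp = (\<lambda>_. []) (0::nat)\<rparr> t
          \<lparr>regs = r', arrs = A (b n (A 0)), inp = [], outp = (\<lambda>_. []) (b n (A 0))\<rparr> \<and>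
        t \<le> ((n + 2) ^ M + 2) ^ l \<and> r' 0 = n"
    proof (rule runs_forD[OF d])
      show "A i a j \<le> (n + 2) ^ M" for i a j
      proof -
        have "T n a j \<le> (n + 2) ^ M" if "a < m \<or> a = m"
          using that c[of n] le[of n j] M(2,3)[of n] by (metis order_trans)
        then show ?thesis unfolding A_def by (auto simp del: add_2_eq_Suc add_2_eq_Suc')
      qed
      show "exec (Store m (Reg 1) (Reg 3)) \<lparr>regs = r, arrs = A i, inp = [], outp = []\<rparr> 1
          \<lparr>regs = r, arrs = A (Suc i), inp = [], outp = []\<rparr>"
        if "i < b n (A 0)" "r 1 = i" "r 3 = f n i (A i)" for i r
      proof -
        have "A (Suc i) = (A i)(m := (A i m)(i := f n i (A i)))"
          using step[OF that(1)[unfolded b0]] unfolding A_def[of i, symmetric]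
          by (auto simp: A_def fun_eq_iff less_Suc_eq)
        then show ?thesis
          using exec.Store[of m "Reg 1" "Reg 3" "\<lparr>regs = r, arrs = A i, inp = [], outp = []\<rparr>"] that by simp
      qed
    qed (use M t in auto)
    then obtain u r' where u: "exec d \<lparr>regs = r, arrs = A 0, inp = [], outp = []\<rparr> u
          \<lparr>regs = r', arrs = A (bnd n), inp = [], outp = []\<rparr>" "u \<le> ((n + 2) ^ M + 2) ^ l" "r' 0 = n"
      unfolding b0 by auto
    have "((n + 2) ^ M + 2) ^ l \<le> (n + 2) ^ ((M + 2) * l)"
      unfolding power_mult using M(4) by (rule power_mono) simp
    then have "t + u \<le> (n + 2) ^ (k + (M + 2) * l + 1)"
      using power_double_add[of n k "(M + 2) * l"] t(3) u(2) by linarith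
    also have "\<dots> \<le> (n + 2) ^ K" unfolding K_def by (rule power_increasing) auto
    finally show "\<exists>t r. exec (Seq c d) (init_state (replicate n 1)) t
        \<lparr>regs = r, arrs = (\<lambda>a i. if a < Suc m then T n a i else 0), inp = [], outp = []\<rparr> \<and>
        r 0 = n \<and> t \<le> (n + 2) ^ K"
      unfolding AB using exec.Seq[OF t(1) u(1)] u(3) by blast
  qed
  then show ?thesis unfolding m' tables_def by blast
qed

text \<open>The last loop prints instead of storing: the arrays stay constant and only the output
  grows.\<close>

lemma polytime_on_unary_map:
  assumes T: "tables m T" and "cmp (\<lambda>\<eta>. b (\<eta> 0))" "cmp (\<lambda>\<eta>. f (\<eta> 0) (\<eta> 1))"
  shows "polytime_on_unary (\<lambda>n. map (\<lambda>i. f n i (\<lambda>a i. if a < m then T n a i else 0))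
    [0..<b n (\<lambda>a i. if a < m then T n a i else 0)])"
proof -
  obtain c k where c: "\<And>n. (\<forall>a<m. \<forall>i. T n a i \<le> (n + 2) ^ k) \<and>
     (\<exists>t r. exec c (init_state (replicate n 1)) t
        \<lparr>regs = r, arrs = (\<lambda>a i. if a < m then T n a i else 0), inp = [], outp = []\<rparr> \<and>
        r 0 = n \<and> t \<le> (n + 2) ^ k)"
    using T unfolding tables_def by blast
  from exec_for[OF assms(2,3)] obtain d l where d: "runs_for (Print (Reg 3)) b f d l"
    by blast
  define M where "M = k + 1"
  have M: "n \<le> (n + 2) ^ M" "(n + 2) ^ k \<le> (n + 2) ^ M" "(n + 2) ^ M + 2 \<le> (n + 2) ^ (M + 2)" for n :: nat
  proof -
    show *: "(n + 2) ^ k \<le> (n + 2) ^ M"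
      unfolding M_def by (rule power_increasing) simp_all
    have "(n + 2) ^ 1 \<le> (n + 2) ^ M" unfolding M_def by (rule power_increasing) auto
    then show "n \<le> (n + 2) ^ M" by simp
    show "(n + 2) ^ M + 2 \<le> (n + 2) ^ (M + 2)"
      using power_double_add[of n 1 M] by simp
  qed
  define K where "K = k + (M + 2) * l + 1"
  \<comment> \<open>\<open>[:2, 1:]\<close> is the polynomial with value \<open>n + 2\<close> at
    \<open>n\<close>.\<close>
  have "\<exists>t s. exec (Seq c d) (init_state (replicate n 1)) t s \<and>
      outp s = map (\<lambda>i. f n i (\<lambda>a i. if a < m then T n a i else 0))
        [0..<b n (\<lambda>a i. if a < m then T n a i else 0)] \<and> t \<le> poly ([:2, 1:] ^ K) n" for n
  proof -
    define A where "A = (\<lambda>a i. if a < m then T n a i else 0)"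
    define Q where "Q j = map (\<lambda>i. f n i A) [0..<j]" for j
    obtain t r where t: "exec c (init_state (replicate n 1)) t
        \<lparr>regs = r, arrs = A, inp = [], outp = []\<rparr>" "r 0 = n" "t \<le> (n + 2) ^ k"
      using c[of n] unfolding A_def by blast
    have "\<exists>t r'. exec d \<lparr>regs = r, arrs = (\<lambda>_. A) (0::nat), inp = [], outp = Q 0\<rparr> t
          \<lparr>regs = r', arrs = (\<lambda>_. A) (b n A), inp = [], outp = Q (b n A)\<rparr> \<and>
        t \<le> ((n + 2) ^ M + 2) ^ l \<and> r' 0 = n"
    proof (rule runs_forD[OF d])
      show "A a j \<le> (n + 2) ^ M" for a j
      proof -
        have "T n a j \<le> (n + 2) ^ M" if "a < m"
          using that c[of n] M(2)[of n] by (metis order_trans)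
        then show ?thesis unfolding A_def by (auto simp del: add_2_eq_Suc add_2_eq_Suc')
      qed
      show "exec (Print (Reg 3)) \<lparr>regs = r, arrs = A, inp = [], outp = Q i\<rparr> 1
          \<lparr>regs = r, arrs = A, inp = [], outp = Q (Suc i)\<rparr>"
        if "r 1 = i" "r 3 = f n i A" for i r
        using exec.Print[of "Reg 3" "\<lparr>regs = r, arrs = A, inp = [], outp = Q i\<rparr>"] that
        by (simp add: Q_def)
    qed (use M t in auto)
    then obtain u r' where u: "exec d \<lparr>regs = r, arrs = A, inp = [], outp = []\<rparr> u
          \<lparr>regs = r', arrs = A, inp = [], outp = Q (b n A)\<rparr>" "u \<le> ((n + 2) ^ M + 2) ^ l"
      by (auto simp: Q_def)
    have "((n + 2) ^ M + 2) ^ l \<le> (n + 2) ^ ((M + 2) * l)"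
      unfolding power_mult using M(3) by (rule power_mono) simp
    then have "t + u \<le> poly ([:2, 1:] ^ K) n"
      using power_double_add[of n k "(M + 2) * l"] t(3) u(2) by (simp add: K_def add.commute)
    with exec.Seq[OF t(1) u(1)] show ?thesis unfolding A_def[symmetric]
      by (intro exI conjI) (assumption, simp add: Q_def, assumption)
  qed
  then show ?thesis unfolding polytime_on_unary_def by blast
qed

section \<open>Tuples of permutations\<close>

text \<open>\<open>p\<close> is coded by the set \<open>Z p\<close>, one of at most
  \<open>2 ^ s\<close>, and by its values on \<open>Y (Z p)\<close>, with at most
  \<open>s ^ R\<close> choices. An application only has to supply the decoding rule
  \<open>inj\<close>.\<close>

lemma card_le_by_encoding:
  fixes Q :: "(nat \<Rightarrow> nat) set"
  assumes s: "0 < s"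
    and Q: "\<And>p x. p \<in> Q \<Longrightarrow> x < s \<Longrightarrow> p x < s"
    and Z: "\<And>p. p \<in> Q \<Longrightarrow> Z p \<subseteq> {..<s}"
    and Y: "\<And>p. p \<in> Q \<Longrightarrow> Y (Z p) \<subseteq> {..<s} \<and> card (Y (Z p)) \<le> R"
    and inj: "\<And>p q. p \<in> Q \<Longrightarrow> q \<in> Q \<Longrightarrow> Z p = Z q \<Longrightarrow> (\<And>x. x \<in> Y (Z p) \<Longrightarrow> p x = q x) \<Longrightarrow> p = q"
  shows "card Q \<le> 2 ^ s * s ^ R"
proof -
  define W where "W = {V \<in> Pow {..<s}. Y V \<subseteq> {..<s} \<and> card (Y V) \<le> R}"
  have finW: "finite W" and cardW: "card W \<le> 2 ^ s"
    using card_mono[of "Pow {..<s}" W] by (auto simp: W_def card_Pow)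
  have finY: "finite (Y V)" if "V \<in> W" for V
    using that finite_subset[of "Y V" "{..<s}"] by (auto simp: W_def)
  let ?B = "Sigma W (\<lambda>V. Y V \<rightarrow>\<^sub>E {..<s})"
  have finB: "finite ?B" using finW finY by (auto intro!: finite_PiE)
  have "card Q \<le> card ?B"
  proof (rule card_inj_on_le[OF _ _ finB])
    show "inj_on (\<lambda>p. (Z p, restrict p (Y (Z p)))) Q"
    proof (rule inj_onI)
      fix p q assume pq: "p \<in> Q" "q \<in> Q" "(Z p, restrict p (Y (Z p))) = (Z q, restrict q (Y (Z q)))"
      then have "restrict p (Y (Z p)) = restrict q (Y (Z p))" "Z p = Z q" by auto
      then show "p = q" using inj[OF pq(1,2)] by (metis restrict_apply')
    qed
    show "(\<lambda>p. (Z p, restrict p (Y (Z p)))) ` Q \<subseteq> ?B"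
      using Z Y Q by (auto simp: W_def subset_iff)
  qed
  also have "card ?B = (\<Sum>V\<in>W. card (Y V \<rightarrow>\<^sub>E {..<s}))"
    using finW finY by (intro card_SigmaI) (auto intro!: finite_PiE)
  also have "\<dots> \<le> (\<Sum>V\<in>W. s ^ R)"
  proof (rule sum_mono)
    fix V assume V: "V \<in> W"
    then have "card (Y V \<rightarrow>\<^sub>E {..<s}) = s ^ card (Y V)" using finY by (simp add: card_PiE)
    also have "\<dots> \<le> s ^ R" using V s by (intro power_increasing) (auto simp: W_def)
    finally show "card (Y V \<rightarrow>\<^sub>E {..<s}) \<le> s ^ R" .
  qed
  also have "\<dots> \<le> 2 ^ s * s ^ R" using cardW by simp
  finally show ?thesis .
qed

lemma permutes_eqI:
  assumes "p permutes {..<s}" "q permutes {..<s}" "\<And>x. x < s \<Longrightarrow> p x = q x"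
  shows "p = q"
proof
  fix x show "p x = q x"
    using assms by (cases "x < s") (auto simp: permutes_not_in)
qed

lemma permutes_less: "p permutes {..<s} \<Longrightarrow> x < s \<Longrightarrow> p x < (s::nat)"
  using permutes_in_image[of p "{..<s}" x] by simp

text \<open>Outside the set where \<open>p\<close> and \<open>h\<close> differ, \<open>p\<close> is
  known, so at most \<open>s div 100\<close> values have to be recorded.\<close>

lemma card_perms_close_to:
  fixes h :: "nat \<Rightarrow> nat"
  assumes "0 < s"
  shows "card {p. p permutes {..<s} \<and> 100 * card {x. x < s \<and> p x \<noteq> h x} \<le> s} \<le> 2 ^ s * s ^ (s div 100)"
proof (rule card_le_by_encoding[where Z = "\<lambda>p. {x. x < s \<and> p x \<noteq> h x}" and Y = "\<lambda>Z. Z"])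
  fix p q :: "nat \<Rightarrow> nat"
  assume p: "p \<in> {p. p permutes {..<s} \<and> 100 * card {x. x < s \<and> p x \<noteq> h x} \<le> s}"
    and q: "q \<in> {p. p permutes {..<s} \<and> 100 * card {x. x < s \<and> p x \<noteq> h x} \<le> s}"
    and Z: "{x. x < s \<and> p x \<noteq> h x} = {x. x < s \<and> q x \<noteq> h x}"
    and eq: "\<And>x. x \<in> {x. x < s \<and> p x \<noteq> h x} \<Longrightarrow> p x = q x"
  show "p = q"
  proof (rule permutes_eqI)
    show "p x = q x" if "x < s" for x
    proof (cases "p x = h x")
      case True
      with that Z have "q x = h x" by blast
      with True show ?thesis by simp
    next
      case False
      with that show ?thesis by (intro eq) simp
    qed
  qed (use p q in auto)
qed (use assms permutes_less in \<open>auto simp: less_eq_div_iff_mult_less_eq mult.commute\<close>)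

text \<open>A largest \<open>M\<close> disjoint from its image works: a moved point outside
  \<open>M\<close>, its image and its preimage could be added. These three sets have at most
  \<open>card M\<close> elements each.\<close>

lemma moved_independent:
  assumes "\<phi> permutes {..<s::nat}"
  obtains M where "M \<subseteq> {x. x < s \<and> \<phi> x \<noteq> x}" "\<phi> ` M \<inter> M = {}" "card {x. x < s \<and> \<phi> x \<noteq> x} \<le> 3 * card M"
proof -
  let ?V = "{x. x < s \<and> \<phi> x \<noteq> x}"
  let ?P = "\<lambda>M. M \<subseteq> ?V \<and> \<phi> ` M \<inter> M = {}"
  have "card M \<le> s" if "?P M" for M
    using card_mono[of "{..<s}" M] that by auto
  then obtain M where M: "?P M" and max: "\<And>N. ?P N \<Longrightarrow> card N \<le> card M"
    using ex_has_greatest_nat[of ?P "{}" card "Suc s"] by (auto simp: less_Suc_eq_le)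
  have finM: "finite M" using M finite_subset[of M "{..<s}"] by auto
  have inj: "inj \<phi>" using assms by (rule permutes_inj)
  have "?V \<subseteq> M \<union> \<phi> ` M \<union> {x. \<phi> x \<in> M}"
  proof
    fix x assume x: "x \<in> ?V"
    show "x \<in> M \<union> \<phi> ` M \<union> {x. \<phi> x \<in> M}"
    proof (rule ccontr)
      assume no: "x \<notin> M \<union> \<phi> ` M \<union> {x. \<phi> x \<in> M}"
      then have "?P (insert x M)" using M x by auto
      then have "card (insert x M) \<le> card M" by (rule max)
      then show False using no finM by simp
    qed
  qed
  moreover have vim: "{x. \<phi> x \<in> M} = inv \<phi> ` M"
    using permutes_inverses[OF assms] by (auto simp: image_iff) metis
  ultimately have "card ?V \<le> card (M \<union> \<phi> ` M \<union> inv \<phi> ` M)"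
    using finM by (intro card_mono) auto
  also have "\<dots> \<le> card M + card (\<phi> ` M) + card (inv \<phi> ` M)"
    by (intro order_trans[OF card_Un_le] add_mono order_refl)
  also have "\<dots> \<le> 3 * card M" using card_image_le[OF finM, of \<phi>] card_image_le[OF finM, of "inv \<phi>"] by simp
  finally show thesis using that M by blast
qed

lemma card_perms_almost_commuting:
  assumes s: "0 < s" and \<phi>: "\<phi> permutes {..<s}" and mv: "s \<le> 2 * card {x. x < s \<and> \<phi> x \<noteq> x}"
  shows "card {p. p permutes {..<s} \<and> 100 * card {x. x < s \<and> \<phi> (p x) \<noteq> p (\<phi> x)} \<le> s}
    \<le> 2 ^ s * s ^ (s - (s div 6 - s div 100))"
proof -
  obtain M where M: "M \<subseteq> {x. x < s \<and> \<phi> x \<noteq> x}" "\<phi> ` M \<inter> M = {}"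
    "card {x. x < s \<and> \<phi> x \<noteq> x} \<le> 3 * card M"
    using moved_independent[OF \<phi>] .
  have M6: "s div 6 \<le> card M" using mv M(3) by linarith
  have finM: "finite M" using M finite_subset[of M "{..<s}"] by auto
  let ?Q = "{p. p permutes {..<s} \<and> 100 * card {x. x < s \<and> \<phi> (p x) \<noteq> p (\<phi> x)} \<le> s}"
  show ?thesis
  proof (rule card_le_by_encoding[where Z = "\<lambda>p. {x. x < s \<and> \<phi> (p x) \<noteq> p (\<phi> x)}"
        and Y = "\<lambda>Z. {..<s} - \<phi> ` (M - Z)"])
    fix p q assume p: "p \<in> ?Q" and q: "q \<in> ?Q"
      and Z: "{x. x < s \<and> \<phi> (p x) \<noteq> p (\<phi> x)} = {x. x < s \<and> \<phi> (q x) \<noteq> q (\<phi> x)}"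
      and eq: "\<And>x. x \<in> {..<s} - \<phi> ` (M - {x. x < s \<and> \<phi> (p x) \<noteq> p (\<phi> x)}) \<Longrightarrow> p x = q x"
    show "p = q"
    proof (rule permutes_eqI)
      show "p y = q y" if "y < s" for y
      proof (cases "y \<in> \<phi> ` (M - {x. x < s \<and> \<phi> (p x) \<noteq> p (\<phi> x)})")
        case True
        then obtain x where x: "y = \<phi> x" "x \<in> M" "x \<notin> {x. x < s \<and> \<phi> (p x) \<noteq> p (\<phi> x)}" by auto
        then have xs: "x < s" using M(1) by auto
        have "x \<notin> {x. x < s \<and> \<phi> (q x) \<noteq> q (\<phi> x)}" using x(3) Z by simp
        then have 1: "\<phi> (p x) = p (\<phi> x)" "\<phi> (q x) = q (\<phi> x)" using x(3) xs by auto
        have "x \<notin> \<phi> ` M" using x(2) M(2) by auto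
        then have "p x = q x" using xs by (intro eq) auto
        then show ?thesis using 1 x(1) by metis
      next
        case False
        with that show ?thesis by (intro eq) simp
      qed
    qed (use p q in auto)
  next
    fix p assume p: "p \<in> ?Q"
    let ?Z = "{x. x < s \<and> \<phi> (p x) \<noteq> p (\<phi> x)}"
    have "\<phi> ` (M - ?Z) \<subseteq> {..<s}" using M(1) permutes_less[OF \<phi>] by auto
    then have "card ({..<s} - \<phi> ` (M - ?Z)) = s - card (\<phi> ` (M - ?Z))"
      using finM by (subst card_Diff_subset) auto
    also have "card (\<phi> ` (M - ?Z)) = card (M - ?Z)"
      using permutes_inj_on[OF \<phi>] by (rule card_image)
    finally have 1: "card ({..<s} - \<phi> ` (M - ?Z)) = s - card (M - ?Z)" .
    have "card M - card ?Z \<le> card (M - ?Z)" by (rule diff_card_le_card_Diff) simp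
    moreover have "card ?Z \<le> s div 100" using p by (simp add: less_eq_div_iff_mult_less_eq mult.commute)
    ultimately have "s - card (M - ?Z) \<le> s - (s div 6 - s div 100)" using M6 by linarith
    then show "{..<s} - \<phi> ` (M - ?Z) \<subseteq> {..<s} \<and>
        card ({..<s} - \<phi> ` (M - ?Z)) \<le> s - (s div 6 - s div 100)"
      using 1 by auto
  qed (use s permutes_less in auto)
qed

text \<open>Double counting of pairs of a \<open>p\<close> mapping \<open>A\<close> into
  \<open>B\<close> and a point \<open>z\<close> outside \<open>A\<close> with \<open>p z\<close> in
  \<open>B\<close>: composing with the transposition of \<open>a\<close> and \<open>z\<close>
  transfers this value to \<open>a\<close> and is its own inverse.\<close>

lemma card_perms_image_insert:
  fixes A B :: "nat set"
  assumes AB: "A \<subseteq> {..<s}" "B \<subseteq> {..<s}" and a: "a < s" "a \<notin> A"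
  shows "card {p. p permutes {..<s} \<and> p ` insert a A \<subseteq> B} * (s - card A) =
    card {p. p permutes {..<s} \<and> p ` A \<subseteq> B} * (card B - card A)"
proof -
  let ?P = "\<lambda>A. {p. p permutes {..<s} \<and> p ` A \<subseteq> B}"
  let ?X = "Sigma (?P A) (\<lambda>p. {z \<in> {..<s} - A. p z \<in> B})"
  let ?Y = "?P (insert a A) \<times> ({..<s} - A)"
  let ?f = "\<lambda>(p, z). (p \<circ> transpose a z, z)"
  have finP: "finite {p. p permutes {..<s}}" by (rule finite_permutations) simp
  have fixA: "transpose a z x = x" if "x \<in> A" "z \<notin> A" for x z
    using that a by (auto simp: transpose_def)
  have perm: "p \<circ> transpose a z permutes {..<s}" if "p permutes {..<s}" "z < s" for p z
    using that a by (intro permutes_compose permutes_swap_id) auto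
  have inv: "(p \<circ> transpose a z) \<circ> transpose a z = p" for p :: "nat \<Rightarrow> nat" and z
    by (simp add: comp_assoc)
  have "bij_betw ?f ?X ?Y"
  proof (rule bij_betw_byWitness[where f' = ?f])
    show "\<forall>x\<in>?X. ?f (?f x) = x" "\<forall>x\<in>?Y. ?f (?f x) = x" using inv by (auto simp: comp_assoc)
    show "?f ` ?X \<subseteq> ?Y" using perm fixA by (auto simp: image_subset_iff)
    show "?f ` ?Y \<subseteq> ?X" using perm fixA by (auto simp: image_subset_iff)
  qed
  then have "card ?X = card ?Y" by (rule bij_betw_same_card)
  also have "\<dots> = card (?P (insert a A)) * (s - card A)"
    using AB finite_subset[OF AB(1)] by (simp add: card_cartesian_product card_Diff_subset)
  also have "card ?X = (\<Sum>p\<in>?P A. card {z \<in> {..<s} - A. p z \<in> B})"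
    using finP by (intro card_SigmaI) (auto intro: finite_subset)
  also have "\<dots> = (\<Sum>p\<in>?P A. card B - card A)"
  proof (rule sum.cong[OF refl])
    fix p assume p: "p \<in> ?P A"
    have inv: "{z \<in> {..<s}. p z \<in> B} = inv p ` B"
    proof -
      have p: "p permutes {..<s}" using p by simp
      show ?thesis
      proof (intro set_eqI iffI)
        fix z assume "z \<in> {z \<in> {..<s}. p z \<in> B}"
        then show "z \<in> inv p ` B" using permutes_inverses(2)[OF p, of z] by (metis (no_types, lifting) image_eqI mem_Collect_eq)
      next
        fix z assume "z \<in> inv p ` B"
        then obtain w where "w \<in> B" "z = inv p w" by blast
        then show "z \<in> {z \<in> {..<s}. p z \<in> B}"
          using AB(2) permutes_less[OF permutes_inv[OF p], of w] permutes_inverses(1)[OF p, of w] by auto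
      qed
    qed
    have "{z \<in> {..<s} - A. p z \<in> B} = {z \<in> {..<s}. p z \<in> B} - A" by auto
    also have "card \<dots> = card {z \<in> {..<s}. p z \<in> B} - card A"
      using p AB finite_subset[OF AB(1)] by (intro card_Diff_subset) auto
    also have "card {z \<in> {..<s}. p z \<in> B} = card B"
      unfolding inv using p permutes_inj_on[OF permutes_inv, of p "{..<s}" B] by (simp add: card_image)
    finally show "card {z \<in> {..<s} - A. p z \<in> B} = card B - card A" .
  qed
  finally show ?thesis by simp
qed

text \<open>The exact probability is a product of factors \<open>(card B - i) / (s - i)\<close> for
  \<open>i < card A\<close>, each at most \<open>card B / s\<close> because
  \<open>card B \<le> s\<close>.\<close>

lemma card_perms_image:
  fixes A B :: "nat set"
  assumes "A \<subseteq> {..<s}" "B \<subseteq> {..<s}"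
  shows "card {p. p permutes {..<s} \<and> p ` A \<subseteq> B} * s ^ card A \<le> fact s * card B ^ card A"
proof -
  have "finite A" using assms(1) finite_subset by blast
  then show ?thesis using assms(1)
  proof (induction A)
    case empty
    then show ?case by (simp add: card_permutations[of "{..<s}" s])
  next
    case (insert a A)
    let ?N = "\<lambda>A. card {p. p permutes {..<s} \<and> p ` A \<subseteq> B}"
    let ?m = "card A" and ?b = "card B"
    have a: "a < s" "A \<subseteq> {..<s}" using insert.prems by auto
    have bs: "?b \<le> s" using card_mono[OF _ assms(2)] by simp
    have "card (insert a A) \<le> card {..<s}" using insert.prems by (intro card_mono) auto
    then have ms: "?m < s" using insert.hyps by simp
    have "(?N (insert a A) * s ^ Suc ?m) * (s - ?m) = ?N (insert a A) * (s - ?m) * s ^ Suc ?m" by simp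
    also have "\<dots> = ?N A * (?b - ?m) * s ^ Suc ?m"
      using card_perms_image_insert[OF a(2) assms(2) a(1) insert.hyps(2)] by simp
    also have "\<dots> = (?N A * s ^ ?m) * ((?b - ?m) * s)" by simp
    also have "\<dots> \<le> (fact s * ?b ^ ?m) * (?b * (s - ?m))"
    proof (rule mult_le_mono)
      show "?N A * s ^ ?m \<le> fact s * ?b ^ ?m" using insert.IH[OF a(2)] .
      show "(?b - ?m) * s \<le> ?b * (s - ?m)"
        using bs by (simp add: diff_mult_distrib diff_mult_distrib2 mult.commute mult_le_mono diff_le_mono2)
    qed
    also have "\<dots> = (fact s * ?b ^ Suc ?m) * (s - ?m)" by simp
    finally show ?case using ms insert.hyps by (simp add: mult.assoc)
  qed
qed

text \<open>The left side is one term of the binomial expansion of \<open>(1 + m / s) ^ s\<close>,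
  which is at most \<open>exp m\<close>.\<close>

lemma choose_power_le:
  assumes "0 < s" "m \<le> s"
  shows "real (s choose m) * (real m / real s) ^ m \<le> 3 ^ m"
proof -
  let ?x = "real m / real s"
  have "real (s choose m) * ?x ^ m = real (s choose m) * ?x ^ m * 1 ^ (s - m)" by simp
  also have "\<dots> \<le> (\<Sum>k\<le>s. real (s choose k) * ?x ^ k * 1 ^ (s - k))"
    using assms by (intro member_le_sum) auto
  also have "\<dots> = (?x + 1) ^ s" by (rule binomial_ring[symmetric])
  also have "\<dots> \<le> exp ?x ^ s" using exp_ge_add_one_self[of ?x] by (intro power_mono) (auto simp: add.commute)
  also have "\<dots> = exp 1 ^ m" using assms by (simp flip: exp_of_nat_mult)
  also have "\<dots> \<le> 3 ^ m" using exp_le by (intro power_mono) auto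
  finally show ?thesis .
qed

text \<open>Of the \<open>24 * m\<close> factors \<open>b / s\<close>, \<open>2 * m\<close> pay for
  the choice of the larger set and \<open>m\<close> for that of the smaller; the remaining
  \<open>21 * m\<close> are at most 3/4 each. This suffices since
  \<open>27 * (3 / 2) * (3 / 4) ^ 21 \<le> 1 / 4\<close>.\<close>

lemma nonexpanding_term_le:
  assumes m: "1 \<le> m" "2 * m \<le> s" and b: "b = 3 * m div 2"
  shows "real (s choose m) * real (s choose b) * (real b / real s) ^ (24 * m) \<le> (1 / 4) ^ m"
proof -
  define x where "x = real m / real s"
  define y where "y = real b / real s"
  have s: "0 < s" using m by simp
  have b1: "1 \<le> b" "b \<le> 2 * m" "4 * b \<le> 3 * s" "2 * b \<le> 3 * m" using m b by auto
  have y0: "0 < y" using b1 s by (simp add: y_def)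
  have "4 * real b \<le> 3 * real s" using b1(3) by linarith
  then have y34: "y \<le> 3 / 4" using s by (simp add: y_def field_simps)
  have "2 * real b \<le> 3 * real m" using b1(4) by linarith
  then have yx: "y \<le> 3 / 2 * x" using s by (simp add: x_def y_def field_simps)
  have x0: "0 < x" using y0 yx by simp
  have "y ^ (24 * m) = y ^ (2 * m) * (y ^ m * y ^ (21 * m))"
    by (simp flip: power_add)
  also have "\<dots> \<le> y ^ b * ((3 / 2 * x) ^ m * ((3 / 4) ^ 21) ^ m)"
  proof (intro mult_mono)
    show "y ^ (2 * m) \<le> y ^ b" using b1 y0 y34 by (intro power_decreasing) auto
    show "y ^ m \<le> (3 / 2 * x) ^ m" using y0 yx by (intro power_mono) auto
    have "y ^ (21 * m) \<le> (3 / 4) ^ (21 * m)" using y0 y34 by (intro power_mono) auto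
    then show "y ^ (21 * m) \<le> ((3 / 4) ^ 21) ^ m" by (simp add: power_mult)
  qed (use y0 x0 in auto)
  finally have "real (s choose m) * real (s choose b) * y ^ (24 * m)
      \<le> real (s choose m) * real (s choose b) * (y ^ b * ((3 / 2 * x) ^ m * ((3 / 4) ^ 21) ^ m))"
    by (intro mult_left_mono) auto
  also have "\<dots> = (real (s choose m) * x ^ m) * (real (s choose b) * y ^ b) * (3 / 2 * (3 / 4) ^ 21) ^ m"
    by (simp only: power_mult_distrib mult_ac)
  also have "\<dots> \<le> 3 ^ m * 9 ^ m * (3 / 2 * (3 / 4) ^ 21) ^ m"
  proof (intro mult_right_mono mult_mono)
    show "real (s choose m) * x ^ m \<le> 3 ^ m" unfolding x_def using s m by (intro choose_power_le) auto
    have "real (s choose b) * y ^ b \<le> 3 ^ b" unfolding y_def using s b1 by (intro choose_power_le) auto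
    also have "\<dots> \<le> 3 ^ (2 * m)" using b1 by (intro power_increasing) auto
    finally show "real (s choose b) * y ^ b \<le> 9 ^ m" by (simp add: power_mult)
  qed (use x0 y0 in auto)
  also have "\<dots> = (3 * 9 * (3 / 2 * (3 / 4) ^ 21)) ^ m" by (simp only: power_mult_distrib)
  also have "\<dots> \<le> (1 / 4) ^ m" by (intro power_mono) (simp_all add: power_divide)
  finally show ?thesis by (simp add: y_def)
qed

section \<open>Expanding, rigid and pairwise far tuples\<close>

text \<open>Approximate conjugacy of tuples by \<open>\<phi>\<close>, with one percent of exceptions
  tolerated separately in each coordinate.\<close>

definition near :: "nat \<Rightarrow> (nat \<Rightarrow> nat \<Rightarrow> nat) \<Rightarrow> (nat \<Rightarrow> nat \<Rightarrow> nat) \<Rightarrow> (nat \<Rightarrow> nat) \<Rightarrow> bool" where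
  "near s \<tau> \<tau>' \<phi> \<longleftrightarrow> (\<forall>i<24. 100 * card {x. x < s \<and> \<phi> (\<tau> i x) \<noteq> \<tau>' i (\<phi> x)} \<le> s)"

definition expanding :: "nat \<Rightarrow> (nat \<Rightarrow> nat \<Rightarrow> nat) \<Rightarrow> bool" where
  "expanding s \<tau> \<longleftrightarrow> (\<forall>A\<subseteq>{..<s}. A \<noteq> {} \<longrightarrow> 2 * card A \<le> s \<longrightarrow> 3 * card A < 2 * card (\<Union>i<24. \<tau> i ` A))"

definition rigid :: "nat \<Rightarrow> (nat \<Rightarrow> nat \<Rightarrow> nat) \<Rightarrow> bool" where
  "rigid s \<tau> \<longleftrightarrow> (\<forall>\<phi>. \<phi> permutes {..<s} \<longrightarrow> near s \<tau> \<tau> \<phi> \<longrightarrow> 2 * card {x. x < s \<and> \<phi> x \<noteq> x} < s)"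

definition tuples :: "nat \<Rightarrow> (nat \<Rightarrow> nat \<Rightarrow> nat) set" where
  "tuples s = (\<Pi>\<^sub>E i\<in>{..<24}. {p. p permutes {..<s}})"

lemma finite_tuples: "finite (tuples s)"
  unfolding tuples_def by (intro finite_PiE finite_permutations) auto

lemma card_tuples: "card (tuples s) = fact s ^ 24"
  unfolding tuples_def by (simp add: card_PiE card_permutations[of "{..<s}" s])

lemma tuplesD: "\<tau> \<in> tuples s \<Longrightarrow> i < 24 \<Longrightarrow> \<tau> i permutes {..<s}"
  unfolding tuples_def by (auto simp: PiE_iff)

text \<open>Union bound over witnesses \<open>j\<close>: once the witness is fixed, the 24
  coordinates are constrained separately, whence the 24th power.\<close>

lemma card_tuples_UN_le:
  assumes "finite I" "X \<subseteq> (\<Union>j\<in>I. \<Pi>\<^sub>E i\<in>{..<24::nat}. Q j i)"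
    and "\<And>i j. j \<in> I \<Longrightarrow> i < 24 \<Longrightarrow> finite (Q j i) \<and> card (Q j i) \<le> N j"
  shows "card X \<le> (\<Sum>j\<in>I. N j ^ 24)"
proof -
  have fin: "finite (\<Pi>\<^sub>E i\<in>{..<24::nat}. Q j i)" if "j \<in> I" for j
    using assms(3) that by (intro finite_PiE) auto
  have "card X \<le> card (\<Union>j\<in>I. \<Pi>\<^sub>E i\<in>{..<24::nat}. Q j i)"
    using assms(1,2) fin by (intro card_mono) auto
  also have "\<dots> \<le> (\<Sum>j\<in>I. card (\<Pi>\<^sub>E i\<in>{..<24::nat}. Q j i))"
    using assms(1) by (rule card_UN_le)
  also have "\<dots> \<le> (\<Sum>j\<in>I. N j ^ 24)"
  proof (rule sum_mono)
    fix j assume j: "j \<in> I"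
    have "card (\<Pi>\<^sub>E i\<in>{..<24::nat}. Q j i) = (\<Prod>i<24. card (Q j i))" by (simp add: card_PiE)
    also have "\<dots> \<le> (\<Prod>i<24::nat. N j)" using assms(3) j by (intro prod_mono) auto
    finally show "card (\<Pi>\<^sub>E i\<in>{..<24::nat}. Q j i) \<le> N j ^ 24" by simp
  qed
  finally show ?thesis .
qed

text \<open>A witness is a set \<open>A\<close> of size \<open>m\<close> with a set \<open>B\<close>
  of size exactly \<open>3 * m div 2\<close> containing all images of \<open>A\<close>; the
  geometric series with ratio 1/4 sums to at most 1/3.\<close>

lemma card_nonexpanding:
  assumes s: "0 < s"
  shows "real (card {\<tau> \<in> tuples s. \<not> expanding s \<tau>}) \<le> fact s ^ 24 / 3"
proof -
  define I where "I = Sigma {1..s div 2} (\<lambda>m. {A. A \<subseteq> {..<s} \<and> card A = m} \<times> {B. B \<subseteq> {..<s} \<and> card B = 3 * m div 2})"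
  define Q where "Q j = {p. p permutes {..<s} \<and> p ` fst (snd j) \<subseteq> snd (snd j)}"
    for j :: "nat \<times> nat set \<times> nat set"
  have finsub: "finite {A. A \<subseteq> {..<s} \<and> card A = m}" for m
    by (rule finite_subset[of _ "Pow {..<s}"]) auto
  have finI: "finite I" unfolding I_def using finsub by auto
  have sub: "{\<tau> \<in> tuples s. \<not> expanding s \<tau>} \<subseteq> (\<Union>j\<in>I. \<Pi>\<^sub>E i\<in>{..<24}. Q j)"
  proof
    fix \<tau> assume "\<tau> \<in> {\<tau> \<in> tuples s. \<not> expanding s \<tau>}"
    then obtain A where \<tau>: "\<tau> \<in> tuples s" and A: "A \<subseteq> {..<s}" "A \<noteq> {}" "2 * card A \<le> s"
      "2 * card (\<Union>i<24. \<tau> i ` A) \<le> 3 * card A"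
      unfolding expanding_def by (auto simp: not_less)
    have finA: "finite A" using A(1) finite_subset by blast
    have U: "(\<Union>i<24. \<tau> i ` A) \<subseteq> {..<s}" using A(1) tuplesD[OF \<tau>] permutes_less by blast
    \<comment> \<open>Padding the image to exactly this size, which fits because
      \<open>2 * card A \<le> s\<close>, makes the number of candidates a binomial
      coefficient.\<close>
    have "card (\<Union>i<24. \<tau> i ` A) \<le> 3 * card A div 2" "3 * card A div 2 \<le> card {..<s}"
      using A(3,4) by simp_all
    from exists_subset_between[OF this U] obtain B where
      B: "(\<Union>i<24. \<tau> i ` A) \<subseteq> B" "B \<subseteq> {..<s}" "card B = 3 * card A div 2" by auto
    have "1 \<le> card A" using A(2) finA by (simp add: Suc_le_eq card_gt_0_iff)
    then have "(card A, A, B) \<in> I" using A B by (auto simp: I_def)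
    moreover have "\<tau> \<in> (\<Pi>\<^sub>E i\<in>{..<24}. Q (card A, A, B))"
      using \<tau> B(1) unfolding tuples_def Q_def by (auto simp: PiE_iff)
    ultimately show "\<tau> \<in> (\<Union>j\<in>I. \<Pi>\<^sub>E i\<in>{..<24}. Q j)" by blast
  qed
  have finQ: "finite (Q j)" for j
    unfolding Q_def by (rule finite_subset[OF _ finite_permutations[of "{..<s}"]]) auto
  have "card {\<tau> \<in> tuples s. \<not> expanding s \<tau>} \<le> (\<Sum>j\<in>I. card (Q j) ^ 24)"
    using finI sub by (rule card_tuples_UN_le) (use finQ in auto)
  then have "real (card {\<tau> \<in> tuples s. \<not> expanding s \<tau>}) \<le> real (\<Sum>j\<in>I. card (Q j) ^ 24)"
    by (rule of_nat_mono)
  also have "\<dots> = (\<Sum>j\<in>I. real (card (Q j)) ^ 24)" by simp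
  also have "\<dots> \<le> (\<Sum>(m, A, B)\<in>I. fact s ^ 24 * (real (3 * m div 2) / real s) ^ (24 * m))"
  proof (rule sum_mono, clarify)
    fix m A B assume "(m, A, B) \<in> I"
    then have AB: "A \<subseteq> {..<s}" "B \<subseteq> {..<s}" "card A = m" "card B = 3 * m div 2"
      by (auto simp: I_def)
    have "real (card (Q (m, A, B)) * s ^ m) \<le> real (fact s * (3 * m div 2) ^ m)"
      unfolding of_nat_le_iff using card_perms_image[OF AB(1,2)] AB(3,4) by (simp add: Q_def)
    then have "real (card (Q (m, A, B))) \<le> fact s * (real (3 * m div 2) / real s) ^ m"
      using s by (simp add: power_divide field_simps)
    then have "real (card (Q (m, A, B))) ^ 24 \<le> (fact s * (real (3 * m div 2) / real s) ^ m) ^ 24"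
      by (rule power_mono) simp
    then show "real (card (Q (m, A, B))) ^ 24 \<le> fact s ^ 24 * (real (3 * m div 2) / real s) ^ (24 * m)"
      by (simp add: power_mult_distrib mult.commute flip: power_mult)
  qed
  also have "\<dots> = (\<Sum>m\<in>{1..s div 2}. \<Sum>(A, B)\<in>{A. A \<subseteq> {..<s} \<and> card A = m} \<times> {B. B \<subseteq> {..<s} \<and> card B = 3 * m div 2}.
      fact s ^ 24 * (real (3 * m div 2) / real s) ^ (24 * m))"
    unfolding I_def using finsub by (subst sum.Sigma[symmetric]) (auto simp: case_prod_unfold)
  also have "\<dots> = (\<Sum>m\<in>{1..s div 2}. fact s ^ 24 *
      (real (s choose m) * real (s choose (3 * m div 2)) * (real (3 * m div 2) / real s) ^ (24 * m)))"
    using n_subsets[of "{..<s}"] by (intro sum.cong) (simp_all add: case_prod_unfold card_cartesian_product)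
  also have "\<dots> \<le> (\<Sum>m\<in>{1..s div 2}. fact s ^ 24 * (1 / 4) ^ m)"
    by (intro sum_mono mult_left_mono nonexpanding_term_le) auto
  also have "\<dots> = fact s ^ 24 * (\<Sum>m\<in>{1..s div 2}. (1 / 4) ^ m)" by (simp add: sum_distrib_left)
  also have "\<dots> \<le> fact s ^ 24 * (1 / 3)"
  proof (rule mult_left_mono)
    have "(\<Sum>m\<in>{1..n}. (1 / 4 :: real) ^ m) = (1 - (1 / 4) ^ n) / 3" for n
    proof (induction n)
      case (Suc n)
      have "(\<Sum>m\<in>{1..Suc n}. (1 / 4 :: real) ^ m) = (\<Sum>m\<in>{1..n}. (1 / 4) ^ m) + (1 / 4) ^ Suc n" by simp
      also have "\<dots> = (1 - (1 / 4) ^ Suc n) / 3" proof -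
        have "(1 - x) / 3 + 1 / 4 * x = (1 - 1 / 4 * x) / 3" for x :: real by (simp add: field_simps)
        then show ?thesis unfolding Suc.IH power_Suc .
      qed
      finally show ?case .
    qed simp
    then show "(\<Sum>m\<in>{1..s div 2}. (1 / 4 :: real) ^ m) \<le> 1 / 3" by simp
  qed simp
  finally show ?thesis by simp
qed

lemma card_nonrigid:
  assumes s: "0 < s"
  shows "card {\<tau> \<in> tuples s. \<not> rigid s \<tau>} \<le> fact s * (2 ^ s * s ^ (s - (s div 6 - s div 100))) ^ 24"
proof -
  define I where "I = {\<phi>. \<phi> permutes {..<s} \<and> s \<le> 2 * card {x. x < s \<and> \<phi> x \<noteq> x}}"
  define Q where "Q \<phi> = {p. p permutes {..<s} \<and> 100 * card {x. x < s \<and> \<phi> (p x) \<noteq> p (\<phi> x)} \<le> s}" for \<phi>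
  have perm: "finite {\<phi>. \<phi> permutes {..<s}}" "card {\<phi>. \<phi> permutes {..<s}} = fact s"
    by (simp_all add: finite_permutations card_permutations[of "{..<s}" s])
  have I: "finite I" "card I \<le> fact s"
    using card_mono[OF perm(1), of I] perm finite_subset[OF _ perm(1), of I] by (auto simp: I_def)
  have "card {\<tau> \<in> tuples s. \<not> rigid s \<tau>} \<le> (\<Sum>\<phi>\<in>I. (2 ^ s * s ^ (s - (s div 6 - s div 100))) ^ 24)"
  proof (rule card_tuples_UN_le[OF I(1)])
    show "{\<tau> \<in> tuples s. \<not> rigid s \<tau>} \<subseteq> (\<Union>\<phi>\<in>I. \<Pi>\<^sub>E i\<in>{..<24}. Q \<phi>)"
    proof
      fix \<tau> assume "\<tau> \<in> {\<tau> \<in> tuples s. \<not> rigid s \<tau>}"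
      then obtain \<phi> where \<phi>: "\<tau> \<in> tuples s" "near s \<tau> \<tau> \<phi>" "\<phi> \<in> I"
        unfolding rigid_def I_def by (auto simp: not_less)
      then have "\<tau> \<in> (\<Pi>\<^sub>E i\<in>{..<24}. Q \<phi>)"
        unfolding near_def Q_def tuples_def by (simp add: PiE_iff)
      with \<phi>(3) show "\<tau> \<in> (\<Union>\<phi>\<in>I. \<Pi>\<^sub>E i\<in>{..<24}. Q \<phi>)" by blast
    qed
    show "finite (Q \<phi>) \<and> card (Q \<phi>) \<le> 2 ^ s * s ^ (s - (s div 6 - s div 100))" if "\<phi> \<in> I" for \<phi>
      using that card_perms_almost_commuting[OF s] finite_subset[OF _ perm(1), of "Q \<phi>"]
      by (auto simp: I_def Q_def)
  qed
  also have "\<dots> \<le> fact s * (2 ^ s * s ^ (s - (s div 6 - s div 100))) ^ 24"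
    using I(2) by simp
  finally show ?thesis .
qed

text \<open>For fixed \<open>\<phi>\<close> each \<open>\<tau> i\<close> must agree, up to one
  percent, with the conjugate of \<open>\<tau>' i\<close> by \<open>\<phi>\<close>; then the union
  bound over all \<open>\<phi>\<close>.\<close>

lemma card_near:
  assumes s: "0 < s"
  shows "card {\<tau> \<in> tuples s. \<exists>\<phi>. \<phi> permutes {..<s} \<and> near s \<tau> \<tau>' \<phi>} \<le> fact s * (2 ^ s * s ^ (s div 100)) ^ 24"
proof -
  define I where "I = {\<phi>. \<phi> permutes {..<s}}"
  define Q where "Q \<phi> i = {p. p permutes {..<s} \<and> 100 * card {x. x < s \<and> p x \<noteq> inv \<phi> (\<tau>' i (\<phi> x))} \<le> s}" for \<phi> i
  have I: "finite I" "card I = fact s"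
    by (simp_all add: I_def finite_permutations card_permutations[of "{..<s}" s])
  have "card {\<tau> \<in> tuples s. \<exists>\<phi>. \<phi> permutes {..<s} \<and> near s \<tau> \<tau>' \<phi>} \<le> (\<Sum>\<phi>\<in>I. (2 ^ s * s ^ (s div 100)) ^ 24)"
  proof (rule card_tuples_UN_le[OF I(1)])
    show "{\<tau> \<in> tuples s. \<exists>\<phi>. \<phi> permutes {..<s} \<and> near s \<tau> \<tau>' \<phi>} \<subseteq> (\<Union>\<phi>\<in>I. \<Pi>\<^sub>E i\<in>{..<24}. Q \<phi> i)"
    proof
      fix \<tau> assume "\<tau> \<in> {\<tau> \<in> tuples s. \<exists>\<phi>. \<phi> permutes {..<s} \<and> near s \<tau> \<tau>' \<phi>}"
      then obtain \<phi> where \<phi>: "\<tau> \<in> tuples s" "\<phi> permutes {..<s}" "near s \<tau> \<tau>' \<phi>" by blast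
      have "y = inv \<phi> z \<longleftrightarrow> \<phi> y = z" for y z using permutes_inverses[OF \<phi>(2)] by metis
      then have "\<tau> \<in> (\<Pi>\<^sub>E i\<in>{..<24}. Q \<phi> i)"
        using \<phi>(1,3) unfolding near_def Q_def tuples_def by (simp add: PiE_iff)
      with \<phi>(2) show "\<tau> \<in> (\<Union>\<phi>\<in>I. \<Pi>\<^sub>E i\<in>{..<24}. Q \<phi> i)" by (auto simp: I_def)
    qed
    show "finite (Q \<phi> i) \<and> card (Q \<phi> i) \<le> 2 ^ s * s ^ (s div 100)" if "\<phi> \<in> I" for \<phi> i
      using card_perms_close_to[OF s] finite_subset[OF _ I(1), of "Q \<phi> i"]
      by (auto simp: I_def Q_def)
  qed
  then show ?thesis using I(2) by simp
qed

text \<open>\<open>n ^ n / fact n\<close> is one term of the series of \<open>exp n\<close>.\<close>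

lemma ln_fact_ge:
  assumes "0 < n" shows "real n * ln (real n) - real n \<le> ln (fact n)"
proof -
  have "real n ^ n / fact n \<le> exp (real n)"
  proof -
    have "(\<Sum>k\<in>{n}. inverse (fact k) *\<^sub>R real n ^ k) \<le> (\<Sum>k. inverse (fact k) *\<^sub>R real n ^ k)"
      using summable_exp_generic[of "real n"] by (intro sum_le_suminf) auto
    then show ?thesis by (simp add: exp_def divide_inverse mult.commute)
  qed
  then have "ln (real n ^ n / fact n) \<le> ln (exp (real n))"
    using assms by (subst ln_le_cancel_iff) auto
  then show ?thesis using assms by (simp add: ln_div ln_realpow)
qed

lemma ln_fact_le: "0 < n \<Longrightarrow> ln (fact n) \<le> real n * ln (real n)"
proof -
  assume n: "0 < n"
  have "(fact n :: real) \<le> real n ^ n" using fact_le_power[of n] by simp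
  then have "ln (fact n :: real) \<le> ln (real n ^ n)" using n by simp
  then show ?thesis using n by (simp add: ln_realpow)
qed

text \<open>In units of \<open>s * ln s\<close> the logarithms on the left are at most about
  \<open>1 + 24 * 0.86\<close> and \<open>2 + 24 * 0.01\<close>, those on the right about 24. The
  error terms are linear in \<open>s\<close>, and \<open>ln s \<ge> 200\<close> outweighs
  them.\<close>

lemma counting_estimates:
  assumes s: "exp 200 \<le> real s"
  shows "3 * (fact s * (2 ^ s * real s ^ (s - (s div 6 - s div 100))) ^ 24) \<le> fact s ^ 24"
    and "3 * (fact s * (fact s * (2 ^ s * real s ^ (s div 100)) ^ 24)) \<le> fact s ^ 24"
proof -
  define u where "u = real s * ln (real s)"
  have s1: "201 \<le> real s" using s exp_ge_add_one_self[of "200::real"] by simp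
  then have s0: "0 < s" by simp
  have ln200: "200 \<le> ln (real s)" using s s0 by (subst ln_ge_iff) auto
  have su: "200 * real s \<le> u" unfolding u_def using ln200 s0 by (simp add: mult.commute)
  have F: "u - real s \<le> ln (fact s)" "ln (fact s) \<le> u"
    using ln_fact_ge[OF s0] ln_fact_le[OF s0] by (auto simp: u_def)
  have ln2: "ln (2::real) \<le> 1" using ln_2_less_1 by simp
  have ln3: "ln (3::real) \<le> 2" using ln_le_minus_one[of "3::real"] by simp
  have est: "c + f + 24 * (a + r) \<le> 24 * f" "c + 2 * f + 24 * (a + t) \<le> 24 * f"
    if "u - v \<le> f" "f \<le> u" "r \<le> 86 / 100 * u" "t \<le> 1 / 100 * u" "a \<le> v" "c \<le> 2" "200 * v \<le> u" "201 \<le> v"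
    for c f a r t u v :: real
  proof -
    have "24 * r \<le> 2064 / 100 * u" "24 * t \<le> 24 / 100 * u" using that(3,4) by linarith+
    then show "c + f + 24 * (a + r) \<le> 24 * f" "c + 2 * f + 24 * (a + t) \<le> 24 * f"
      using that(1,2,5-8) by argo+
  qed
  have ln2s: "real s * ln 2 \<le> real s" using ln2 by (simp add: mult_left_le)
  define R where "R = s - (s div 6 - s div 100)"
  \<comment> \<open>\<open>1 - 1/6 + 1/100\<close> is below 0.85; the remainder up to 0.86 absorbs
    the rounding.\<close>
  have "real R \<le> 86 / 100 * real s"
  proof -
    have "real (s div 6) \<ge> real s / 6 - 1" "real (s div 100) \<le> real s / 100" by linarith+
    moreover have "real R \<le> real s - real (s div 6) + real (s div 100)" unfolding R_def by linarith
    ultimately show ?thesis using s1 by linarith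
  qed
  then have R: "real R * ln (real s) \<le> 86 / 100 * u"
    unfolding u_def using ln200 by (simp add: mult_right_mono flip: mult.assoc)
  have "real (s div 100) \<le> 1 / 100 * real s" by linarith
  then have D: "real (s div 100) * ln (real s) \<le> 1 / 100 * u"
    unfolding u_def using ln200 by (simp add: mult_right_mono flip: mult.assoc)
  have "ln (3 * (fact s * (2 ^ s * real s ^ R) ^ 24)) = ln 3 + ln (fact s) + 24 * (real s * ln 2 + real R * ln (real s))"
    using s0 by (simp add: ln_mult ln_realpow)
  also have "\<dots> \<le> 24 * ln (fact s)" using est(1)[OF F R D ln2s ln3 su s1] .
  also have "\<dots> = ln (fact s ^ 24)" by (simp add: ln_realpow)
  finally show "3 * (fact s * (2 ^ s * real s ^ (s - (s div 6 - s div 100))) ^ 24) \<le> fact s ^ 24"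
    using s0 by (subst (asm) ln_le_cancel_iff) (auto simp: R_def)
  have "ln (3 * (fact s * (fact s * (2 ^ s * real s ^ (s div 100)) ^ 24)))
      = ln 3 + 2 * ln (fact s) + 24 * (real s * ln 2 + real (s div 100) * ln (real s))"
    using s0 by (simp add: ln_mult ln_realpow)
  also have "\<dots> \<le> 24 * ln (fact s)" using est(2)[OF F R D ln2s ln3 su s1] .
  also have "\<dots> = ln (fact s ^ 24)" by (simp add: ln_realpow)
  finally show "3 * (fact s * (fact s * (2 ^ s * real s ^ (s div 100)) ^ 24)) \<le> fact s ^ 24"
    using s0 by (subst (asm) ln_le_cancel_iff) auto
qed

text \<open>Tuples failing expansion or rigidity are at most two thirds. The remaining third is
  covered by the neighbourhoods of members of \<open>Acc\<close>, each holding at most a fraction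
  \<open>1 / (3 * fact s)\<close> of all tuples.\<close>

lemma maximal_family_large:
  assumes s: "exp 200 \<le> real s" and Acc: "finite Acc"
    and max: "\<And>\<tau>. \<tau> \<in> tuples s \<Longrightarrow> expanding s \<tau> \<Longrightarrow> rigid s \<tau> \<Longrightarrow>
      \<exists>\<tau>'\<in>Acc. \<exists>\<phi>. \<phi> permutes {..<s} \<and> near s \<tau> \<tau>' \<phi>"
  shows "fact s \<le> card Acc"
proof -
  have s0: "0 < s" using s exp_gt_zero[of "200::real"] by (cases s) (simp_all add: not_le[symmetric])
  let ?F = "fact s :: real"
  define b where "b = ?F * (2 ^ s * real s ^ (s div 100)) ^ 24"
  have b0: "0 < b" using s0 by (simp add: b_def)
  let ?E = "{\<tau> \<in> tuples s. \<not> expanding s \<tau>}" and ?R = "{\<tau> \<in> tuples s. \<not> rigid s \<tau>}"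
  let ?N = "\<lambda>\<tau>'. {\<tau> \<in> tuples s. \<exists>\<phi>. \<phi> permutes {..<s} \<and> near s \<tau> \<tau>' \<phi>}"
  have "tuples s \<subseteq> ?E \<union> ?R \<union> (\<Union>\<tau>'\<in>Acc. ?N \<tau>')" using max by blast
  then have "card (tuples s) \<le> card (?E \<union> ?R \<union> (\<Union>\<tau>'\<in>Acc. ?N \<tau>'))"
    using finite_tuples Acc by (intro card_mono) auto
  also have "\<dots> \<le> card ?E + card ?R + card (\<Union>\<tau>'\<in>Acc. ?N \<tau>')"
    by (intro order_trans[OF card_Un_le] add_mono order_refl)
  also have "card (\<Union>\<tau>'\<in>Acc. ?N \<tau>') \<le> (\<Sum>\<tau>'\<in>Acc. card (?N \<tau>'))" using Acc by (rule card_UN_le)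
  finally have "real (card (tuples s)) \<le> real (card ?E) + real (card ?R) + (\<Sum>\<tau>'\<in>Acc. real (card (?N \<tau>')))"
    by (simp flip: of_nat_sum of_nat_add)
  moreover have "(\<Sum>\<tau>'\<in>Acc. real (card (?N \<tau>'))) \<le> (\<Sum>\<tau>'\<in>Acc. b)"
  proof (rule sum_mono)
    fix \<tau>' show "real (card (?N \<tau>')) \<le> b"
      using of_nat_mono[OF card_near[OF s0, of \<tau>'], where 'a = real] by (simp add: b_def)
  qed
  moreover have "real (card ?R) \<le> ?F ^ 24 / 3"
    using of_nat_mono[OF card_nonrigid[OF s0], where 'a = real] counting_estimates(1)[OF s] by simp
  moreover have "real (card ?E) \<le> ?F ^ 24 / 3" by (rule card_nonexpanding[OF s0])
  ultimately have "?F ^ 24 / 3 \<le> real (card Acc) * b" by (simp add: card_tuples)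
  moreover have "3 * (?F * b) \<le> ?F ^ 24" using counting_estimates(2)[OF s] unfolding b_def .
  ultimately have "?F * b \<le> real (card Acc) * b" by linarith
  then have "?F \<le> real (card Acc)" using b0 by simp
  then show ?thesis by (metis of_nat_fact of_nat_le_iff)
qed

section \<open>Partial maps of components with few defects\<close>

text \<open>\<open>near\<close> and \<open>rigid\<close> speak of permutations of all cells, while a
  vertex permutation yields only an injection on some of them; this bridges the gap.\<close>

lemma permutes_extending:
  fixes f :: "nat \<Rightarrow> nat"
  assumes "A \<subseteq> {..<s}" "inj_on f A" "f ` A \<subseteq> {..<s}"
  obtains \<phi> where "\<phi> permutes {..<s}" "\<And>x. x \<in> A \<Longrightarrow> \<phi> x = f x"
proof -
  have fin: "finite A" using assms(1) finite_subset by blast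
  have "card ({..<s} - A) = card ({..<s} - f ` A)"
    using assms fin by (simp add: card_Diff_subset card_image)
  then obtain g where g: "bij_betw g ({..<s} - A) ({..<s} - f ` A)"
    using finite_same_card_bij[of "{..<s} - A" "{..<s} - f ` A"] by auto
  define \<phi> where "\<phi> x = (if x \<in> A then f x else if x < s then g x else x)" for x
  have "bij_betw \<phi> A (f ` A)"
    using bij_betw_imageI[OF assms(2) refl] by (subst bij_betw_cong[of _ _ f]) (auto simp: \<phi>_def)
  moreover have "bij_betw \<phi> ({..<s} - A) ({..<s} - f ` A)"
    using g by (subst bij_betw_cong[of _ _ g]) (auto simp: \<phi>_def)
  ultimately have "bij_betw \<phi> (A \<union> ({..<s} - A)) (f ` A \<union> ({..<s} - f ` A))"
    by (rule bij_betw_combine) auto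
  moreover have "A \<union> ({..<s} - A) = {..<s}" "f ` A \<union> ({..<s} - f ` A) = {..<s}" using assms by auto
  ultimately have "\<phi> permutes {..<s}"
    using assms(1) by (intro bij_imp_permutes) (auto simp: \<phi>_def)
  then show thesis by (rule that) (simp add: \<phi>_def)
qed

text \<open>If few vertices of a component are bad, expansion forces almost all of it into a single
  component; closeness then rules out every other component, and by rigidity and once more
  expansion the map is close to the identity.\<close>

lemma component_moved_le:
  fixes \<tau> :: "nat \<Rightarrow> nat \<Rightarrow> nat" and c f :: "nat \<Rightarrow> nat"
  assumes s: "0 < s" and \<tau>: "\<And>i. i < 24 \<Longrightarrow> \<tau> i permutes {..<s}"
    and expd: "expanding s \<tau>" and rig: "rigid s \<tau>"
    and G: "G \<subseteq> {..<s}"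
    and inj: "\<And>x y. x \<in> G \<Longrightarrow> y \<in> G \<Longrightarrow> c x = c y \<Longrightarrow> f x = f y \<Longrightarrow> x = y"
    and less: "\<And>x. x \<in> G \<Longrightarrow> f x < s"
    and hom: "\<And>x i. x \<in> G \<Longrightarrow> i < 24 \<Longrightarrow> \<tau> i x \<in> G \<Longrightarrow> c (\<tau> i x) = c x \<and> f (\<tau> i x) = \<sigma> (c x) i (f x)"
    and own: "\<And>i. i < 24 \<Longrightarrow> \<sigma> j0 i = \<tau> i"
    and far: "\<And>x \<phi>. x \<in> G \<Longrightarrow> c x \<noteq> j0 \<Longrightarrow> \<phi> permutes {..<s} \<Longrightarrow> \<not> near s \<tau> (\<sigma> (c x)) \<phi>"
  shows "card {x \<in> G. \<not> (c x = j0 \<and> f x = x)} \<le> 700 * card ({..<s} - G)"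
proof -
  define b where "b = card ({..<s} - G)"
  have finG: "finite G" using G finite_subset by blast
  have cardG: "card G + b = s"
    using card_Diff_subset[OF finG G] card_mono[OF _ G] by (simp add: b_def)
  have sub_le: "card {x \<in> G. \<not> (c x = j0 \<and> f x = x)} \<le> s"
    using card_mono[of "{..<s}" "{x \<in> G. \<not> (c x = j0 \<and> f x = x)}"] G by auto
  \<comment> \<open>If the images of a nonempty \<open>U\<close> stay in \<open>U\<close> and
    \<open>D\<close>, expansion gives \<open>3 * card U < 2 * (card U + card D)\<close>.\<close>
  have grow: "card U \<le> 2 * card D"
    if "U \<subseteq> {..<s}" "2 * card U \<le> s" "finite D" "\<And>x i. x \<in> U \<Longrightarrow> i < 24 \<Longrightarrow> \<tau> i x \<in> U \<union> D" for U D
  proof (cases "U = {}")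
    case False
    have "3 * card U < 2 * card (\<Union>i<24. \<tau> i ` U)"
      using expd that(1,2) False unfolding expanding_def by blast
    also have "card (\<Union>i<24. \<tau> i ` U) \<le> card (U \<union> D)"
      using that finite_subset[OF that(1)] by (intro card_mono) auto
    also have "card (U \<union> D) \<le> card U + card D" by (rule card_Un_le)
    finally show ?thesis by simp
  qed simp
  have closed: "card U \<le> 2 * b"
    if "U \<subseteq> G" "2 * card U \<le> s" "\<And>x i. x \<in> U \<Longrightarrow> i < 24 \<Longrightarrow> \<tau> i x \<in> G \<Longrightarrow> \<tau> i x \<in> U" for U
    unfolding b_def
  proof (rule grow)
    show "\<tau> i x \<in> U \<union> ({..<s} - G)" if "x \<in> U" "i < 24" for x i
    proof -
      have "\<tau> i x < s" using permutes_less[OF \<tau>[OF that(2)], of x] that(1) \<open>U \<subseteq> G\<close> G by auto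
      then show ?thesis using that \<open>\<And>x i. x \<in> U \<Longrightarrow> i < 24 \<Longrightarrow> \<tau> i x \<in> G \<Longrightarrow> \<tau> i x \<in> U\<close>[of x i] by auto
    qed
  qed (use that G in auto)
  show ?thesis
  \<comment> \<open>600 is 100 times 6: below, at most \<open>6 * b\<close> cells violate
    commutation and \<open>near\<close> tolerates one percent. If \<open>b\<close> is larger, the
    trivial bound \<open>s\<close> suffices.\<close>
  proof (cases "s \<le> 600 * b")
    case True
    then show ?thesis using sub_le unfolding b_def by linarith
  next
    case False
    define A where "A j = {x \<in> G. c x = j}" for j
    have "\<exists>j. s < 2 * card (A j)"
    proof (rule ccontr)
      assume "\<nexists>j. s < 2 * card (A j)"
      then have le: "2 * card (A j) \<le> s" for j using not_less by blast
      have Aj: "card (A j) \<le> 2 * b" for j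
        using le by (intro closed) (use hom in \<open>auto simp: A_def\<close>)
      \<comment> \<open>Labels are joined one by one: two sets of at most \<open>2 * b\<close> cells
        have at most \<open>4 * b\<close> together, still below half, so expansion cuts the union
        back to \<open>2 * b\<close>. In the end \<open>G\<close> itself would be that
        small.\<close>
      have P: "card {x \<in> G. c x < J} \<le> 2 * b" for J
      proof (induction J)
        case (Suc J)
        have "{x \<in> G. c x < Suc J} = {x \<in> G. c x < J} \<union> A J" by (auto simp: A_def)
        then have "card {x \<in> G. c x < Suc J} \<le> card {x \<in> G. c x < J} + card (A J)"
          using card_Un_le by metis
        then have "card {x \<in> G. c x < Suc J} \<le> 4 * b" using Suc Aj[of J] by linarith
        then have "2 * card {x \<in> G. c x < Suc J} \<le> s" using False by linarith
        then show ?case by (intro closed) (use hom in auto)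
      qed simp
      have "c x < Suc (Max (c ` G))" if "x \<in> G" for x using finG that by (simp add: less_Suc_eq_le)
      then have "{x \<in> G. c x < Suc (Max (c ` G))} = G" by blast
      then have "card G \<le> 2 * b" using P[of "Suc (Max (c ` G))"] by simp
      then show False using cardG False by linarith
    qed
    then obtain j where j: "s < 2 * card (A j)" ..
    have AG: "A j \<subseteq> G" "finite (A j)" using finG by (auto simp: A_def)
    define U where "U = G - A j"
    have cU: "card U + card (A j) = card G"
      using card_Diff_subset[OF AG(2,1)] card_mono[OF finG AG(1)] by (simp add: U_def)
    have U: "card U \<le> 2 * b"
      using cU j cardG by (intro closed) (use hom in \<open>auto simp: U_def A_def\<close>)
    define D where "D = {..<s} - A j"
    have D: "card D \<le> 3 * b"
    proof -
      have "D = U \<union> ({..<s} - G)" using G AG by (auto simp: D_def U_def)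
      then have "card D \<le> card U + b" unfolding b_def by (simp add: card_Un_le)
      then show ?thesis using U by simp
    qed
    have finD: "finite D" by (simp add: D_def)
    have "inj_on f (A j)" using inj AG by (auto simp: inj_on_def A_def)
    moreover have "f ` A j \<subseteq> {..<s}" using less AG by auto
    ultimately obtain \<phi> where \<phi>: "\<phi> permutes {..<s}" "\<And>x. x \<in> A j \<Longrightarrow> \<phi> x = f x"
      using permutes_extending[of "A j" s f] AG G by blast
    \<comment> \<open>A violation at \<open>x\<close> puts \<open>x\<close> or
      \<open>\<tau> i x\<close> into \<open>D\<close>, hence at most twice \<open>3 * b\<close>
      cells.\<close>
    have near: "near s \<tau> (\<sigma> j) \<phi>"
      unfolding near_def
    proof (intro allI impI)
      fix i :: nat assume i: "i < 24"
      have "{x. x < s \<and> \<phi> (\<tau> i x) \<noteq> \<sigma> j i (\<phi> x)} \<subseteq> D \<union> inv (\<tau> i) ` D"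
      proof
        fix x assume x: "x \<in> {x. x < s \<and> \<phi> (\<tau> i x) \<noteq> \<sigma> j i (\<phi> x)}"
        show "x \<in> D \<union> inv (\<tau> i) ` D"
        proof (rule ccontr)
          assume no: "x \<notin> D \<union> inv (\<tau> i) ` D"
          have "inv (\<tau> i) (\<tau> i x) = x" using permutes_inverses(2)[OF \<tau>[OF i]] .
          then have "\<tau> i x \<notin> D" using no by (metis UnI2 image_eqI)
          then have "\<tau> i x \<in> A j" "x \<in> A j"
            using no x permutes_less[OF \<tau>[OF i], of x] by (auto simp: D_def)
          then have "\<phi> (\<tau> i x) = \<sigma> j i (\<phi> x)" using hom[of x i] i \<phi>(2) by (simp add: A_def)
          then show False using x by simp
        qed
      qed
      then have "card {x. x < s \<and> \<phi> (\<tau> i x) \<noteq> \<sigma> j i (\<phi> x)} \<le> card (D \<union> inv (\<tau> i) ` D)"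
        using finD by (intro card_mono) auto
      also have "\<dots> \<le> card D + card (inv (\<tau> i) ` D)" by (rule card_Un_le)
      also have "\<dots> \<le> 6 * b" using D card_image_le[OF finD, of "inv (\<tau> i)"] by linarith
      finally show "100 * card {x. x < s \<and> \<phi> (\<tau> i x) \<noteq> \<sigma> j i (\<phi> x)} \<le> s" using False by linarith
    qed
    have "A j \<noteq> {}" using j by auto
    then have j0: "j = j0" using near far[OF _ _ \<phi>(1)] by (auto simp: A_def)
    have "near s \<tau> \<tau> \<phi>" using near own unfolding j0 near_def by simp
    then have mv: "2 * card {x. x < s \<and> \<phi> x \<noteq> x} < s" using rig \<phi>(1) unfolding rigid_def by blast
    \<comment> \<open>Inside \<open>A j\<close>, \<open>\<tau> i\<close> is injective and commutes
      with \<open>f\<close>, so it never sends a moved cell to a fixed one: \<open>M\<close> leaks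
      only into \<open>D\<close>. Rigidity keeps \<open>M\<close> below half of the cells, as
      \<open>grow\<close> requires.\<close>
    define M where "M = {x \<in> A j. f x \<noteq> x}"
    have M: "M \<subseteq> {x. x < s \<and> \<phi> x \<noteq> x}" using \<phi>(2) AG G by (auto simp: M_def)
    have "card M \<le> 2 * card D"
    proof (rule grow)
      show "M \<subseteq> {..<s}" using M by auto
      show "2 * card M \<le> s" using card_mono[OF _ M] mv by simp
      show "\<tau> i x \<in> M \<union> D" if x: "x \<in> M" and i: "i < 24" for x i
      proof (rule ccontr)
        assume no: "\<tau> i x \<notin> M \<union> D"
        have xA: "x \<in> A j" "f x \<noteq> x" using x by (auto simp: M_def)
        then have "\<tau> i x < s" using permutes_less[OF \<tau>[OF i], of x] AG G by auto
        then have tA: "\<tau> i x \<in> A j" using no by (auto simp: D_def)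
        then have "f (\<tau> i x) = \<tau> i x" using no by (auto simp: M_def)
        moreover have "f (\<tau> i x) = \<tau> i (f x)" using hom[of x i] i xA tA own j0 by (auto simp: A_def)
        ultimately have "\<tau> i (f x) = \<tau> i x" by simp
        then show False using permutes_inj[OF \<tau>[OF i]] xA(2) by (auto dest: injD)
      qed
    qed (rule finD)
    then have "card M \<le> 6 * b" using D by linarith
    moreover have "{x \<in> G. \<not> (c x = j0 \<and> f x = x)} \<subseteq> U \<union> M" by (auto simp: U_def M_def A_def j0)
    then have "card {x \<in> G. \<not> (c x = j0 \<and> f x = x)} \<le> card U + card M"
      using order_trans[OF card_mono card_Un_le, of U M] finG AG by (auto simp: U_def M_def)
    ultimately show ?thesis using U unfolding b_def[symmetric] by linarith
  qed
qed

text \<open>\<open>component_moved_le\<close> summed over all components. \<open>off\<close>,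
  \<open>cl\<close> and \<open>loc\<close> are coordinates of cells; for component \<open>j\<close>
  the label \<open>c x\<close> is the component receiving cell \<open>x\<close> and
  \<open>f x\<close> its place there.\<close>

lemma cells_moved_le:
  fixes sz off cl loc :: "nat \<Rightarrow> nat" and \<tau> :: "nat \<Rightarrow> nat \<Rightarrow> nat \<Rightarrow> nat"
  assumes cell: "\<And>X. X < N \<Longrightarrow> cl X < q \<and> loc X < sz (cl X) \<and> X = off (cl X) + loc X"
    and off: "\<And>j x. j < q \<Longrightarrow> x < sz j \<Longrightarrow> off j + x < N \<and> cl (off j + x) = j \<and> loc (off j + x) = x"
    and sz: "\<And>j. j < q \<Longrightarrow> 0 < sz j"
    and \<tau>: "\<And>j i. j < q \<Longrightarrow> i < 24 \<Longrightarrow> \<tau> j i permutes {..<sz j}"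
    and expd: "\<And>j. j < q \<Longrightarrow> expanding (sz j) (\<tau> j)" and rig: "\<And>j. j < q \<Longrightarrow> rigid (sz j) (\<tau> j)"
    and T: "\<And>i X. i < 24 \<Longrightarrow> X < N \<Longrightarrow> T i X = off (cl X) + \<tau> (cl X) i (loc X)"
    and Gd: "Gd \<subseteq> {..<N}" and inj: "inj_on \<psi> Gd" and less: "\<psi> ` Gd \<subseteq> {..<N}"
    and hom: "\<And>X i. X \<in> Gd \<Longrightarrow> i < 24 \<Longrightarrow> T i X \<in> Gd \<Longrightarrow> \<psi> (T i X) = T i (\<psi> X)"
    and szeq: "\<And>X. X \<in> Gd \<Longrightarrow> sz (cl (\<psi> X)) = sz (cl X)"
    and far: "\<And>X \<phi>. X \<in> Gd \<Longrightarrow> cl (\<psi> X) \<noteq> cl X \<Longrightarrow> \<phi> permutes {..<sz (cl X)} \<Longrightarrow>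
      \<not> near (sz (cl X)) (\<tau> (cl X)) (\<tau> (cl (\<psi> X))) \<phi>"
  shows "card {X \<in> Gd. \<psi> X \<noteq> X} \<le> 700 * card ({..<N} - Gd)"
proof -
  have sum: "card B = (\<Sum>j<q. card {x. x < sz j \<and> off j + x \<in> B})" if B: "B \<subseteq> {..<N}" for B
  proof -
    have eq: "B = (\<Union>j<q. (+) (off j) ` {x. x < sz j \<and> off j + x \<in> B})"
    proof (intro set_eqI iffI)
      fix X assume X: "X \<in> B"
      then show "X \<in> (\<Union>j<q. (+) (off j) ` {x. x < sz j \<and> off j + x \<in> B})"
        using cell[of X] B by (intro UN_I[of "cl X"]) (auto intro!: image_eqI[of _ _ "loc X"])
    qed auto
    have "card B = (\<Sum>j<q. card ((+) (off j) ` {x. x < sz j \<and> off j + x \<in> B}))"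
    proof (subst eq, rule card_UN_disjoint)
      show "\<forall>i\<in>{..<q}. \<forall>j\<in>{..<q}. i \<noteq> j \<longrightarrow> (+) (off i) ` {x. x < sz i \<and> off i + x \<in> B} \<inter>
          (+) (off j) ` {x. x < sz j \<and> off j + x \<in> B} = {}"
      proof (intro ballI impI)
        fix i j assume ij: "i \<in> {..<q}" "j \<in> {..<q}" "i \<noteq> j"
        have False if "x < sz i" "y < sz j" "off i + x = off j + y" for x y
          using off[of i x] off[of j y] ij that by auto
        show "(+) (off i) ` {x. x < sz i \<and> off i + x \<in> B} \<inter>
          (+) (off j) ` {x. x < sz j \<and> off j + x \<in> B} = {}"
        proof (rule equals0I, elim IntE imageE CollectE conjE)
          fix z x y assume "z = off i + x" "x < sz i" "z = off j + y" "y < sz j"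
          then show False using \<open>\<And>x y. x < sz i \<Longrightarrow> y < sz j \<Longrightarrow> off i + x = off j + y \<Longrightarrow> False\<close>[of x y] by simp
        qed
      qed
    qed auto
    also have "\<dots> = (\<Sum>j<q. card {x. x < sz j \<and> off j + x \<in> B})"
      by (intro sum.cong refl card_image) (auto simp: inj_on_def)
    finally show ?thesis .
  qed
  have le: "card {x. x < sz j \<and> off j + x \<in> {X \<in> Gd. \<psi> X \<noteq> X}} \<le>
      700 * card {x. x < sz j \<and> off j + x \<in> {..<N} - Gd}" if j: "j < q" for j
  proof -
    define G where "G = {x. x < sz j \<and> off j + x \<in> Gd}"
    define c where "c x = cl (\<psi> (off j + x))" for x
    define f where "f x = loc (\<psi> (off j + x))" for x
    have cellG: "\<psi> (off j + x) < N" "c x < q" "f x < sz (c x)" "\<psi> (off j + x) = off (c x) + f x"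
      if "x \<in> G" for x
      using that less cell[of "\<psi> (off j + x)"] by (auto simp: G_def c_def f_def)
    have "card {x \<in> G. \<not> (c x = j \<and> f x = x)} \<le> 700 * card ({..<sz j} - G)"
    proof (rule component_moved_le)
      show "0 < sz j" "expanding (sz j) (\<tau> j)" "rigid (sz j) (\<tau> j)" using j sz expd rig by auto
      show "\<tau> j i permutes {..<sz j}" if "i < 24" for i using \<tau> j that .
      show "G \<subseteq> {..<sz j}" by (auto simp: G_def)
      show "x = y" if "x \<in> G" "y \<in> G" "c x = c y" "f x = f y" for x y
      proof -
        have "\<psi> (off j + x) = \<psi> (off j + y)"
          using cellG(4)[OF that(1)] cellG(4)[OF that(2)] that(3,4) by metis
        moreover have "off j + x \<in> Gd" "off j + y \<in> Gd" using that(1,2) by (auto simp: G_def)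
        ultimately have "off j + x = off j + y" by (rule inj_onD[OF inj])
        then show ?thesis by simp
      qed
      show "f x < sz j" if "x \<in> G" for x
        using cellG(3)[OF that] szeq[of "off j + x"] off[OF j, of x] that by (auto simp: G_def c_def)
      show "\<not> near (sz j) (\<tau> j) (\<tau> (c x)) \<phi>" if "x \<in> G" "c x \<noteq> j" "\<phi> permutes {..<sz j}" for x \<phi>
        using far[of "off j + x" \<phi>] off[OF j, of x] that by (auto simp: G_def c_def)
      show "c (\<tau> j i x) = c x \<and> f (\<tau> j i x) = \<tau> (c x) i (f x)"
        if x: "x \<in> G" and i: "i < 24" and tx: "\<tau> j i x \<in> G" for x i
      proof -
        have xs: "x < sz j" "off j + x \<in> Gd" using x by (auto simp: G_def)
        have "T i (off j + x) = off j + \<tau> j i x" using T[OF i, of "off j + x"] off[OF j xs(1)] by simp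
        then have "\<psi> (off j + \<tau> j i x) = T i (off (c x) + f x)"
          using hom[OF xs(2) i] tx cellG(4)[OF x] by (simp add: G_def)
        also have "\<dots> = off (c x) + \<tau> (c x) i (f x)"
          using T[OF i, of "off (c x) + f x"] off[OF cellG(2,3)[OF x]] by simp
        finally have "\<psi> (off j + \<tau> j i x) = off (c x) + \<tau> (c x) i (f x)" .
        moreover have "\<tau> (c x) i (f x) < sz (c x)"
          using permutes_less[OF \<tau>[OF cellG(2)[OF x] i] cellG(3)[OF x]] .
        ultimately show ?thesis
          using off[OF cellG(2)[OF x], of "\<tau> (c x) i (f x)"] by (simp add: c_def[of "\<tau> j i x"] f_def[of "\<tau> j i x"])
      qed
    qed simp
    moreover have "{x. x < sz j \<and> off j + x \<in> {X \<in> Gd. \<psi> X \<noteq> X}} \<subseteq> {x \<in> G. \<not> (c x = j \<and> f x = x)}"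
      using cellG(4) by (auto simp: G_def)
    then have "card {x. x < sz j \<and> off j + x \<in> {X \<in> Gd. \<psi> X \<noteq> X}} \<le> card {x \<in> G. \<not> (c x = j \<and> f x = x)}"
      by (intro card_mono) (auto simp: G_def)
    moreover have "{..<sz j} - G = {x. x < sz j \<and> off j + x \<in> {..<N} - Gd}"
      using off[OF j] by (auto simp: G_def)
    ultimately show ?thesis by simp
  qed
  have "card {X \<in> Gd. \<psi> X \<noteq> X} = (\<Sum>j<q. card {x. x < sz j \<and> off j + x \<in> {X \<in> Gd. \<psi> X \<noteq> X}})"
    using Gd by (intro sum) auto
  also have "\<dots> \<le> (\<Sum>j<q. 700 * card {x. x < sz j \<and> off j + x \<in> {..<N} - Gd})"
    using le by (intro sum_mono) auto
  also have "\<dots> = 700 * card ({..<N} - Gd)"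
    using sum[of "{..<N} - Gd"] by (simp add: sum_distrib_left)
  finally show ?thesis .
qed

section \<open>From permutations to graphs\<close>

definition graph_of :: "nat \<Rightarrow> (nat \<Rightarrow> nat \<Rightarrow> bool) \<Rightarrow> nat set set" where
  "graph_of n R = {{u, v} |u v. u \<in> {1..n} \<and> v \<in> {1..n} \<and> u \<noteq> v \<and> R u v}"

lemma graph_graph_of: "graph {1..n} (graph_of n R)"
  unfolding graph_def graph_of_def by blast

lemma edge_graph_of_iff:
  "{u, v} \<in> graph_of n R \<longleftrightarrow> u \<in> {1..n} \<and> v \<in> {1..n} \<and> u \<noteq> v \<and> (R u v \<or> R v u)"
  unfolding graph_of_def by (auto simp: doubleton_eq_iff)

definition nbrs :: "nat \<Rightarrow> nat set set \<Rightarrow> nat \<Rightarrow> nat set" where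
  "nbrs n E v = {w \<in> {1..n}. {v, w} \<in> E}"

lemma graph_edgeD: "graph V E \<Longrightarrow> {u, v} \<in> E \<Longrightarrow> u \<in> V \<and> v \<in> V \<and> u \<noteq> v"
  unfolding graph_def by (auto simp: doubleton_eq_iff)

lemma degree_eq_card_nbrs:
  assumes "graph {1..n} E" "v \<in> {1..n}"
  shows "degree_in E v = card (nbrs n E v)"
proof -
  have "{e \<in> E. v \<in> e} = (\<lambda>w. {v, w}) ` nbrs n E v"
  proof (intro set_eqI iffI)
    fix e assume e: "e \<in> {e \<in> E. v \<in> e}"
    then obtain a b where ab: "e = {a, b}" "a \<in> {1..n}" "b \<in> {1..n}"
      using assms(1) unfolding graph_def by blast
    then have "e = {v, if v = a then b else a}" using e by auto
    moreover have "(if v = a then b else a) \<in> {1..n}" using ab by simp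
    ultimately show "e \<in> (\<lambda>w. {v, w}) ` nbrs n E v" using e unfolding nbrs_def by blast
  qed (auto simp: nbrs_def)
  moreover have "inj_on (\<lambda>w. {v, w}) (nbrs n E v)" by (auto simp: inj_on_def doubleton_eq_iff)
  ultimately show ?thesis by (simp add: degree_in_def card_image)
qed

text \<open>Being an automorphism, localised at a vertex: degree and neighbourhood carry over at
  good vertices, and the others are charged to changed edges.\<close>

definition good :: "nat \<Rightarrow> nat set set \<Rightarrow> (nat \<Rightarrow> nat) \<Rightarrow> nat \<Rightarrow> bool" where
  "good n E \<pi> v \<longleftrightarrow> (\<forall>w\<in>{1..n}. {v, w} \<in> E \<longleftrightarrow> {\<pi> v, \<pi> w} \<in> E)"

lemma goodD: "good n E \<pi> v \<Longrightarrow> w \<in> {1..n} \<Longrightarrow> {\<pi> v, \<pi> w} \<in> E \<longleftrightarrow> {v, w} \<in> E"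
  unfolding good_def by blast

lemma good_nbrs:
  assumes "\<pi> permutes {1..n}" "good n E \<pi> v"
  shows "nbrs n E (\<pi> v) = \<pi> ` nbrs n E v"
proof (intro set_eqI iffI)
  fix w assume w: "w \<in> nbrs n E (\<pi> v)"
  then have "w \<in> \<pi> ` {1..n}" unfolding permutes_image[OF assms(1)] by (simp add: nbrs_def)
  then obtain u where "w = \<pi> u" "u \<in> {1..n}" by blast
  then show "w \<in> \<pi> ` nbrs n E v" using w goodD[OF assms(2)] by (auto simp: nbrs_def)
next
  fix w assume "w \<in> \<pi> ` nbrs n E v"
  then show "w \<in> nbrs n E (\<pi> v)"
    using goodD[OF assms(2)] permutes_in_image[OF assms(1)] by (auto simp: nbrs_def)
qed

lemma good_card_nbrs:
  assumes "\<pi> permutes {1..n}" "good n E \<pi> v"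
  shows "card (nbrs n E (\<pi> v)) = card (nbrs n E v)"
  unfolding good_nbrs[OF assms] using permutes_inj_on[OF assms(1)] by (rule card_image)

text \<open>If adjacency of \<open>v\<close> and \<open>w\<close> is not preserved, the pair of
  their images lies in the symmetric difference. So bad vertices have distinct images among the
  endpoints of changed edges, two per edge.\<close>

lemma card_bad_le:
  assumes g: "graph {1..n} E" and p: "\<pi> permutes {1..n}"
  shows "card {v \<in> {1..n}. \<not> good n E \<pi> v} \<le> 2 * card (sym_diff E ((\<lambda>e. \<pi> ` e) ` E))"
proof -
  let ?D = "sym_diff E ((\<lambda>e. \<pi> ` e) ` E)"
  have injp: "inj \<pi>" using p by (rule permutes_inj)
  have E2: "e \<in> E \<Longrightarrow> \<exists>a b. e = {a, b} \<and> a \<in> {1..n} \<and> b \<in> {1..n}" for e using g unfolding graph_def by blast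
  have "E \<subseteq> Pow {1..n}" using E2 by blast
  then have finE: "finite E" by (rule finite_subset) simp
  then have finD: "finite ?D" by auto
  have card2: "card e \<le> 2" "finite e" if "e \<in> ?D" for e
  proof -
    have "\<exists>a b. e = {a, b}" using that E2 by fastforce
    then show "card e \<le> 2" "finite e" by (auto simp: card_insert_if)
  qed
  have "\<pi> ` {v \<in> {1..n}. \<not> good n E \<pi> v} \<subseteq> \<Union> ?D"
  proof
    fix x assume "x \<in> \<pi> ` {v \<in> {1..n}. \<not> good n E \<pi> v}"
    then obtain v w where v: "x = \<pi> v" and vw: "({v, w} \<in> E) \<noteq> ({\<pi> v, \<pi> w} \<in> E)"
      unfolding good_def by auto
    have "{\<pi> v, \<pi> w} \<in> (\<lambda>e. \<pi> ` e) ` E \<longleftrightarrow> {v, w} \<in> E"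
    proof
      assume "{\<pi> v, \<pi> w} \<in> (\<lambda>e. \<pi> ` e) ` E"
      then obtain e where e: "e \<in> E" "\<pi> ` {v, w} = \<pi> ` e" by auto
      then show "{v, w} \<in> E" using inj_image_eq_iff[OF injp] by metis
    qed (auto intro: image_eqI[of _ _ "{v, w}"])
    then have "{\<pi> v, \<pi> w} \<in> ?D" using vw by blast
    then show "x \<in> \<Union> ?D" using v by blast
  qed
  then have "card (\<pi> ` {v \<in> {1..n}. \<not> good n E \<pi> v}) \<le> card (\<Union> ?D)"
    using finD card2 by (intro card_mono finite_Union) auto
  also have "\<dots> \<le> (\<Sum>e\<in>?D. card e)" by (rule card_Union_le_sum_card)
  also have "\<dots> \<le> (\<Sum>e\<in>?D. 2)" using card2 by (intro sum_mono) auto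
  finally show ?thesis using card_image[OF inj_on_subset[OF injp subset_UNIV], of "{v \<in> {1..n}. \<not> good n E \<pi> v}"]
    by simp
qed

section \<open>Asymmetric blocks and the wiring of cells\<close>

text \<open>A path on \<open>1, ..., m - 1\<close> with a triangle of tip \<open>m\<close> erected
  over the edge from 2 to 3. The tails beyond 2 and 3 have 1 and \<open>m - 4\<close> vertices, so
  the graph is asymmetric from \<open>m = 6\<close> on.\<close>

definition path_arc :: "nat \<Rightarrow> nat \<Rightarrow> nat \<Rightarrow> bool" where
  "path_arc m u v \<longleftrightarrow> v = u + 1 \<and> v < m \<or> v = m \<and> (u = 2 \<or> u = 3)"

text \<open>Only 2 and 3 have degree 3, only 1 and \<open>m - 1\<close> have degree 1, and of these
  leaves only 1 is adjacent to a vertex of degree 3. This fixes 1, 2, 3 and the tip, and then the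
  path vertex by vertex.\<close>

lemma path_rigid:
  assumes m: "6 \<le> m" and f: "inj_on f {1..m}" "f ` {1..m} \<subseteq> {1..m}"
    and adj: "\<And>u v. u \<in> {1..m} \<Longrightarrow> v \<in> {1..m} \<Longrightarrow> u \<noteq> v \<Longrightarrow>
      path_arc m (f u) (f v) \<or> path_arc m (f v) (f u) \<longleftrightarrow> path_arc m u v \<or> path_arc m v u"
    and u: "u \<in> {1..m}"
  shows "f u = u"
proof -
  define E where "E = graph_of m (path_arc m)"
  have surj: "f ` {1..m} = {1..m}" using f by (simp add: endo_inj_surj)
  have inj: "u \<in> {1..m} \<Longrightarrow> v \<in> {1..m} \<Longrightarrow> f u = f v \<Longrightarrow> u = v" for u v using f(1) by (auto dest: inj_onD)
  have fm: "u \<in> {1..m} \<Longrightarrow> f u \<in> {1..m}" for u using f(2) by blast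
  have edge: "{f u, f v} \<in> E \<longleftrightarrow> {u, v} \<in> E" if "u \<in> {1..m}" "v \<in> {1..m}" for u v
    using adj[OF that] fm that inj[OF that] unfolding E_def edge_graph_of_iff by blast
  have nb: "nbrs m E u = {v \<in> {1..m}. v \<noteq> u \<and> (path_arc m u v \<or> path_arc m v u)}" if "u \<in> {1..m}" for u
    using that unfolding nbrs_def E_def edge_graph_of_iff by auto
  have nb1: "nbrs m E 1 = {2}" and nb2: "nbrs m E 2 = {1, 3, m}" and nb3: "nbrs m E 3 = {2, 4, m}"
    and nbm: "nbrs m E m = {2, 3}" and nbl: "nbrs m E (m - 1) = {m - 2}"
    using m by (auto simp: nb path_arc_def)
  have nbi: "nbrs m E u = {u - 1, u + 1}" if "4 \<le> u" "u \<le> m - 2" for u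
    using m that by (auto simp: nb path_arc_def)
  have nbf: "nbrs m E (f u) = f ` nbrs m E u" if u: "u \<in> {1..m}" for u
  proof (intro set_eqI iffI)
    fix w assume w: "w \<in> nbrs m E (f u)"
    then have "w \<in> f ` {1..m}" unfolding surj by (simp add: nbrs_def)
    then obtain v where "w = f v" "v \<in> {1..m}" by blast
    then show "w \<in> f ` nbrs m E u" using w edge[OF u] by (auto simp: nbrs_def)
  next
    fix w assume "w \<in> f ` nbrs m E u"
    then show "w \<in> nbrs m E (f u)" using edge[OF u] fm by (auto simp: nbrs_def)
  qed
  have cardf: "card (nbrs m E (f u)) = card (nbrs m E u)" if "u \<in> {1..m}" for u
    unfolding nbf[OF that] by (rule card_image) (rule inj_on_subset[OF f(1)], auto simp: nbrs_def)
  have deg: "u = 1 \<or> u = m - 1 \<or> u = 2 \<or> u = 3 \<or> u = m \<or> 4 \<le> u \<and> u \<le> m - 2" if "u \<in> {1..m}" for u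
    using that by auto
  have c: "card (nbrs m E 1) = 1" "card (nbrs m E (m - 1)) = 1" "card (nbrs m E 2) = 3"
    "card (nbrs m E 3) = 3" "card (nbrs m E m) = 2"
    unfolding nb1 nb2 nb3 nbm nbl using m by auto
  have ci: "card (nbrs m E u) = 2" if "4 \<le> u" "u \<le> m - 2" for u
    unfolding nbi[OF that] using that by auto
  have f23: "f u = 2 \<or> f u = 3" if "u = 2 \<or> u = 3" for u
    using deg[OF fm, of u] cardf[of u] c ci[of "f u"] that m by auto
  have f1: "f 1 = 1"
  proof -
    have "f 1 = 1 \<or> f 1 = m - 1" using deg[OF fm, of 1] cardf[of 1] c ci[of "f 1"] m by auto
    moreover have "f 2 \<in> nbrs m E (f 1)" using nbf[of 1] nb1 m by auto
    ultimately show ?thesis using f23[of 2] nbl m by auto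
  qed
  have f2: "f 2 = 2" using nbf[of 1] nb1 f1 m by auto
  have f3: "f 3 = 3" using f23[of 3] f2 inj[of 2 3] m by auto
  have fmm: "f m = m"
  proof -
    have "f m \<in> nbrs m E (f 2)" "f m \<in> nbrs m E (f 3)" using nbf[of 2] nbf[of 3] nb2 nb3 m by auto
    then show ?thesis using f2 f3 nb2 nb3 m by auto
  qed
  have "f v = v" if "v < m" "1 \<le> v" for v
    using that
  proof (induction v rule: less_induct)
    case (less v)
    consider "v = 1" | "v = 2" | "v = 3" | "v = 4" | "5 \<le> v" using less.prems by linarith
    then show ?case
    proof cases
      case 4
      have "f 4 \<in> nbrs m E (f 3)" using nbf[of 3] nb3 m by auto
      then have "f 4 = 2 \<or> f 4 = 4 \<or> f 4 = m" using f3 nb3 by auto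
      then show ?thesis using 4 inj[of 2 4] inj[of m 4] f2 fmm m by auto
    next
      case 5
      then have ih: "f (v - 1) = v - 1" "f (v - 2) = v - 2" using less by auto
      have nbv: "nbrs m E (v - 1) = {v - 1 - 1, v - 1 + 1}" using 5 less.prems by (intro nbi) auto
      have m1: "v - 1 \<in> {1..m}" "v \<in> {1..m}" "v - 2 \<in> {1..m}" using 5 less.prems by auto
      have "v \<in> nbrs m E (v - 1)" unfolding nbv using 5 by simp
      then have "f v \<in> nbrs m E (f (v - 1))" unfolding nbf[OF m1(1)] by (rule imageI)
      then have "f v = v - 2 \<or> f v = v" unfolding ih nbv using 5 by auto
      moreover have "f v \<noteq> v - 2"
      proof
        assume "f v = v - 2"
        then have "v = v - 2" using inj[OF m1(2,3)] ih by simp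
        then show False using 5 by simp
      qed
      ultimately show ?thesis by simp
    qed (use f1 f2 f3 in auto)
  qed
  then show ?thesis using u fmm by (cases "u = m") auto
qed

text \<open>The asymmetric graph on \<open>1, ..., W - 1\<close> plus a centre \<open>W\<close>
  joined to \<open>1, ..., d\<close>, which realises the maximum degree.\<close>

definition block_arc :: "nat \<Rightarrow> nat \<Rightarrow> nat \<Rightarrow> nat \<Rightarrow> bool" where
  "block_arc W d u v \<longleftrightarrow> v < W \<and> path_arc (W - 1) u v \<or> v = W \<and> u \<le> d"

definition flip :: "nat \<Rightarrow> nat" where
  "flip X = (if even X then X + 1 else X - 1)"

definition link :: "(nat \<Rightarrow> nat \<Rightarrow> nat) \<Rightarrow> nat \<Rightarrow> nat \<Rightarrow> nat \<Rightarrow> nat" where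
  "link T a b X = (if b = 27 \<and> 2 \<le> a then T (a - 2) X else X)"

text \<open>A vertex of role \<open>a\<close> has one neighbour of each role \<open>b \<ge> 29 - a\<close>, hence \<open>a\<close> neighbours;
  for \<open>b = a\<close> this requires the fixed-point-free involution \<open>flip\<close>. The star at role 28 holds a
  cell together, and only the links between roles \<open>2, \<dots>, 26\<close> and 27 leave the cell.\<close>

definition cell_arc :: "(nat \<Rightarrow> nat \<Rightarrow> nat) \<Rightarrow> nat \<Rightarrow> nat \<Rightarrow> nat \<Rightarrow> nat \<Rightarrow> bool" where
  "cell_arc T a b X Y \<longleftrightarrow> 29 \<le> a + b \<and> (a < b \<and> Y = link T a b X \<or> a = b \<and> Y = flip X)"

definition role :: "nat \<Rightarrow> nat \<Rightarrow> nat" where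
  "role W u = (u - W - 1) mod 28 + 1"

definition cell :: "nat \<Rightarrow> nat \<Rightarrow> nat" where
  "cell W u = (u - W - 1) div 28"

definition arc :: "nat \<Rightarrow> nat \<Rightarrow> (nat \<Rightarrow> nat \<Rightarrow> nat) \<Rightarrow> nat \<Rightarrow> nat \<Rightarrow> bool" where
  "arc W d T u v \<longleftrightarrow> (if v \<le> W then u \<le> W \<and> block_arc W d u v
     else W < u \<and> cell_arc T (role W u) (role W v) (cell W u) (cell W v))"

lemma flip_flip [simp]: "flip (flip X) = X"
  by (auto simp: flip_def)

lemma flip_neq [simp]: "flip X \<noteq> X" "X \<noteq> flip X"
  by (auto simp: flip_def elim: oddE)

lemma flip_less: "even N \<Longrightarrow> X < N \<Longrightarrow> flip X < N"
  by (auto simp: flip_def) presburger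

section \<open>Recovering cells and block from the plain graph\<close>

text \<open>\<open>T 24\<close> is an additional colour beyond the 24 of a tuple. The bound
  \<open>30 \<le> d\<close> separates the degree of the block centre from the role degrees
  \<open>1, ..., 28\<close>.\<close>

locale cell_graph =
  fixes N W d :: nat and T :: "nat \<Rightarrow> nat \<Rightarrow> nat"
  assumes perm: "\<And>i. i \<le> 24 \<Longrightarrow> T i permutes {..<N}"
    and evN: "even N" and d: "30 \<le> d" and W: "d + 1 \<le> W"
begin

definition n :: nat where "n = W + 28 * N"

definition E :: "nat set set" where "E = graph_of n (arc W d T)"

definition vert :: "nat \<Rightarrow> nat \<Rightarrow> nat" where "vert X a = W + 28 * X + a"

lemma graph_E: "graph {1..n} E"
  unfolding E_def by (rule graph_graph_of)

lemma vert_in: "X < N \<Longrightarrow> a \<in> {1..28} \<Longrightarrow> vert X a \<in> {1..n}"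
  by (auto simp: vert_def n_def)

lemma cell_role_vert [simp]:
  assumes "a \<in> {1..28}"
  shows "cell W (vert X a) = X" "role W (vert X a) = a"
proof -
  obtain c where c: "a = c + 1" "c < 28" using assms by (cases a) auto
  have "vert X a - W - 1 = 28 * X + c" by (simp add: vert_def c)
  then show "cell W (vert X a) = X" "role W (vert X a) = a"
    using c by (simp_all add: cell_def role_def)
qed

lemma vert_gt: "a \<in> {1..28} \<Longrightarrow> W < vert X a"
  by (auto simp: vert_def)

lemma vert_cases:
  assumes "v \<in> {1..n}" "W < v"
  obtains X a where "v = vert X a" "X < N" "a \<in> {1..28}"
proof (rule that)
  have "v - W - 1 = 28 * cell W v + (role W v - 1)" by (simp add: cell_def role_def)
  moreover have "1 \<le> role W v" by (simp add: role_def)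
  ultimately show "v = vert (cell W v) (role W v)" using assms by (simp add: vert_def)
  have "v - W - 1 < 28 * N" using assms by (auto simp: n_def)
  then show "cell W v < N" unfolding cell_def by (simp add: less_mult_imp_div_less mult.commute)
  show "role W v \<in> {1..28}" by (auto simp: role_def Suc_le_eq)
qed

lemma vert_eq_iff: "a \<in> {1..28} \<Longrightarrow> b \<in> {1..28} \<Longrightarrow> vert X a = vert Y b \<longleftrightarrow> X = Y \<and> a = b"
  by (metis cell_role_vert)

lemma edge_vert:
  assumes "X < N" "a \<in> {1..28}" "Y < N" "b \<in> {1..28}"
  shows "{vert X a, vert Y b} \<in> E \<longleftrightarrow> 29 \<le> a + b \<and>
    (a < b \<and> Y = link T a b X \<or> b < a \<and> X = link T b a Y \<or> a = b \<and> Y = flip X)"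
proof -
  have fl: "Y = flip X \<longleftrightarrow> X = flip Y" by (metis flip_flip)
  have arc: "arc W d T (vert X a) (vert Y b) = cell_arc T a b X Y" if "a \<in> {1..28}" "b \<in> {1..28}" for X a Y b
    using vert_gt[OF that(1), of X] vert_gt[OF that(2), of Y] that by (simp add: arc_def)
  have ne: "cell_arc T a b X Y \<Longrightarrow> vert X a \<noteq> vert Y b"
    unfolding vert_eq_iff[OF assms(2,4)] by (auto simp: cell_arc_def)
  have ne': "cell_arc T b a Y X \<Longrightarrow> vert X a \<noteq> vert Y b"
    unfolding vert_eq_iff[OF assms(2,4)] by (auto simp: cell_arc_def)
  have "{vert X a, vert Y b} \<in> E \<longleftrightarrow> cell_arc T a b X Y \<or> cell_arc T b a Y X"
    unfolding E_def edge_graph_of_iff arc[OF assms(2,4)] arc[OF assms(4,2)]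
    using vert_in[OF assms(1,2)] vert_in[OF assms(3,4)] ne ne' by blast
  then show ?thesis unfolding cell_arc_def using fl by (auto simp: add.commute)
qed

lemma edge_block:
  "u \<le> W \<Longrightarrow> v \<le> W \<Longrightarrow> {u, v} \<in> E \<longleftrightarrow> 1 \<le> u \<and> 1 \<le> v \<and> u \<noteq> v \<and> (block_arc W d u v \<or> block_arc W d v u)"
  unfolding E_def edge_graph_of_iff arc_def by (auto simp: n_def)

lemma no_edge_block: "u \<le> W \<Longrightarrow> W < v \<Longrightarrow> {u, v} \<notin> E"
  unfolding E_def edge_graph_of_iff arc_def by auto

lemma link_perm: "a \<le> 28 \<Longrightarrow> a < b \<Longrightarrow> b \<le> 28 \<Longrightarrow> link T a b permutes {..<N}"
proof -
  assume ab: "a \<le> 28" "a < b" "b \<le> 28"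
  show ?thesis
  proof (cases "b = 27 \<and> 2 \<le> a")
    case True
    then have "link T a b = T (a - 2)" by (auto simp: link_def fun_eq_iff)
    moreover have "a - 2 \<le> 24" using ab True by linarith
    ultimately show ?thesis using perm by simp
  next
    case False
    then have "link T a b = id" by (auto simp: link_def fun_eq_iff)
    then show ?thesis by (simp add: permutes_id)
  qed
qed

text \<open>For each role \<open>b\<close> from \<open>29 - a\<close> to 28 there is exactly one
  neighbour, in cell \<open>Z b\<close>: along the link if \<open>a < b\<close>, against it if
  \<open>b < a\<close>, and by \<open>flip\<close> if \<open>a = b\<close>.\<close>

lemma card_nbrs_vert:
  assumes X: "X < N" and a: "a \<in> {1..28}"
  shows "card (nbrs n E (vert X a)) = a"
proof -
  define Z where "Z b = (if a < b then link T a b X else if b < a then inv (link T b a) X else flip X)" for b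
  have Zless: "Z b < N" if b: "b \<in> {1..28}" for b
  proof -
    have "link T a b X < N" if "a < b"
      using permutes_in_image[OF link_perm[of a b], of X] a b that X by auto
    moreover have "inv (link T b a) X < N" if "b < a"
      using permutes_in_image[OF permutes_inv[OF link_perm[of b a]], of X] a b that X by auto
    ultimately show ?thesis using flip_less[OF evN X] by (auto simp: Z_def)
  qed
  have edge: "{vert X a, vert Y b} \<in> E \<longleftrightarrow> 29 \<le> a + b \<and> Y = Z b" if "Y < N" "b \<in> {1..28}" for Y b
  proof -
    have "X = link T b a Y \<longleftrightarrow> Y = inv (link T b a) X" if "b < a"
      using permutes_inverses[OF link_perm[of b a]] \<open>b \<in> {1..28}\<close> a that by auto
    then show ?thesis
      unfolding edge_vert[OF X a that] Z_def by (cases a b rule: linorder_cases) auto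
  qed
  have "nbrs n E (vert X a) = (\<lambda>b. vert (Z b) b) ` {29 - a..28}"
  proof (intro set_eqI iffI)
    fix w assume w: "w \<in> nbrs n E (vert X a)"
    then have "W < w" using no_edge_block[of w "vert X a"] vert_gt[OF a, of X]
      by (auto simp: nbrs_def insert_commute not_le[symmetric])
    then obtain Y b where Y: "w = vert Y b" "Y < N" "b \<in> {1..28}" using vert_cases w by (auto simp: nbrs_def)
    then have "29 \<le> a + b \<and> Y = Z b" using w edge by (auto simp: nbrs_def)
    then show "w \<in> (\<lambda>b. vert (Z b) b) ` {29 - a..28}" using Y by auto
  next
    fix w assume "w \<in> (\<lambda>b. vert (Z b) b) ` {29 - a..28}"
    then obtain b where b: "w = vert (Z b) b" "29 \<le> a + b" "b \<in> {1..28}" using a by auto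
    then show "w \<in> nbrs n E (vert X a)"
      using edge[OF Zless[OF b(3)] b(3)] vert_in[OF Zless[OF b(3)] b(3)] by (auto simp: nbrs_def)
  qed
  moreover have "inj_on (\<lambda>b. vert (Z b) b) {29 - a..28}"
  proof (rule inj_onI)
    fix b c assume "b \<in> {29 - a..28}" "c \<in> {29 - a..28}" "vert (Z b) b = vert (Z c) c"
    then show "b = c" using a vert_eq_iff[of b c "Z b" "Z c"] by auto
  qed
  ultimately have "card (nbrs n E (vert X a)) = card {29 - a..28}" by (simp add: card_image)
  then show ?thesis using a by auto
qed

lemma card_nbrs_center: "card (nbrs n E W) = d"
proof -
  have "nbrs n E W = {1..d}"
  proof (intro set_eqI iffI)
    fix w assume w: "w \<in> nbrs n E W"
    then have "w \<le> W" using no_edge_block[of W w] by (auto simp: nbrs_def not_le[symmetric])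
    then have "w < W" "block_arc W d W w \<or> block_arc W d w W" "1 \<le> w"
      using w edge_block[of W w] by (auto simp: nbrs_def)
    then show "w \<in> {1..d}" using W d by (auto simp: block_arc_def path_arc_def)
  next
    fix w assume "w \<in> {1..d}"
    then show "w \<in> nbrs n E W" using W edge_block[of W w] by (auto simp: nbrs_def block_arc_def n_def)
  qed
  then show ?thesis by simp
qed

lemma card_nbrs_block:
  assumes "1 \<le> u" "u < W"
  shows "card (nbrs n E u) \<le> 4"
proof -
  have "nbrs n E u \<subseteq> (if u = W - 1 then {2, 3, W} else {u - 1, u + 1, W - 1, W})"
  proof
    fix w assume w: "w \<in> nbrs n E u"
    then have "w \<le> W" using no_edge_block[of u w] assms by (auto simp: nbrs_def not_le[symmetric])
    then have "block_arc W d u w \<or> block_arc W d w u"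
      using w edge_block[of u w] assms by (auto simp: nbrs_def)
    then show "w \<in> (if u = W - 1 then {2, 3, W} else {u - 1, u + 1, W - 1, W})"
      using assms by (auto simp: block_arc_def path_arc_def)
  qed
  then have "card (nbrs n E u) \<le> card (if u = W - 1 then {2, 3, W} else {u - 1, u + 1, W - 1, W})"
    by (intro card_mono) auto
  also have "\<dots> \<le> 4"
    using card_length[of "[2, 3, W]"] card_length[of "[u - 1, u + 1, W - 1, W]"] by simp
  finally show ?thesis .
qed

lemma max_degree_E: "max_degree {1..n} E = d"
  unfolding max_degree_def
proof (rule Max_eqI)
  have Wn: "W \<in> {1..n}" using W by (auto simp: n_def)
  show "d \<in> degree_in E ` {1..n}"
    using degree_eq_card_nbrs[OF graph_E Wn] card_nbrs_center Wn by force
  fix y assume "y \<in> degree_in E ` {1..n}"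
  then obtain v where v: "v \<in> {1..n}" "y = card (nbrs n E v)" using degree_eq_card_nbrs[OF graph_E] by auto
  show "y \<le> d"
  proof (cases v W rule: linorder_cases)
    case less
    then show ?thesis using card_nbrs_block[of v] v d by auto
  next
    case equal
    then show ?thesis using card_nbrs_center v by simp
  next
    case greater
    then obtain X a where "v = vert X a" "X < N" "a \<in> {1..28}" using vert_cases v by blast
    then show ?thesis using card_nbrs_vert v d by auto
  qed
qed simp

text \<open>Degrees from 5 to 28 occur only in cells: the centre has degree \<open>d\<close> and the
  other block vertices have degree at most 4.\<close>

lemma role_determined:
  assumes "v \<in> {1..n}" "card (nbrs n E v) = a" "4 < a" "a \<le> 28"
  obtains X where "v = vert X a" "X < N"
proof (cases v W rule: linorder_cases)
  case less
  then show ?thesis using card_nbrs_block[of v] assms by auto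
next
  case equal
  then show ?thesis using card_nbrs_center assms d by auto
next
  case greater
  then obtain X b where "v = vert X b" "X < N" "b \<in> {1..28}" using vert_cases assms(1) by blast
  then show ?thesis using card_nbrs_vert assms(2) that by auto
qed

text \<open>The interface between graph and permutations: \<open>G\<close> will be the cells with
  only good vertices and \<open>\<psi>\<close> the induced map. Preservation of fixed points is
  demanded so that colour 24 can tell two kinds of component apart.\<close>

definition robust_cells :: "nat \<Rightarrow> bool" where
  "robust_cells K \<longleftrightarrow> (\<forall>G \<psi>. G \<subseteq> {..<N} \<longrightarrow> inj_on \<psi> G \<longrightarrow> \<psi> ` G \<subseteq> {..<N} \<longrightarrow>
     (\<forall>X\<in>G. \<forall>i\<le>24. T i X \<in> G \<longrightarrow> \<psi> (T i X) = T i (\<psi> X)) \<longrightarrow>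
     (\<forall>X\<in>G. \<forall>i\<le>24. T i X = X \<longleftrightarrow> T i (\<psi> X) = \<psi> X) \<longrightarrow>
     card {X \<in> G. \<psi> X \<noteq> X} \<le> K * card ({..<N} - G))"

text \<open>In a wholly good cell the vertex of role 28 goes to one of role 28 by its degree. The
  others are adjacent to it, so they enter the same target cell, again with their roles. Each bad or
  moved cell costs at most 28 vertices, whence \<open>28 * (K + 1)\<close>.\<close>

lemma moved_le_bad:
  assumes K: "robust_cells K" and p: "\<pi> permutes {1..n}"
  shows "card {v \<in> {1..n}. \<pi> v \<noteq> v} \<le> (W + 28 * (K + 1)) * card {v \<in> {1..n}. \<not> good n E \<pi> v}"
proof -
  define B where "B = {v \<in> {1..n}. \<not> good n E \<pi> v}"
  have finB: "finite B" by (simp add: B_def)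
  have pin: "\<pi> v \<in> {1..n}" if "v \<in> {1..n}" for v using that permutes_in_image[OF p] by simp
  have pinj: "\<pi> u = \<pi> v \<Longrightarrow> u = v" for u v using permutes_inj[OF p] by (auto dest: injD)
  define G where "G = {X \<in> {..<N}. \<forall>a\<in>{1..28}. good n E \<pi> (vert X a)}"
  define \<psi> where "\<psi> X = cell W (\<pi> (vert X 28))" for X
  have top: "\<pi> (vert X 28) = vert (\<psi> X) 28 \<and> \<psi> X < N" if "X \<in> G" for X
  proof -
    have X: "X < N" "good n E \<pi> (vert X 28)" using that by (auto simp: G_def)
    have "card (nbrs n E (\<pi> (vert X 28))) = 28"
      using good_card_nbrs[OF p X(2)] card_nbrs_vert[OF X(1), of 28] by simp
    then obtain Y where "\<pi> (vert X 28) = vert Y 28" "Y < N"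
      using role_determined[OF pin[OF vert_in[OF X(1), of 28]], of 28] by auto
    then show ?thesis by (simp add: \<psi>_def)
  qed
  have all: "\<pi> (vert X a) = vert (\<psi> X) a" if X: "X \<in> G" and a: "a \<in> {1..28}" for X a
  proof (cases "a = 28")
    case False
    then have a28: "a < 28" using a by auto
    have XN: "X < N" and ga: "good n E \<pi> (vert X a)" using X a by (auto simp: G_def)
    have "{vert X a, vert X 28} \<in> E" using edge_vert[OF XN a XN, of 28] a a28 by (auto simp: link_def)
    then have e: "{\<pi> (vert X a), vert (\<psi> X) 28} \<in> E"
      using goodD[OF ga, of "vert X 28"] vert_in[OF XN, of 28] top[OF X] by auto
    have "W < \<pi> (vert X a)"
      using no_edge_block[of "\<pi> (vert X a)" "vert (\<psi> X) 28"] vert_gt[of 28 "\<psi> X"] e by (auto simp: not_le[symmetric])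
    then obtain Y b where Y: "\<pi> (vert X a) = vert Y b" "Y < N" "b \<in> {1..28}"
      using vert_cases[OF pin[OF vert_in[OF XN a]]] by blast
    have "b = a"
      using good_card_nbrs[OF p ga] card_nbrs_vert[OF XN a] card_nbrs_vert[OF Y(2,3)] Y(1) by simp
    moreover have "Y = \<psi> X" using e edge_vert[OF Y(2,3), of "\<psi> X" 28] top[OF X] Y(1) a28 \<open>b = a\<close>
      by (auto simp: link_def)
    ultimately show ?thesis using Y by simp
  qed (use top[OF X] in simp)
  have moved: "card {X \<in> G. \<psi> X \<noteq> X} \<le> K * card ({..<N} - G)"
  proof (rule K[unfolded robust_cells_def, rule_format])
    show "G \<subseteq> {..<N}" "\<psi> ` G \<subseteq> {..<N}" using top by (auto simp: G_def)
    show "inj_on \<psi> G"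
    proof (rule inj_onI)
      fix X Y assume XY: "X \<in> G" "Y \<in> G" "\<psi> X = \<psi> Y"
      then have "vert X 28 = vert Y 28" using top pinj by metis
      then show "X = Y" by (simp add: vert_def)
    qed
    fix X i assume X: "X \<in> G" and i: "i \<le> (24::nat)"
    have XN: "X < N" using X by (auto simp: G_def)
    have ab: "i + 2 \<in> {1..28}" "27 \<in> {1..28::nat}" using i by auto
    have edge: "{vert X (i + 2), vert Y 27} \<in> E \<longleftrightarrow> Y = T i X" if "X < N" "Y < N" for X Y
      unfolding edge_vert[OF that(1) ab(1) that(2) ab(2)] using i by (auto simp: link_def)
    have g: "good n E \<pi> (vert X (i + 2))" using X ab by (auto simp: G_def)
    have pX: "\<psi> X < N" using top[OF X] by simp
    \<comment> \<open>A single edge between roles \<open>i + 2\<close> and 27 expresses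
      \<open>Y = T i X\<close>, and its absence the negation. Taking \<open>Y = X\<close> gives the
      claim on fixed points.\<close>
    have key: "Y = T i X \<longleftrightarrow> \<psi> Y = T i (\<psi> X)" if Y: "Y \<in> G" for Y
    proof -
      have YN: "Y < N" "\<psi> Y < N" using Y top[OF Y] by (auto simp: G_def)
      show ?thesis
        using goodD[OF g vert_in[OF YN(1) ab(2)]] edge[OF XN YN(1)] edge[OF pX YN(2)]
          all[OF X ab(1)] all[OF Y ab(2)] by simp
    qed
    show "\<psi> (T i X) = T i (\<psi> X)" if "T i X \<in> G" using key[OF that] by simp
    show "T i X = X \<longleftrightarrow> T i (\<psi> X) = \<psi> X" using key[OF X] by metis
  qed
  have badcells: "card ({..<N} - G) \<le> card B"
  proof -
    have "\<forall>X\<in>{..<N} - G. \<exists>a\<in>{1..28}. vert X a \<in> B"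
      using vert_in by (auto simp: G_def B_def)
    then obtain h where h: "\<And>X. X \<in> {..<N} - G \<Longrightarrow> h X \<in> {1..28} \<and> vert X (h X) \<in> B" by metis
    have "inj_on (\<lambda>X. vert X (h X)) ({..<N} - G)"
    proof (rule inj_onI)
      fix X Y assume "X \<in> {..<N} - G" "Y \<in> {..<N} - G" "vert X (h X) = vert Y (h Y)"
      then show "X = Y" using vert_eq_iff[of "h X" "h Y" X Y] h by blast
    qed
    then show ?thesis using h finB by (intro card_inj_on_le[of "\<lambda>X. vert X (h X)"]) auto
  qed
  have cells: "card {v \<in> {1..n}. W < v \<and> \<pi> v \<noteq> v} \<le> 28 * (K + 1) * card B"
  proof -
    let ?M = "({..<N} - G) \<union> {X \<in> G. \<psi> X \<noteq> X}"
    have "{v \<in> {1..n}. W < v \<and> \<pi> v \<noteq> v} \<subseteq> (\<lambda>(X, a). vert X a) ` (?M \<times> {1..28})"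
    proof
      fix v assume v: "v \<in> {v \<in> {1..n}. W < v \<and> \<pi> v \<noteq> v}"
      then obtain X a where X: "v = vert X a" "X < N" "a \<in> {1..28}" using vert_cases by blast
      then have "X \<in> ?M" using v all[of X a] by auto
      then show "v \<in> (\<lambda>(X, a). vert X a) ` (?M \<times> {1..28})" using X by force
    qed
    then have "card {v \<in> {1..n}. W < v \<and> \<pi> v \<noteq> v} \<le> card ((\<lambda>(X, a). vert X a) ` (?M \<times> {1..28}))"
      by (intro card_mono finite_imageI finite_cartesian_product) (auto simp: G_def)
    also have "\<dots> \<le> card (?M \<times> {1..28::nat})"
      by (intro card_image_le finite_cartesian_product) (auto simp: G_def)
    also have "\<dots> = 28 * card ?M" by (simp add: card_cartesian_product)
    also have "card ?M \<le> card ({..<N} - G) + card {X \<in> G. \<psi> X \<noteq> X}" by (rule card_Un_le)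
    also have "\<dots> \<le> (K + 1) * card ({..<N} - G)" using moved by simp
    also have "\<dots> \<le> (K + 1) * card B" using badcells by (rule mult_le_mono2)
    finally show ?thesis by (simp only: mult.assoc)
  qed
  \<comment> \<open>One bad block vertex pays for all \<open>W\<close> vertices of the block;
    without one the block is fixed pointwise.\<close>
  have block: "card {v \<in> {1..n}. v \<le> W \<and> \<pi> v \<noteq> v} \<le> W * card B"
  proof (cases "\<forall>v\<in>{1..W}. good n E \<pi> v")
    case True
    have Wn: "v \<in> {1..n}" if "v \<in> {1..W}" for v using that by (auto simp: n_def)
    have W1: "W \<in> {1..W}" using W by auto
    have pW: "\<pi> W = W"
    proof -
      have c: "card (nbrs n E (\<pi> W)) = d"
        using good_card_nbrs[OF p, of E W] True W1 card_nbrs_center by auto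
      have v: "\<pi> W \<in> {1..n}" using pin Wn W1 by blast
      show ?thesis
      proof (cases "\<pi> W" W rule: linorder_cases)
        case less
        then show ?thesis using card_nbrs_block[of "\<pi> W"] c d v by auto
      next
        case greater
        then obtain X a where "\<pi> W = vert X a" "X < N" "a \<in> {1..28}" using vert_cases v by blast
        then show ?thesis using card_nbrs_vert c d by auto
      qed
    qed
    have step: "\<pi> v \<in> {1..W}" if "u \<in> {1..W}" "\<pi> u \<in> {1..W}" "v \<in> {1..W}" "{u, v} \<in> E" for u v
    proof -
      have "{\<pi> u, \<pi> v} \<in> E" using goodD[of n E \<pi> u v] True that Wn by blast
      then have "\<not> W < \<pi> v" using no_edge_block[of "\<pi> u" "\<pi> v"] that(2) by auto
      then show ?thesis using pin[OF Wn[OF that(3)]] by auto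
    qed
    \<comment> \<open>Vertices up to \<open>d\<close> stay in the block as neighbours of the fixed
      centre, each later one as neighbour of its predecessor on the path. The tip
      \<open>W - 1\<close> follows afterwards from its neighbour 2.\<close>
    have in1: "\<pi> v \<in> {1..W}" if "1 \<le> v" "v < W - 1" for v
      using that
    proof (induction v rule: less_induct)
      case (less v)
      show ?case
      proof (cases "v \<le> d")
        case True
        then show ?thesis using less.prems pW W1
          by (intro step[of W v]) (auto simp: edge_block block_arc_def)
      next
        case False
        then have v: "2 \<le> v" using d by auto
        have e: "{v - 1, v} \<in> E"
          using v less.prems by (subst edge_block) (auto simp: block_arc_def path_arc_def)
        have "v - 1 \<in> {1..W}" "v \<in> {1..W}" "\<pi> (v - 1) \<in> {1..W}"
          using v less.prems less.IH[of "v - 1"] by auto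
        then show ?thesis using e by (intro step[of "v - 1" v])
      qed
    qed
    have in2: "\<pi> v \<in> {1..W - 1}" if v: "v \<in> {1..W - 1}" for v
    proof -
      have "\<pi> v \<in> {1..W}"
      proof (cases "v = W - 1")
        case True
        have "\<pi> 2 \<in> {1..W}" using in1[of 2] W d by auto
        then show ?thesis using True W d
          by (intro step[of 2 v]) (auto simp: edge_block block_arc_def path_arc_def)
      qed (use v in1 in auto)
      moreover have "\<pi> v \<noteq> W" using pinj[of v W] pW v W by auto
      ultimately show ?thesis by auto
    qed
    have "\<pi> v = v" if v: "v \<in> {1..W - 1}" for v
    proof (rule path_rigid[OF _ _ _ _ v])
      show "6 \<le> W - 1" using W d by auto
      show "inj_on \<pi> {1..W - 1}" using permutes_inj_on[OF p] .
      show "\<pi> ` {1..W - 1} \<subseteq> {1..W - 1}" using in2 by blast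
      fix u w assume u: "u \<in> {1..W - 1}" and w: "w \<in> {1..W - 1}" and uw: "u \<noteq> w"
      have e: "{u, w} \<in> E \<longleftrightarrow> path_arc (W - 1) u w \<or> path_arc (W - 1) w u"
        if "u \<in> {1..W - 1}" "w \<in> {1..W - 1}" "u \<noteq> w" for u w
      proof -
        have "u < W" "w < W" "1 \<le> u" "1 \<le> w" using that by auto
        then show ?thesis using that edge_block[of u w] by (auto simp: block_arc_def)
      qed
      have "\<pi> u \<noteq> \<pi> w" using pinj uw by blast
      then show "path_arc (W - 1) (\<pi> u) (\<pi> w) \<or> path_arc (W - 1) (\<pi> w) (\<pi> u) \<longleftrightarrow>
          path_arc (W - 1) u w \<or> path_arc (W - 1) w u"
        using e[OF u w uw] e[OF in2[OF u] in2[OF w]] goodD[of n E \<pi> u w] True u w Wn by auto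
    qed
    then have "\<pi> v = v" if "1 \<le> v" "v \<le> W" for v using pW that by (cases "v = W") auto
    then have "{v \<in> {1..n}. v \<le> W \<and> \<pi> v \<noteq> v} = {}" by (metis (mono_tags, lifting) atLeastAtMost_iff empty_Collect_eq)
    then show ?thesis by (simp only: card.empty)
  next
    case False
    then obtain v where v: "v \<in> {1..W}" "\<not> good n E \<pi> v" by blast
    then have "v \<in> B" unfolding B_def by (simp add: n_def)
    then have "1 \<le> card B" using finB by (auto simp: Suc_le_eq card_gt_0_iff)
    then have "W * 1 \<le> W * card B" by (rule mult_le_mono2)
    moreover have "card {v \<in> {1..n}. v \<le> W \<and> \<pi> v \<noteq> v} \<le> card {1..W}" by (intro card_mono) auto
    ultimately show ?thesis unfolding card_atLeastAtMost by linarith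
  qed
  have "{v \<in> {1..n}. \<pi> v \<noteq> v} = {v \<in> {1..n}. v \<le> W \<and> \<pi> v \<noteq> v} \<union> {v \<in> {1..n}. W < v \<and> \<pi> v \<noteq> v}"
    (is "?M = ?M1 \<union> ?M2")
  proof (intro set_eqI iffI)
    fix v assume "v \<in> ?M"
    then show "v \<in> ?M1 \<union> ?M2" by (cases "v \<le> W") simp_all
  next
    fix v assume "v \<in> ?M1 \<union> ?M2"
    then show "v \<in> ?M" by blast
  qed
  then have "card {v \<in> {1..n}. \<pi> v \<noteq> v} \<le> card {v \<in> {1..n}. v \<le> W \<and> \<pi> v \<noteq> v} + card {v \<in> {1..n}. W < v \<and> \<pi> v \<noteq> v}"
    using card_Un_le[of "{v \<in> {1..n}. v \<le> W \<and> \<pi> v \<noteq> v}" "{v \<in> {1..n}. W < v \<and> \<pi> v \<noteq> v}"] by (simp only:)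
  also have "\<dots> \<le> (W + 28 * (K + 1)) * card B" unfolding add_mult_distrib[of W] using block cells by (rule add_mono)
  finally show ?thesis by (simp add: B_def)
qed

text \<open>\<open>M\<close> bounds the block sizes of a whole family, so that one constant serves
  all its graphs; the factor 2 is that of \<open>card_bad_le\<close>.\<close>

lemma robustly_self_ordered_E:
  assumes K: "robust_cells K" and M: "W \<le> M"
  shows "robustly_self_ordered (1 / real (2 * (M + 28 * (K + 1)))) {1..n} E"
  unfolding robustly_self_ordered_def
proof (intro allI impI)
  fix \<pi> assume p: "\<pi> permutes {1..n}"
  let ?D = "card (sym_diff E ((\<lambda>e. \<pi> ` e) ` E))"
  have "card {v \<in> {1..n}. \<pi> v \<noteq> v} \<le> (W + 28 * (K + 1)) * (2 * ?D)"
    using moved_le_bad[OF K p] mult_le_mono2[OF card_bad_le[OF graph_E p], of "W + 28 * (K + 1)"] by linarith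
  also have "\<dots> \<le> (M + 28 * (K + 1)) * (2 * ?D)" using M by (intro mult_le_mono1) simp
  finally have "real (card {v \<in> {1..n}. \<pi> v \<noteq> v}) \<le> real (2 * (M + 28 * (K + 1)) * ?D)"
    by (simp only: of_nat_le_iff mult_ac)
  then have "real (card {v \<in> {1..n}. \<pi> v \<noteq> v}) \<le> real (2 * (M + 28 * (K + 1))) * real ?D"
    by (simp only: of_nat_mult)
  then show "1 / real (2 * (M + 28 * (K + 1))) * real (card {v \<in> {1..n}. \<pi> v \<noteq> v}) \<le> real ?D"
    by (simp add: field_simps)
qed

end

text \<open>For bounded size asymmetry is enough: a permutation other than the identity changes at
  least one edge and moves at most \<open>M\<close> vertices.\<close>

lemma robustly_self_ordered_path:
  assumes "6 \<le> n" "n \<le> M"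
  shows "robustly_self_ordered (1 / real M) {1..n} (graph_of n (path_arc n))"
  unfolding robustly_self_ordered_def
proof (intro allI impI)
  fix \<pi> assume p: "\<pi> permutes {1..n}"
  let ?E = "graph_of n (path_arc n)"
  let ?S = "sym_diff ?E ((\<lambda>e. \<pi> ` e) ` ?E)"
  have "finite ?E" by (rule finite_subset[of _ "Pow {1..n}"]) (auto simp: graph_of_def)
  then have fin: "finite ?S" by auto
  show "1 / real M * real (card {v \<in> {1..n}. \<pi> v \<noteq> v}) \<le> real (card ?S)"
  proof (cases "?S = {}")
    case True
    have "card {v \<in> {1..n}. \<not> good n ?E \<pi> v} \<le> 2 * card ?S"
      by (rule card_bad_le[OF graph_graph_of p])
    then have "card {v \<in> {1..n}. \<not> good n ?E \<pi> v} = 0" unfolding True by simp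
    then have gd: "good n ?E \<pi> v" if "v \<in> {1..n}" for v using that by auto
    have "\<pi> v = v" if v: "v \<in> {1..n}" for v
    proof (rule path_rigid[OF assms(1) permutes_inj_on[OF p] _ _ v])
      show "\<pi> ` {1..n} \<subseteq> {1..n}" using permutes_image[OF p] by simp
      fix u w assume uw: "u \<in> {1..n}" "w \<in> {1..n}" "u \<noteq> w"
      have "\<pi> u \<noteq> \<pi> w" "\<pi> u \<in> {1..n}" "\<pi> w \<in> {1..n}"
        using uw permutes_inj[OF p] permutes_in_image[OF p] by (auto dest: injD)
      then show "path_arc n (\<pi> u) (\<pi> w) \<or> path_arc n (\<pi> w) (\<pi> u) \<longleftrightarrow> path_arc n u w \<or> path_arc n w u"
        using goodD[OF gd[OF uw(1)] uw(2)] uw unfolding edge_graph_of_iff by simp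
    qed
    then have "{v \<in> {1..n}. \<pi> v \<noteq> v} = {}" by blast
    then have "card {v \<in> {1..n}. \<pi> v \<noteq> v} = 0" by (simp only: card.empty)
    then show ?thesis by (simp only: of_nat_0 mult_zero_right of_nat_0_le_iff)
  next
    case False
    then have "1 \<le> card ?S" using fin by (simp add: Suc_le_eq card_gt_0_iff)
    moreover have "card {v \<in> {1..n}. \<pi> v \<noteq> v} \<le> card {1..n}" by (intro card_mono) auto
    then have "1 / real M * real (card {v \<in> {1..n}. \<pi> v \<noteq> v}) \<le> 1" using assms by (simp add: field_simps)
    ultimately show ?thesis by linarith
  qed
qed

lemma max_component_size_le:
  assumes "finite V" "V \<noteq> {}" and lab: "\<And>u v. {u, v} \<in> E \<Longrightarrow> lab u = lab v"
    and le: "\<And>v. v \<in> V \<Longrightarrow> card {w \<in> V. lab w = lab v} \<le> S"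
  shows "max_component_size V E \<le> S"
proof -
  let ?R = "{(u, v). u \<in> V \<and> v \<in> V \<and> (u, v) \<in> {(x, y). {x, y} \<in> E}\<^sup>*}"
  have labR: "lab u = lab v" if "(u, v) \<in> {(x, y). {x, y} \<in> E}\<^sup>*" for u v
    using that by (induction rule: rtrancl_induct) (auto dest: lab)
  have "card C \<le> S" if "C \<in> V // ?R" for C
  proof -
    obtain v where v: "v \<in> V" "C = ?R `` {v}" using \<open>C \<in> V // ?R\<close> by (rule quotientE)
    then have "C \<subseteq> {w \<in> V. lab w = lab v}" using labR by fastforce
    then have "card C \<le> card {w \<in> V. lab w = lab v}" using assms(1) by (intro card_mono) auto
    then show ?thesis using le[OF v(1)] by simp
  qed
  moreover have "finite (V // ?R)" using assms(1) by (rule finite_quotient) auto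
  moreover have "V // ?R \<noteq> {}" using assms(2) by (simp add: quotient_is_empty)
  ultimately show ?thesis unfolding max_component_size_def connected_components_def by simp
qed

section \<open>Greedy selection of codes\<close>

text \<open>Powers in the form of a finite array that reads 0 beyond its end. Exponents up to
  \<open>24 * s\<close> cover all digit positions of a tuple and the number of codes.\<close>

definition pow_table :: "nat \<Rightarrow> nat \<Rightarrow> nat" where
  "pow_table s p = (if p \<le> 24 * s then s ^ p else 0)"

text \<open>A base \<open>s\<close> digit. The powers are a parameter so that an array of the
  machine can take their place.\<close>

definition dig :: "(nat \<Rightarrow> nat) \<Rightarrow> nat \<Rightarrow> nat \<Rightarrow> nat \<Rightarrow> nat" where
  "dig pw s w p = w div pw p mod s"

definition tup :: "(nat \<Rightarrow> nat) \<Rightarrow> nat \<Rightarrow> nat \<Rightarrow> nat \<Rightarrow> nat \<Rightarrow> nat" where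
  "tup pw s w i x = dig pw s w (i * s + x)"

definition inj_test :: "(nat \<Rightarrow> nat) \<Rightarrow> nat \<Rightarrow> nat \<Rightarrow> bool" where
  "inj_test pw s f \<longleftrightarrow> (\<forall>x<s. \<forall>y<x. dig pw s f x \<noteq> dig pw s f y)"

definition perms_test :: "(nat \<Rightarrow> nat) \<Rightarrow> nat \<Rightarrow> nat \<Rightarrow> bool" where
  "perms_test pw s w \<longleftrightarrow> (\<forall>i<24. \<forall>x<s. \<forall>y<x. tup pw s w i x \<noteq> tup pw s w i y)"

text \<open>A number \<open>f < s ^ s\<close> codes the subset on which its digits vanish.\<close>

definition expanding_test :: "(nat \<Rightarrow> nat) \<Rightarrow> nat \<Rightarrow> nat \<Rightarrow> bool" where
  "expanding_test pw s w \<longleftrightarrow> (\<forall>f<pw s.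
     0 < card {x. x < s \<and> dig pw s f x = 0} \<and> 2 * card {x. x < s \<and> dig pw s f x = 0} \<le> s \<longrightarrow>
     3 * card {x. x < s \<and> dig pw s f x = 0} <
     2 * card {y. y < s \<and> (\<exists>i<24. \<exists>x<s. dig pw s f x = 0 \<and> y = tup pw s w i x)})"

definition near_test :: "(nat \<Rightarrow> nat) \<Rightarrow> nat \<Rightarrow> nat \<Rightarrow> nat \<Rightarrow> nat \<Rightarrow> bool" where
  "near_test pw s w w' f \<longleftrightarrow> (\<forall>i<24.
     100 * card {x. x < s \<and> dig pw s f (tup pw s w i x) \<noteq> tup pw s w' i (dig pw s f x)} \<le> s)"

definition rigid_test :: "(nat \<Rightarrow> nat) \<Rightarrow> nat \<Rightarrow> nat \<Rightarrow> bool" where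
  "rigid_test pw s w \<longleftrightarrow> (\<forall>f<pw s. inj_test pw s f \<longrightarrow> near_test pw s w w f \<longrightarrow>
     2 * card {x. x < s \<and> dig pw s f x \<noteq> x} < s)"

definition fit :: "(nat \<Rightarrow> nat) \<Rightarrow> nat \<Rightarrow> nat \<Rightarrow> bool" where
  "fit pw s w \<longleftrightarrow> perms_test pw s w \<and> expanding_test pw s w \<and> rigid_test pw s w"

definition far_test :: "(nat \<Rightarrow> nat) \<Rightarrow> nat \<Rightarrow> nat \<Rightarrow> nat \<Rightarrow> bool" where
  "far_test pw s w w' \<longleftrightarrow> (\<forall>f<pw s. inj_test pw s f \<longrightarrow> \<not> near_test pw s w w' f)"

text \<open>The greedy choice in numerical order of codes; testing in one direction suffices by
  \<open>near_sym\<close>.\<close>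

function accept :: "nat \<Rightarrow> nat \<Rightarrow> bool" where
  "accept s w \<longleftrightarrow> fit (pow_table s) s w \<and> (\<forall>v<w. accept s v \<longrightarrow> far_test (pow_table s) s w v)"
  by auto
termination by (relation "measure snd") auto

declare accept.simps [simp del]

section \<open>Correctness of the tests on codes\<close>

definition ext :: "nat \<Rightarrow> (nat \<Rightarrow> nat) \<Rightarrow> nat \<Rightarrow> nat" where
  "ext s g x = (if x < s then g x else x)"

text \<open>Normalised outside the coded range: identity beyond \<open>s\<close>, as
  \<open>permutes\<close> demands, and undefined from index 24 on, as the extensional product in
  \<open>tuples\<close> demands.\<close>

definition perms_of :: "nat \<Rightarrow> nat \<Rightarrow> nat \<Rightarrow> nat \<Rightarrow> nat" where
  "perms_of s w = (\<lambda>i\<in>{..<24}. ext s (tup (pow_table s) s w i))"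

lemma ext_permutes:
  assumes "\<forall>x<s. \<forall>y<x. g x \<noteq> g y" "\<And>x. x < s \<Longrightarrow> g x < s"
  shows "ext s g permutes {..<s}"
proof (rule bij_imp_permutes)
  have "inj_on (ext s g) {..<s}"
  proof (rule inj_onI)
    fix x y assume "x \<in> {..<s}" "y \<in> {..<s}" "ext s g x = ext s g y"
    then show "x = y"
      using assms(1)[rule_format, of x y] assms(1)[rule_format, of y x]
      by (cases x y rule: linorder_cases) (auto simp: ext_def)
  qed
  moreover have "ext s g ` {..<s} \<subseteq> {..<s}" using assms(2) by (auto simp: ext_def)
  ultimately show "bij_betw (ext s g) {..<s} {..<s}" by (simp add: bij_betw_def endo_inj_surj)
qed (auto simp: ext_def)

lemma ext_permutes_inj:
  assumes "ext s g permutes {..<s}" shows "\<forall>x<s. \<forall>y<x. g x \<noteq> g y"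
proof (intro allI impI)
  fix x y assume "x < s" "y < x"
  then show "g x \<noteq> g y" using permutes_inj[OF assms] injD[of "ext s g" x y] by (auto simp: ext_def)
qed

lemma digits_exist:
  fixes s :: nat
  assumes "\<forall>p<m. g p < s" "0 < s"
  shows "\<exists>w<s ^ m. \<forall>p<m. w div s ^ p mod s = g p"
  using assms(1)
proof (induction m)
  case (Suc m)
  then obtain w where w: "w < s ^ m" "\<forall>p<m. w div s ^ p mod s = g p" by auto
  let ?w = "w + g m * s ^ m"
  have "?w < s ^ m + g m * s ^ m" using w by simp
  also have "\<dots> = (g m + 1) * s ^ m" by simp
  also have "\<dots> \<le> s * s ^ m" using Suc.prems by (intro mult_le_mono1) (simp add: Suc_le_eq)
  finally have "?w < s ^ Suc m" by simp
  moreover have "?w div s ^ p mod s = g p" if p: "p < Suc m" for p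
  proof (cases "p = m")
    case True
    then show ?thesis using w(1) Suc.prems assms(2) by simp
  next
    case False
    then have "p < m" using p by simp
    then obtain l where l: "m = Suc (p + l)" using less_imp_Suc_add by blast
    have "?w = w + s ^ p * (s * (g m * s ^ l))" by (simp add: l power_add mult_ac)
    also have "\<dots> div s ^ p = w div s ^ p + s * (g m * s ^ l)" using assms(2) by simp
    finally show ?thesis using w(2) \<open>p < m\<close> by simp
  qed
  ultimately show ?case by blast
qed simp

lemma dig_less: "0 < s \<Longrightarrow> dig pw s w p < s"
  by (simp add: dig_def)

lemma tup_less: "0 < s \<Longrightarrow> tup pw s w i x < s"
  by (simp add: tup_def dig_less)

lemma dig_code_exists:
  assumes "0 < s" "\<And>x. x < s \<Longrightarrow> g x < s"
  obtains f where "f < pow_table s s" "\<And>x. x < s \<Longrightarrow> dig (pow_table s) s f x = g x"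
proof -
  obtain f where "f < s ^ s" "\<forall>p<s. f div s ^ p mod s = g p"
    using digits_exist[of s g s] assms by auto
  then show thesis by (intro that[of f]) (auto simp: pow_table_def dig_def)
qed

lemma perms_of_tuples:
  assumes "0 < s" shows "perms_of s w \<in> tuples s \<longleftrightarrow> perms_test (pow_table s) s w"
proof
  assume "perms_of s w \<in> tuples s"
  then have "ext s (tup (pow_table s) s w i) permutes {..<s}" if "i < 24" for i
    using tuplesD[of "perms_of s w" s i] that by (simp add: perms_of_def)
  then show "perms_test (pow_table s) s w" using ext_permutes_inj unfolding perms_test_def by blast
next
  assume "perms_test (pow_table s) s w"
  then show "perms_of s w \<in> tuples s"
    using ext_permutes tup_less[OF assms] unfolding perms_test_def tuples_def perms_of_def by auto
qed

lemma perms_of_surj: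
  assumes "0 < s" "\<tau> \<in> tuples s"
  obtains w where "w < s ^ (24 * s)" "perms_of s w = \<tau>"
proof -
  have less: "\<tau> i x < s" if "i < 24" "x < s" for i x
    using permutes_less[OF tuplesD[OF assms(2) that(1)] that(2)] .
  have "\<forall>p<24 * s. \<tau> (p div s) (p mod s) < s"
    using less assms(1) by (simp add: less_mult_imp_div_less)
  from digits_exist[OF this assms(1)] obtain w where
    w: "w < s ^ (24 * s)" "\<forall>p<24 * s. w div s ^ p mod s = \<tau> (p div s) (p mod s)" by blast
  have "perms_of s w i x = \<tau> i x" for i x
  proof (cases "i < 24")
    case i: True
    show ?thesis
    proof (cases "x < s")
      case True
      have "i * s + x < (i + 1) * s" using True by simp
      also have "\<dots> \<le> 24 * s" using i by (intro mult_le_mono1) simp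
      finally have "i * s + x < 24 * s" .
      then show ?thesis using w(2) i True assms(1)
        by (simp add: perms_of_def ext_def tup_def dig_def pow_table_def)
    next
      case False
      then show ?thesis using permutes_not_in[OF tuplesD[OF assms(2) i], of x] i
        by (simp add: perms_of_def ext_def)
    qed
  next
    case False
    then show ?thesis using assms(2) by (simp add: perms_of_def tuples_def PiE_iff extensional_def)
  qed
  then have "perms_of s w = \<tau>" by blast
  with w(1) show thesis by (rule that)
qed

lemma expanding_test_iff:
  assumes s: "2 \<le> s"
  shows "expanding_test (pow_table s) s w \<longleftrightarrow> expanding s (perms_of s w)"
proof -
  let ?A = "\<lambda>f. {x. x < s \<and> dig (pow_table s) s f x = 0}"
  have img: "{y. y < s \<and> (\<exists>i<24. \<exists>x<s. dig (pow_table s) s f x = 0 \<and> y = tup (pow_table s) s w i x)}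
      = (\<Union>i<24. perms_of s w i ` ?A f)" for f
    using s tup_less[of s] by (auto simp: perms_of_def ext_def image_iff)
  \<comment> \<open>Digit 1 marks the cells outside the set; it exists because \<open>s\<close> is
    at least 2.\<close>
  have code: "\<exists>f<pow_table s s. ?A f = A" if "A \<subseteq> {..<s}" for A
  proof -
    obtain f where "f < pow_table s s" "\<And>x. x < s \<Longrightarrow> dig (pow_table s) s f x = (if x \<in> A then 0 else 1)"
      by (rule dig_code_exists[of s "\<lambda>x. if x \<in> A then 0 else 1"]) (use s in auto)
    then show ?thesis using that by (intro exI[of _ f]) (auto split: if_splits)
  qed
  show ?thesis
  proof
    assume test: "expanding_test (pow_table s) s w"
    show "expanding s (perms_of s w)"
      unfolding expanding_def
    proof (intro allI impI)
      fix A assume A: "A \<subseteq> {..<s}" "A \<noteq> {}" "2 * card A \<le> s"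
      obtain f where f: "f < pow_table s s" "?A f = A" using code[OF A(1)] by blast
      have "0 < card A" using A(1,2) finite_subset[OF A(1)] by (simp add: card_gt_0_iff)
      then show "3 * card A < 2 * card (\<Union>i<24. perms_of s w i ` A)"
        using test[unfolded expanding_test_def img, rule_format, OF f(1)] A(3) unfolding f(2) by blast
    qed
  next
    assume ex: "expanding s (perms_of s w)"
    show "expanding_test (pow_table s) s w"
      unfolding expanding_test_def img
    proof (intro allI impI)
      fix f assume f: "0 < card (?A f) \<and> 2 * card (?A f) \<le> s"
      have "?A f \<subseteq> {..<s}" by auto
      moreover have "?A f \<noteq> {}" using f by (metis card.empty less_irrefl)
      ultimately show "3 * card (?A f) < 2 * card (\<Union>i<24. perms_of s w i ` ?A f)"
        using ex f unfolding expanding_def by blast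
    qed
  qed
qed

lemma near_test_iff:
  assumes "0 < s"
  shows "near_test (pow_table s) s w w' f \<longleftrightarrow>
    near s (perms_of s w) (perms_of s w') (ext s (dig (pow_table s) s f))"
proof -
  have "{x. x < s \<and> ext s (dig (pow_table s) s f) (perms_of s w i x) \<noteq>
      perms_of s w' i (ext s (dig (pow_table s) s f) x)} =
    {x. x < s \<and> dig (pow_table s) s f (tup (pow_table s) s w i x) \<noteq>
      tup (pow_table s) s w' i (dig (pow_table s) s f x)}" if "i < 24" for i
    using that dig_less[OF assms] tup_less[OF assms] by (auto simp: perms_of_def ext_def)
  then show ?thesis unfolding near_test_def near_def by simp
qed

lemma code_of_perm:
  assumes s: "0 < s" and "\<phi> permutes {..<s}"
  obtains f where "f < pow_table s s" "inj_test (pow_table s) s f" "ext s (dig (pow_table s) s f) = \<phi>"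
proof -
  obtain f where f: "f < pow_table s s" "\<And>x. x < s \<Longrightarrow> dig (pow_table s) s f x = \<phi> x"
    using dig_code_exists[of s \<phi>] permutes_less[OF assms(2)] s by blast
  have eq: "ext s (dig (pow_table s) s f) = \<phi>"
    using f(2) permutes_not_in[OF assms(2)] by (auto simp: ext_def fun_eq_iff)
  then have "inj_test (pow_table s) s f"
    unfolding inj_test_def using assms(2) by (intro ext_permutes_inj) simp
  with f(1) eq show thesis by (intro that)
qed

lemma perm_of_code:
  assumes "0 < s" "inj_test (pow_table s) s f"
  shows "ext s (dig (pow_table s) s f) permutes {..<s}"
  using assms by (intro ext_permutes) (auto simp: inj_test_def dig_less)

lemma rigid_test_iff:
  assumes s: "0 < s"
  shows "rigid_test (pow_table s) s w \<longleftrightarrow> rigid s (perms_of s w)"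
proof -
  have mv: "{x. x < s \<and> ext s g x \<noteq> x} = {x. x < s \<and> g x \<noteq> x}" for g
    by (auto simp: ext_def)
  show ?thesis
  proof
    assume test: "rigid_test (pow_table s) s w"
    show "rigid s (perms_of s w)"
      unfolding rigid_def
    proof (intro allI impI)
      fix \<phi> assume \<phi>: "\<phi> permutes {..<s}" "near s (perms_of s w) (perms_of s w) \<phi>"
      obtain f where f: "f < pow_table s s" "inj_test (pow_table s) s f" "ext s (dig (pow_table s) s f) = \<phi>"
        using code_of_perm[OF s \<phi>(1)] .
      have "2 * card {x. x < s \<and> dig (pow_table s) s f x \<noteq> x} < s"
        using test \<phi>(2) f near_test_iff[OF s, of w w f] unfolding rigid_test_def by simp
      then show "2 * card {x. x < s \<and> \<phi> x \<noteq> x} < s" using mv[of "dig (pow_table s) s f"] f(3) by simp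
    qed
  next
    assume rig: "rigid s (perms_of s w)"
    show "rigid_test (pow_table s) s w"
      unfolding rigid_test_def
    proof (intro allI impI)
      fix f assume f: "inj_test (pow_table s) s f" "near_test (pow_table s) s w w f"
      have "2 * card {x. x < s \<and> ext s (dig (pow_table s) s f) x \<noteq> x} < s"
        using rig perm_of_code[OF s f(1)] f(2)[unfolded near_test_iff[OF s]] unfolding rigid_def by blast
      then show "2 * card {x. x < s \<and> dig (pow_table s) s f x \<noteq> x} < s" unfolding mv .
    qed
  qed
qed

lemma fit_iff:
  assumes "2 \<le> s"
  shows "fit (pow_table s) s w \<longleftrightarrow>
    perms_of s w \<in> tuples s \<and> expanding s (perms_of s w) \<and> rigid s (perms_of s w)"
  using assms perms_of_tuples[of s w] expanding_test_iff[of s w] rigid_test_iff[of s w]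
  unfolding fit_def by auto

lemma far_test_iff:
  assumes s: "0 < s"
  shows "far_test (pow_table s) s w w' \<longleftrightarrow>
    \<not> (\<exists>\<phi>. \<phi> permutes {..<s} \<and> near s (perms_of s w) (perms_of s w') \<phi>)"
proof
  assume test: "far_test (pow_table s) s w w'"
  show "\<not> (\<exists>\<phi>. \<phi> permutes {..<s} \<and> near s (perms_of s w) (perms_of s w') \<phi>)"
  proof
    assume "\<exists>\<phi>. \<phi> permutes {..<s} \<and> near s (perms_of s w) (perms_of s w') \<phi>"
    then obtain \<phi> where \<phi>: "\<phi> permutes {..<s}" "near s (perms_of s w) (perms_of s w') \<phi>" by blast
    obtain f where "f < pow_table s s" "inj_test (pow_table s) s f" "ext s (dig (pow_table s) s f) = \<phi>"
      using code_of_perm[OF s \<phi>(1)] .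
    then show False using test \<phi>(2) near_test_iff[OF s, of w w' f] unfolding far_test_def by simp
  qed
next
  assume "\<not> (\<exists>\<phi>. \<phi> permutes {..<s} \<and> near s (perms_of s w) (perms_of s w') \<phi>)"
  then show "far_test (pow_table s) s w w'"
    unfolding far_test_def near_test_iff[OF s] using perm_of_code[OF s] by blast
qed

text \<open>The exceptional set for the inverse is contained in the image under
  \<open>\<phi>\<close> of the original one, so it is no larger.\<close>

lemma near_sym:
  assumes \<phi>: "\<phi> permutes {..<s}" and "near s \<tau> \<tau>' \<phi>"
  shows "near s \<tau>' \<tau> (inv \<phi>)"
  unfolding near_def
proof (intro allI impI)
  fix i :: nat assume i: "i < 24"
  have "{y. y < s \<and> inv \<phi> (\<tau>' i y) \<noteq> \<tau> i (inv \<phi> y)} \<subseteq> \<phi> ` {x. x < s \<and> \<phi> (\<tau> i x) \<noteq> \<tau>' i (\<phi> x)}"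
  proof
    fix y assume y: "y \<in> {y. y < s \<and> inv \<phi> (\<tau>' i y) \<noteq> \<tau> i (inv \<phi> y)}"
    have eq: "\<phi> (inv \<phi> y) = y" "inv \<phi> (\<phi> (\<tau> i (inv \<phi> y))) = \<tau> i (inv \<phi> y)"
      using permutes_inverses[OF \<phi>] by auto
    have "inv \<phi> y < s" using permutes_less[OF permutes_inv[OF \<phi>], of y] y by simp
    moreover have "\<phi> (\<tau> i (inv \<phi> y)) \<noteq> \<tau>' i (\<phi> (inv \<phi> y))" using y eq by auto
    ultimately show "y \<in> \<phi> ` {x. x < s \<and> \<phi> (\<tau> i x) \<noteq> \<tau>' i (\<phi> x)}" using eq(1) by (intro image_eqI[of _ _ "inv \<phi> y"]) auto
  qed
  then have "card {y. y < s \<and> inv \<phi> (\<tau>' i y) \<noteq> \<tau> i (inv \<phi> y)} \<le> card (\<phi> ` {x. x < s \<and> \<phi> (\<tau> i x) \<noteq> \<tau>' i (\<phi> x)})"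
    by (intro card_mono) auto
  also have "\<dots> \<le> card {x. x < s \<and> \<phi> (\<tau> i x) \<noteq> \<tau>' i (\<phi> x)}" by (rule card_image_le) simp
  also have "100 * \<dots> \<le> s" using assms(2) i unfolding near_def by blast
  finally show "100 * card {y. y < s \<and> inv \<phi> (\<tau>' i y) \<noteq> \<tau> i (inv \<phi> y)} \<le> s" by simp
qed

lemma accept_fit: "accept s w \<Longrightarrow> fit (pow_table s) s w"
  by (simp add: accept.simps[of s w])

lemma accept_not_near:
  assumes s: "0 < s" and "accept s v" "accept s w" "v \<noteq> w" "\<phi> permutes {..<s}"
  shows "\<not> near s (perms_of s v) (perms_of s w) \<phi>"
proof
  assume near: "near s (perms_of s v) (perms_of s w) \<phi>"
  show False
  proof (cases "v < w")
    case True
    then have "far_test (pow_table s) s w v" using assms by (simp add: accept.simps[of s w])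
    then show False
      using near_sym[OF assms(5) near] permutes_inv[OF assms(5)] unfolding far_test_iff[OF s] by blast
  next
    case False
    then have "far_test (pow_table s) s v w" using assms by (simp add: accept.simps[of s v])
    then show False using near assms(5) unfolding far_test_iff[OF s] by blast
  qed
qed

text \<open>The greedy family is maximal: a fit code that is rejected is near a smaller accepted
  one, and an accepted code is near itself by the identity.\<close>

lemma card_accept:
  assumes s: "exp 200 \<le> real s"
  shows "fact s \<le> card {w. w < s ^ (24 * s) \<and> accept s w}"
proof -
  have "201 \<le> real s" using s exp_ge_add_one_self[of "200::real"] by simp
  then have s2: "2 \<le> s" by simp
  then have s0: "0 < s" by simp
  let ?Acc = "{w. w < s ^ (24 * s) \<and> accept s w}"
  have "fact s \<le> card (perms_of s ` ?Acc)"
  proof (rule maximal_family_large[OF s])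
    fix \<tau> assume \<tau>: "\<tau> \<in> tuples s" "expanding s \<tau>" "rigid s \<tau>"
    obtain w where w: "w < s ^ (24 * s)" "perms_of s w = \<tau>" using perms_of_surj[OF s0 \<tau>(1)] .
    then have fw: "fit (pow_table s) s w" using \<tau> fit_iff[OF s2] by simp
    show "\<exists>\<tau>'\<in>perms_of s ` ?Acc. \<exists>\<phi>. \<phi> permutes {..<s} \<and> near s \<tau> \<tau>' \<phi>"
    proof (cases "accept s w")
      case True
      have "near s \<tau> (perms_of s w) id" unfolding near_def w(2) by simp
      then show ?thesis using True w permutes_id by blast
    next
      case False
      then obtain v where v: "v < w" "accept s v" "\<not> far_test (pow_table s) s w v"
        using fw by (auto simp: accept.simps[of s w])
      then have "v < s ^ (24 * s)" using w(1) by simp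
      then show ?thesis using v(2,3) w(2) far_test_iff[OF s0, of w v] by blast
    qed
  qed simp
  also have "\<dots> \<le> card ?Acc" by (rule card_image_le) simp
  finally show ?thesis .
qed

section \<open>Search expressed by counting\<close>

text \<open>The element of \<open>P\<close> with rank \<open>j\<close>, counted from 0: exactly the
  numbers below it have at most \<open>j\<close> elements of \<open>P\<close> up to and including
  themselves. As a count it falls under \<open>cmp_card\<close>, with no search loop.\<close>

definition nth_of :: "nat \<Rightarrow> (nat \<Rightarrow> bool) \<Rightarrow> nat \<Rightarrow> nat" where
  "nth_of M P j = card {w. w < M \<and> card {v. v < w + 1 \<and> P v} \<le> j}"

lemma nth_of:
  assumes "j < card {w. w < M \<and> P w}"
  shows "nth_of M P j < M" "P (nth_of M P j)" "card {v. v < nth_of M P j + 1 \<and> P v} = j + 1"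
proof -
  define c where "c w = card {v. v < w + 1 \<and> P v}" for w
  have cSuc: "c (Suc w) = c w + of_bool (P (Suc w))" for w
  proof -
    have "{v. v < Suc w + 1 \<and> P v} = {v. v < w + 1 \<and> P v} \<union> (if P (Suc w) then {Suc w} else {})"
      by (auto simp: less_Suc_eq)
    then show ?thesis unfolding c_def by (simp add: card_Un_disjoint)
  qed
  have mono: "c v \<le> c w" if "v \<le> w" for v w
    unfolding c_def using that by (intro card_mono) auto
  have M0: "0 < M" using assms by (cases M) auto
  have "c (M - 1) = card {w. w < M \<and> P w}" using M0 by (simp add: c_def)
  then have jM: "j < c (M - 1)" using assms by simp
  then have ex: "\<exists>w. j < c w" by blast
  define w0 where "w0 = (LEAST w. j < c w)"
  have w0: "j < c w0" unfolding w0_def using ex by (rule LeastI_ex)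
  have least: "c w \<le> j" if "w < w0" for w using not_less_Least that unfolding w0_def by fastforce
  have "w0 \<le> M - 1" unfolding w0_def using jM by (rule Least_le)
  then have w0M: "w0 < M" using M0 by simp
  have "{w. w < M \<and> c w \<le> j} = {..<w0}"
  proof (intro set_eqI iffI)
    fix w assume w: "w \<in> {w. w < M \<and> c w \<le> j}"
    have "\<not> w0 \<le> w" using mono[of w0 w] w w0 by auto
    then show "w \<in> {..<w0}" by simp
  qed (use least w0M in auto)
  then have eq: "nth_of M P j = w0" unfolding nth_of_def c_def[symmetric] by simp
  have "P w0 \<and> c w0 = j + 1"
  proof (cases w0)
    case 0
    have "c 0 = of_bool (P 0)" by (auto simp: c_def card_eq_0_iff intro: arg_cong[of _ "{0}" card, THEN trans])
    then show ?thesis using w0 0 by (cases "P 0") auto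
  next
    case (Suc w)
    then have "c w \<le> j" using least by simp
    then show ?thesis using w0 cSuc[of w] Suc by (cases "P (Suc w)") auto
  qed
  then show "nth_of M P j < M" "P (nth_of M P j)" "card {v. v < nth_of M P j + 1 \<and> P v} = j + 1"
    using w0M unfolding eq c_def by auto
qed

lemma nth_of_inj:
  assumes "i < card {w. w < M \<and> P w}" "j < card {w. w < M \<and> P w}" "nth_of M P i = nth_of M P j"
  shows "i = j"
  using nth_of(3)[OF assms(1)] nth_of(3)[OF assms(2)] assms(3) by simp

text \<open>The least element of \<open>P\<close>, again as the number of its predecessors; it is
  \<open>M\<close> if there is none below \<open>M\<close>.\<close>

definition first_of :: "nat \<Rightarrow> (nat \<Rightarrow> bool) \<Rightarrow> nat" where
  "first_of M P = card {w. w < M \<and> (\<forall>v<w + 1. \<not> P v)}"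

lemma first_of:
  assumes "w < M" "P w" shows "P (first_of M P)"
proof -
  define w0 where "w0 = (LEAST w. P w)"
  have w0: "P w0" unfolding w0_def using assms(2) by (rule LeastI)
  have least: "\<not> P v" if "v < w0" for v using not_less_Least that unfolding w0_def by blast
  have "w0 \<le> w" unfolding w0_def using assms(2) by (rule Least_le)
  then have "{w. w < M \<and> (\<forall>v<w + 1. \<not> P v)} = {..<w0}"
  proof (intro set_eqI iffI)
    fix x assume x: "x \<in> {w. w < M \<and> (\<forall>v<w + 1. \<not> P v)}"
    have "\<not> w0 < x + 1" using x w0 by blast
    then show "x \<in> {..<w0}" by simp
  next
    fix x assume "x \<in> {..<w0}"
    then show "x \<in> {w. w < M \<and> (\<forall>v<w + 1. \<not> P v)}" using least assms(1) \<open>w0 \<le> w\<close> by auto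
  qed
  then show ?thesis using w0 by (simp add: first_of_def)
qed

lemma first_of_fit:
  assumes s: "exp 200 \<le> real s"
  shows "fit (pow_table s) s (first_of (s ^ (24 * s)) (fit (pow_table s) s))"
proof -
  have "card {w. w < s ^ (24 * s) \<and> accept s w} > 0"
    using card_accept[OF s] fact_gt_zero[of s] by (metis less_le_trans)
  then obtain w where "w < s ^ (24 * s)" "accept s w" by (auto simp: card_gt_0_iff)
  then show ?thesis using first_of[of w _ "fit (pow_table s) s"] accept_fit by blast
qed

section \<open>The family of graphs\<close>

text \<open>Colour 24 is the identity on the regular components but not on the last one, so good cells
  cannot be moved between the two kinds.\<close>

definition cell_map where
  "cell_map s L N pw pw' a b i X = (if N \<le> X then X
     else if i = (24::nat) then (if X < L then X else flip X)
     else if X < L then X div s * s + tup pw s (a (X div s)) i (X mod s)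
     else L + tup pw' (N - L) b i (X - L))"

text \<open>Components \<open>0, ..., q - 2\<close> have \<open>s\<close> cells and distinct
  accepted codes; component \<open>q - 1\<close> takes all remaining cells. Evenness of
  \<open>s\<close> keeps \<open>flip\<close> inside components.\<close>

locale component_family =
  fixes s q N :: nat and a :: "nat \<Rightarrow> nat" and b :: nat
  assumes s2: "2 \<le> s" and evs: "even s" and evN: "even N" and q1: "1 \<le> q" and LN: "(q - 1) * s + s \<le> N"
    and acc: "\<And>j. j < q - 1 \<Longrightarrow> accept s (a j)"
    and inj: "\<And>i j. i < q - 1 \<Longrightarrow> j < q - 1 \<Longrightarrow> a i = a j \<Longrightarrow> i = j"
    and fitb: "fit (pow_table (N - (q - 1) * s)) (N - (q - 1) * s) b"
begin

definition L where "L = (q - 1) * s"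
definition T where "T = cell_map s L N (pow_table s) (pow_table (N - L)) a b"
definition cl where "cl X = (if X < L then X div s else q - 1)"
definition sz where "sz j = (if j < q - 1 then s else N - L)"
definition \<tau> where "\<tau> j = (if j < q - 1 then perms_of s (a j) else perms_of (N - L) b)"

lemma s0: "0 < s" using s2 by simp

lemma lsz: "s \<le> N - L" "2 \<le> N - L" "L < N"
  using LN s2 by (auto simp: L_def)

lemma sz2: "2 \<le> sz j"
  using s2 lsz by (simp add: sz_def)

lemma evL: "even L" using evs by (simp add: L_def)

lemma fit_\<tau>:
  assumes "j < q" shows "\<tau> j \<in> tuples (sz j)" "expanding (sz j) (\<tau> j)" "rigid (sz j) (\<tau> j)"
proof -
  have "\<tau> j \<in> tuples (sz j) \<and> expanding (sz j) (\<tau> j) \<and> rigid (sz j) (\<tau> j)"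
  proof (cases "j < q - 1")
    case True
    then show ?thesis using accept_fit[OF acc[OF True]] fit_iff[OF s2, of "a j"] by (simp add: \<tau>_def sz_def)
  next
    case False
    then show ?thesis using fitb fit_iff[OF lsz(2), of b] by (simp add: \<tau>_def sz_def L_def)
  qed
  then show "\<tau> j \<in> tuples (sz j)" "expanding (sz j) (\<tau> j)" "rigid (sz j) (\<tau> j)" by auto
qed

lemma cell_cl:
  assumes "X < N"
  shows "cl X < q" "X - cl X * s < sz (cl X)" "X = cl X * s + (X - cl X * s)"
proof -
  have "cl X < q \<and> X - cl X * s < sz (cl X) \<and> cl X * s \<le> X"
  proof (cases "X < L")
    case True
    then have "X div s < q - 1" by (simp add: L_def less_mult_imp_div_less)
    then show ?thesis using True s0 by (simp add: cl_def sz_def minus_div_mult_eq_mod)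
  next
    case False
    then show ?thesis using assms q1 by (auto simp: cl_def sz_def L_def)
  qed
  then show "cl X < q" "X - cl X * s < sz (cl X)" "X = cl X * s + (X - cl X * s)" by auto
qed

lemma cl_off:
  assumes "j < q" "x < sz j"
  shows "j * s + x < N" "cl (j * s + x) = j"
proof -
  have "j * s + x < N \<and> cl (j * s + x) = j"
  proof (cases "j < q - 1")
    case True
    then have "x < s" using assms(2) by (simp add: sz_def)
    then have "j * s + x < (j + 1) * s" by simp
    also have "\<dots> \<le> (q - 1) * s" using True by (intro mult_le_mono1) simp
    finally have "j * s + x < L" by (simp add: L_def)
    then show ?thesis using lsz(3) \<open>x < s\<close> s0 by (simp add: cl_def)
  next
    case False
    then have "j = q - 1" using assms(1) by simp
    then show ?thesis using assms(2) by (simp add: cl_def sz_def L_def)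
  qed
  then show "j * s + x < N" "cl (j * s + x) = j" by auto
qed

lemma T_eq:
  assumes "i < 24" "X < N"
  shows "T i X = cl X * s + \<tau> (cl X) i (X - cl X * s)"
proof (cases "X < L")
  case True
  then have "X div s < q - 1" by (simp add: L_def less_mult_imp_div_less)
  then show ?thesis
    using True assms s0 by (simp add: T_def cell_map_def cl_def \<tau>_def perms_of_def ext_def minus_div_mult_eq_mod)
next
  case False
  then show ?thesis
    using assms by (auto simp: T_def cell_map_def cl_def \<tau>_def perms_of_def ext_def L_def)
qed

lemma T24: "X < N \<Longrightarrow> T 24 X = (if X < L then X else flip X)"
  by (simp add: T_def cell_map_def)

lemma flip_ge_iff: "L \<le> flip X \<longleftrightarrow> L \<le> X"
  using evL by (auto simp: flip_def elim!: evenE oddE)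

lemma flip_div: "even s \<Longrightarrow> flip X div s = X div s"
proof -
  assume "even s"
  then obtain t where t: "s = 2 * t" by (rule evenE)
  have "X div s = X div 2 div t" for X by (simp add: t div_mult2_eq)
  moreover have "flip X div 2 = X div 2" by (auto simp: flip_def elim!: oddE evenE)
  ultimately show ?thesis by metis
qed

lemma cl_flip: "cl (flip X) = cl X"
  using flip_ge_iff[of X] flip_div[OF evs, of X] by (auto simp: cl_def not_le[symmetric])

lemma cl_T:
  assumes "i \<le> 24" "X < N" shows "T i X < N" "cl (T i X) = cl X"
proof -
  have "T i X < N \<and> cl (T i X) = cl X"
  proof (cases "i = 24")
    case True
    then show ?thesis using T24[OF assms(2)] cl_flip flip_less[OF evN assms(2)] assms(2) by simp
  next
    case False
    then have i: "i < 24" using assms(1) by simp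
    have "\<tau> (cl X) i (X - cl X * s) < sz (cl X)"
      using permutes_less[OF tuplesD[OF fit_\<tau>(1)[OF cell_cl(1)[OF assms(2)]] i] cell_cl(2)[OF assms(2)]] .
    then show ?thesis using cl_off[OF cell_cl(1)[OF assms(2)]] unfolding T_eq[OF i assms(2)] by simp
  qed
  then show "T i X < N" "cl (T i X) = cl X" by auto
qed

lemma T_permutes:
  assumes i: "i \<le> 24" shows "T i permutes {..<N}"
proof (rule bij_imp_permutes)
  have "inj_on (T i) {..<N}"
  proof (rule inj_onI)
    fix X Y assume XY: "X \<in> {..<N}" "Y \<in> {..<N}" and eq: "T i X = T i Y"
    then have cl: "cl X = cl Y" using cl_T(2)[OF i, of X] cl_T(2)[OF i, of Y] by simp
    show "X = Y"
    proof (cases "i = 24")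
      case True
      have "(X < L) = (Y < L)"
        using eq XY unfolding True by (auto simp: T24 split: if_splits) (metis flip_ge_iff not_le)+
      then show ?thesis using eq XY unfolding True by (auto simp: T24 split: if_splits) (metis flip_flip)
    next
      case False
      then have i: "i < 24" using assms by simp
      have "\<tau> (cl X) i (X - cl X * s) = \<tau> (cl X) i (Y - cl X * s)" using eq XY cl by (simp add: T_eq i)
      moreover have "inj (\<tau> (cl X) i)"
        using tuplesD[OF fit_\<tau>(1)[OF cell_cl(1)] i, of X] XY permutes_inj by auto
      ultimately have "X - cl X * s = Y - cl Y * s" using cl by (auto dest: injD)
      then show ?thesis using cell_cl(3)[of X] cell_cl(3)[of Y] XY cl by simp
    qed
  qed
  moreover have "T i ` {..<N} \<subseteq> {..<N}" using cl_T(1)[OF i] by auto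
  ultimately show "bij_betw (T i) {..<N} {..<N}" by (simp add: bij_betw_def endo_inj_surj)
qed (auto simp: T_def cell_map_def)

text \<open>Since \<open>flip\<close> has no fixed point, colour 24 fixes exactly the regular cells,
  so good cells stay among the regular ones or in the last component. Hence only regular components,
  of equal size, can be confused, and their accepted codes are far apart.\<close>

lemma T_robust:
  assumes Gd: "Gd \<subseteq> {..<N}" "inj_on \<psi> Gd" "\<psi> ` Gd \<subseteq> {..<N}"
    and hom: "\<forall>X\<in>Gd. \<forall>i\<le>24. T i X \<in> Gd \<longrightarrow> \<psi> (T i X) = T i (\<psi> X)"
    and fixp: "\<forall>X\<in>Gd. \<forall>i\<le>24. T i X = X \<longleftrightarrow> T i (\<psi> X) = \<psi> X"
  shows "card {X \<in> Gd. \<psi> X \<noteq> X} \<le> 700 * card ({..<N} - Gd)"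
proof (rule cells_moved_le[where sz = sz and off = "\<lambda>j. j * s" and cl = cl and loc = "\<lambda>X. X - cl X * s"
      and q = q and \<tau> = \<tau> and T = T, OF _ _ _ _ _ _ _ Gd])
  \<comment> \<open>Both sides say that colour 24 fixes the cell in question.\<close>
  have special: "\<psi> X < L \<longleftrightarrow> X < L" if "X \<in> Gd" for X
  proof -
    have "X < N" "\<psi> X < N" using that Gd by auto
    then show ?thesis using fixp[rule_format, OF that, of 24] by (auto simp: T24 split: if_splits)
  qed
  have cls: "cl X < q - 1 \<longleftrightarrow> X < L" if "X < N" for X
  proof -
    have "X div s < q - 1" if "X < L" using that by (simp add: L_def less_mult_imp_div_less)
    then show ?thesis by (auto simp: cl_def)
  qed
  have N: "X < N" "\<psi> X < N" if "X \<in> Gd" for X using that Gd by auto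
  show "cl X < q \<and> X - cl X * s < sz (cl X) \<and> X = cl X * s + (X - cl X * s)" if "X < N" for X
    using cell_cl[OF that] by blast
  show "j * s + x < N \<and> cl (j * s + x) = j \<and> j * s + x - cl (j * s + x) * s = x" if "j < q" "x < sz j" for j x
    using cl_off[OF that] by simp
  show "0 < sz j" for j using sz2[of j] by linarith
  show "\<tau> j i permutes {..<sz j}" if "j < q" "i < 24" for j i using tuplesD[OF fit_\<tau>(1)[OF that(1)] that(2)] .
  show "expanding (sz j) (\<tau> j)" "rigid (sz j) (\<tau> j)" if "j < q" for j using fit_\<tau>[OF that] by auto
  show "T i X = cl X * s + \<tau> (cl X) i (X - cl X * s)" if "i < 24" "X < N" for i X by (rule T_eq[OF that])
  show "\<psi> (T i X) = T i (\<psi> X)" if "X \<in> Gd" "i < 24" "T i X \<in> Gd" for X i using hom that by simp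
  show "sz (cl (\<psi> X)) = sz (cl X)" if "X \<in> Gd" for X
    using special[OF that] cls[OF N(1)[OF that]] cls[OF N(2)[OF that]] by (simp add: sz_def)
  show "\<not> near (sz (cl X)) (\<tau> (cl X)) (\<tau> (cl (\<psi> X))) \<phi>"
    if X: "X \<in> Gd" "cl (\<psi> X) \<noteq> cl X" "\<phi> permutes {..<sz (cl X)}" for X \<phi>
  proof -
    have XL: "X < L"
    proof (rule ccontr)
      assume "\<not> X < L"
      then show False using X(2) special[OF X(1)] by (simp add: cl_def)
    qed
    then have c: "cl X < q - 1" "cl (\<psi> X) < q - 1"
      using special[OF X(1)] cls[OF N(1)[OF X(1)]] cls[OF N(2)[OF X(1)]] by auto
    then have "a (cl X) \<noteq> a (cl (\<psi> X))" using inj X(2) by metis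
    then show ?thesis
      using accept_not_near[OF s0 acc[OF c(1)] acc[OF c(2)]] X(3) c by (simp add: \<tau>_def sz_def)
  qed
qed

lemma card_component: "card {X \<in> {..<N}. cl X = j} \<le> N - L"
proof -
  have "{X \<in> {..<N}. cl X = j} \<subseteq> (+) (j * s) ` {..<sz j}"
  proof
    fix X assume X: "X \<in> {X \<in> {..<N}. cl X = j}"
    then show "X \<in> (+) (j * s) ` {..<sz j}"
      using cell_cl(2,3)[of X] by (intro image_eqI[of _ _ "X - cl X * s"]) auto
  qed
  then have "card {X \<in> {..<N}. cl X = j} \<le> card ((+) (j * s) ` {..<sz j})" by (intro card_mono) auto
  also have "\<dots> \<le> card {..<sz j}" by (rule card_image_le) simp
  also have "\<dots> \<le> N - L" using lsz by (simp add: sz_def)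
  finally show ?thesis .
qed

end

context cell_graph
begin

lemma edge_cases:
  assumes "{u, v} \<in> E"
  obtains "u \<le> W" "v \<le> W"
  | X Y where "W < u" "W < v" "cell W u < N" "cell W v < N" "X = cell W u" "Y = cell W v"
      "(Y = X \<or> Y = flip X \<or> (\<exists>i\<le>24. Y = T i X)) \<or> (\<exists>i\<le>24. X = T i Y)"
proof -
  have in_n: "u \<in> {1..n}" "v \<in> {1..n}" using graph_edgeD[OF graph_E assms] by auto
  consider "u \<le> W" "v \<le> W" | "u \<le> W" "W < v" | "v \<le> W" "W < u" | "W < u" "W < v" by linarith
  then show thesis
  proof cases
    case 1
    then show ?thesis using that by blast
  next
    case 2
    then show ?thesis using no_edge_block assms by blast
  next
    case 3
    then show ?thesis using no_edge_block[of v u] assms by (simp add: insert_commute)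
  next
    case 4
    obtain X a where X: "u = vert X a" "X < N" "a \<in> {1..28}" using vert_cases[OF in_n(1) 4(1)] .
    obtain Y b where Y: "v = vert Y b" "Y < N" "b \<in> {1..28}" using vert_cases[OF in_n(2) 4(2)] .
    have link: "link T a b X = X \<or> (\<exists>i\<le>24. link T a b X = T i X)" if "a \<in> {1..28}" "b \<in> {1..28}" "a < b" for a b X
    proof (cases "b = 27 \<and> 2 \<le> a")
      case True
      then have "a - 2 \<le> 24" using that by auto
      then show ?thesis using True by (auto simp: link_def)
    qed (auto simp: link_def)
    have "(a < b \<and> Y = link T a b X) \<or> (b < a \<and> X = link T b a Y) \<or> Y = flip X"
      using assms edge_vert[OF X(2,3) Y(2,3)] X(1) Y(1) by auto
    then have nb: "(Y = X \<or> Y = flip X \<or> (\<exists>i\<le>24. Y = T i X)) \<or> (\<exists>i\<le>24. X = T i Y)"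
    proof (elim disjE conjE)
      assume "a < b" "Y = link T a b X"
      then have "Y = X \<or> (\<exists>i\<le>24. Y = T i X)" using link[OF X(3) Y(3), of X] by simp
      then show ?thesis by (elim disjE) simp_all
    next
      assume "b < a" "X = link T b a Y"
      then have "X = Y \<or> (\<exists>i\<le>24. X = T i Y)" using link[OF Y(3) X(3), of Y] by simp
      then show ?thesis by (elim disjE) simp_all
    next
      assume "Y = flip X"
      then show ?thesis by (intro disjI1 disjI2)
    qed
    have c: "cell W u = X" "cell W v = Y" using X(1,3) Y(1,3) by simp_all
    show ?thesis by (rule that(2)[OF 4 _ _ _ _ nb]) (simp_all add: c X(2) Y(2))
  qed
qed

text \<open>Block vertices get label 0 and cell vertices one more than their component, so that
  labels never clash. Every edge follows a colour, a \<open>flip\<close> or stays in its cell, and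
  none of these changes the label.\<close>

lemma max_component_size_E:
  assumes cl: "\<And>i X. i \<le> 24 \<Longrightarrow> X < N \<Longrightarrow> cl (T i X) = cl X" "\<And>X. cl (flip X) = cl X"
    and S: "\<And>j :: nat. card {X \<in> {..<N}. cl X = j} \<le> S"
  shows "max_component_size {1..n} E \<le> W + 28 * S"
proof (rule max_component_size_le[where lab = "\<lambda>u. if u \<le> W then 0 else Suc (cl (cell W u))"])
  show "{1..n} \<noteq> {}" using W by (simp add: n_def)
  show "(if u \<le> W then 0 else Suc (cl (cell W u))) = (if v \<le> W then 0 else Suc (cl (cell W v)))"
    if "{u, v} \<in> E" for u v
    using that
  proof (cases rule: edge_cases)
    case (2 X Y)
    then have "cl X = cl Y" using cl by metis
    then show ?thesis using 2 by simp
  qed simp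
  fix v assume v: "v \<in> {1..n}"
  let ?M = "{w \<in> {1..n}. (if w \<le> W then 0 else Suc (cl (cell W w))) = (if v \<le> W then 0 else Suc (cl (cell W v)))}"
  show "card ?M \<le> W + 28 * S"
  proof (cases "v \<le> W")
    case True
    then have "?M \<subseteq> {1..W}" by (auto split: if_splits)
    then have "card ?M \<le> card {1..W}" by (intro card_mono) auto
    then show ?thesis by simp
  next
    case False
    let ?C = "{X \<in> {..<N}. cl X = cl (cell W v)}"
    have "?M \<subseteq> (\<lambda>(X, a). vert X a) ` (?C \<times> {1..28})"
    proof
      fix w assume w: "w \<in> ?M"
      then have "W < w" "w \<in> {1..n}" using False by (auto split: if_splits)
      then obtain X a where X: "w = vert X a" "X < N" "a \<in> {1..28}" using vert_cases by blast
      then have "X \<in> ?C" using w False \<open>W < w\<close> by auto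
      then show "w \<in> (\<lambda>(X, a). vert X a) ` (?C \<times> {1..28})" using X by force
    qed
    then have "card ?M \<le> card ((\<lambda>(X, a). vert X a) ` (?C \<times> {1..28}))" by (intro card_mono) auto
    also have "\<dots> \<le> card (?C \<times> {1..28::nat})" by (rule card_image_le) auto
    also have "\<dots> = 28 * card ?C" by (simp add: card_cartesian_product)
    also have "\<dots> \<le> 28 * S" using S by simp
    finally show ?thesis by simp
  qed
qed simp

end

section \<open>Choice of parameters\<close>

text \<open>The inverse of the factorial, of order \<open>ln n / ln (ln n)\<close>, written as a
  count so that it can be computed from a table of factorials.\<close>

definition height :: "nat \<Rightarrow> nat" where
  "height n = card {i. i < n \<and> fact (i + 1) \<le> n}"

lemma height:
  assumes "1 \<le> n" shows "fact (height n) \<le> n" "n < fact (height n + 1)"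
proof -
  define h where "h = (LEAST i. n < fact (i + 1))"
  have "n < fact (n + 1)" using fact_ge_self[of "n + 1"] by simp
  then have h: "n < fact (h + 1)" unfolding h_def by (rule LeastI)
  have least: "fact (i + 1) \<le> n" if "i < h" for i
    using not_less_Least[of i "\<lambda>i. n < fact (i + 1)"] that unfolding h_def by simp
  have "{i. i < n \<and> fact (i + 1) \<le> n} = {..<h}"
  proof (intro set_eqI iffI)
    fix i assume i: "i \<in> {i. i < n \<and> fact (i + 1) \<le> n}"
    have "\<not> h \<le> i"
    proof
      assume "h \<le> i"
      then have "(fact (h + 1) :: nat) \<le> fact (i + 1)" by (intro fact_mono_nat) simp
      then show False using i h by simp
    qed
    then show "i \<in> {..<h}" by simp
  next
    fix i assume i: "i \<in> {..<h}"
    then have "fact (i + 1) \<le> n" using least by simp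
    moreover have "i + 1 \<le> fact (i + 1)" by (rule fact_ge_self)
    ultimately show "i \<in> {i. i < n \<and> fact (i + 1) \<le> n}" by simp
  qed
  then have "height n = h" by (simp add: height_def)
  moreover have "fact h \<le> n"
    using assms least[of "h - 1"] by (cases h) auto
  ultimately show "fact (height n) \<le> n" "n < fact (height n + 1)" using h by auto
qed

text \<open>Up to the threshold the block is the whole graph.\<close>

definition threshold :: "nat \<Rightarrow> nat" where
  "threshold d = fact (d + 60 + nat \<lceil>exp 200 :: real\<rceil>) + d"

text \<open>Cells come in pairs, as \<open>flip\<close> requires, hence 56 vertices at a time;
  \<open>d + 1\<close> vertices are reserved for the block.\<close>

definition cells :: "nat \<Rightarrow> nat \<Rightarrow> nat" where
  "cells d n = (if n \<le> threshold d then 0 else 2 * ((n - (d + 1)) div 56))"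

text \<open>The number of cells in regular components. One component fewer than would fit is made
  regular, so that the last one, including the remainder, has at least \<open>s\<close> and fewer
  than \<open>2 * s\<close> cells.\<close>

definition regular :: "nat \<Rightarrow> nat \<Rightarrow> nat \<Rightarrow> nat" where
  "regular d n s = (cells d n div s - 1) * s"

lemma cells_le: "28 * cells d n \<le> n" "d < n \<Longrightarrow> d + 1 \<le> n - 28 * cells d n"
  "n - 28 * cells d n \<le> threshold d + d + 57"
proof -
  have "28 * cells d n = 0 \<or> threshold d < n \<and> 28 * cells d n = 56 * ((n - (d + 1)) div 56)"
    by (auto simp: cells_def)
  moreover have "56 * ((n - (d + 1)) div 56) + (n - (d + 1)) mod 56 = n - (d + 1)" by simp
  moreover have "(n - (d + 1)) mod 56 < 56" by simp
  moreover have "d \<le> threshold d" by (simp add: threshold_def)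
  ultimately show "28 * cells d n \<le> n" "d < n \<Longrightarrow> d + 1 \<le> n - 28 * cells d n" by linarith+
  show "n - 28 * cells d n \<le> threshold d + d + 57"
  proof (cases "n \<le> threshold d")
    case False
    then have "28 * cells d n = 56 * ((n - (d + 1)) div 56)" by (simp add: cells_def)
    then show ?thesis
      using \<open>56 * ((n - (d + 1)) div 56) + (n - (d + 1)) mod 56 = n - (d + 1)\<close>
        \<open>(n - (d + 1)) mod 56 < 56\<close> by linarith
  qed simp
qed

text \<open>The summands in \<open>threshold\<close> serve these claims: \<open>exp 200\<close>
  starts the counting estimates, \<open>d + 60\<close> makes
  \<open>height n * (height n - 1)\<close> exceed \<open>56 * height n + d + 1\<close>, and the
  final \<open>d\<close> gives \<open>d + 1 \<le> n\<close>.\<close>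

lemma above_threshold:
  assumes n: "threshold d < n"
  shows "exp 200 \<le> real (2 * height n)" "2 * height n \<le> cells d n" "d + 1 \<le> n" "cells d n < fact (2 * height n)"
proof -
  let ?H = "d + 60 + nat \<lceil>exp 200 :: real\<rceil>"
  have n1: "1 \<le> n" "fact ?H < n" using n by (auto simp: threshold_def)
  then have "(fact ?H :: nat) < fact (height n + 1)" using height(2)[OF n1(1)] by linarith
  then have "?H < height n + 1" using fact_mono_nat[of "height n + 1" ?H] by (meson not_le)
  then have h: "d + 60 \<le> height n" "nat \<lceil>exp 200 :: real\<rceil> \<le> 2 * height n" by linarith+
  have "exp 200 \<le> real (nat \<lceil>exp 200 :: real\<rceil>)" by (rule real_nat_ceiling_ge)
  also have "\<dots> \<le> real (2 * height n)" using h(2) by (rule of_nat_mono)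
  finally show "exp 200 \<le> real (2 * height n)" .
  show dn: "d + 1 \<le> n" using n by (simp add: threshold_def)
  obtain g where g: "height n = g + 2" using h(1) by (intro that[of "height n - 2"]) simp
  have "(g + 2) * (g + 1) \<le> (fact (g + 2) :: nat)"
  proof -
    have "(g + 2) * (g + 1) * 1 \<le> (g + 2) * (g + 1) * (fact g :: nat)" using fact_ge_1 by (rule mult_le_mono2)
    also have "\<dots> = fact (g + 2)" by (simp add: numeral_2_eq_2 algebra_simps)
    finally show ?thesis by simp
  qed
  then have "height n * (height n - 1) \<le> n" using height(1)[OF n1(1)] g by simp
  moreover have "height n * (d + 59) \<le> height n * (height n - 1)" using h(1) by (intro mult_le_mono2) simp
  moreover have "56 * height n + (d + 1) \<le> height n * (d + 59)"
  proof -
    have eq: "height n * (d + 59) = 56 * height n + height n * (d + 3)" by (simp add: algebra_simps)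
    have "1 * (d + 3) \<le> height n * (d + 3)" using h(1) by (intro mult_le_mono1) simp
    then have "d + 1 \<le> height n * (d + 3)" unfolding mult_1 by (rule order_trans[rotated]) simp
    then show ?thesis unfolding eq by (rule add_left_mono)
  qed
  ultimately have "56 * height n \<le> n - (d + 1)" by linarith
  then have "height n \<le> (n - (d + 1)) div 56" by (simp add: less_eq_div_iff_mult_less_eq mult.commute)
  then show "2 * height n \<le> cells d n" using n by (simp add: cells_def)
  have "cells d n \<le> n" using cells_le(1)[of d n] by simp
  also have "n < fact (height n + 1)" by (rule height(2)[OF n1(1)])
  also have "(fact (height n + 1) :: nat) \<le> fact (2 * height n)" using h(1) by (intro fact_mono_nat) simp
  finally show "cells d n < fact (2 * height n)" .
qed

definition code_of :: "nat \<Rightarrow> nat \<Rightarrow> nat" where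
  "code_of n j = nth_of ((2 * height n) ^ (24 * (2 * height n))) (accept (2 * height n)) j"

definition last_size :: "nat \<Rightarrow> nat \<Rightarrow> nat" where
  "last_size d n = cells d n - regular d n (2 * height n)"

definition last_code :: "nat \<Rightarrow> nat \<Rightarrow> nat" where
  "last_code d n = first_of (last_size d n ^ (24 * last_size d n)) (fit (pow_table (last_size d n)) (last_size d n))"

definition wiring :: "nat \<Rightarrow> nat \<Rightarrow> nat \<Rightarrow> nat \<Rightarrow> nat" where
  "wiring d n = cell_map (2 * height n) (regular d n (2 * height n)) (cells d n)
     (pow_table (2 * height n)) (pow_table (last_size d n)) (code_of n) (last_code d n)"

lemma last_size_bounds:
  assumes "threshold d < n"
  shows "2 * height n \<le> last_size d n" "last_size d n \<le> 2 * (2 * height n)"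
    "(cells d n div (2 * height n) - 1) * (2 * height n) + 2 * height n \<le> cells d n"
    "1 \<le> cells d n div (2 * height n)"
proof -
  let ?s = "2 * height n" and ?N = "cells d n"
  have s: "0 < ?s" "?s \<le> ?N"
    using above_threshold[OF assms] exp_gt_zero[of "200::real"] by (auto intro: gr0I)
  then show q: "1 \<le> ?N div ?s" by (simp add: Suc_le_eq div_greater_zero_iff)
  then obtain p where p: "?N div ?s = Suc p" by (metis Suc_le_D One_nat_def)
  have "?N div ?s * ?s + ?N mod ?s = ?N" by (rule div_mult_mod_eq)
  then have N: "p * ?s + ?s + ?N mod ?s = ?N" unfolding p by simp
  have ms: "?N mod ?s < ?s" using s by simp
  have aux: "S \<le> M - K \<and> M - K \<le> 2 * S \<and> K + S \<le> M" if "K + S + R = M" "R < S" for K S R M :: nat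
    using that by auto
  show "2 * height n \<le> last_size d n" "last_size d n \<le> 2 * (2 * height n)"
    "(cells d n div (2 * height n) - 1) * (2 * height n) + 2 * height n \<le> cells d n"
    using aux[OF N ms] unfolding last_size_def regular_def p by auto
qed

text \<open>There are at least \<open>fact (2 * height n)\<close> accepted codes, more than there
  are cells, let alone components. Doubling the height ensures this and also makes \<open>s\<close>
  even.\<close>

lemma component_family_cells:
  assumes n: "threshold d < n"
  shows "component_family (2 * height n) (cells d n div (2 * height n)) (cells d n) (code_of n) (last_code d n)"
proof -
  let ?s = "2 * height n" and ?N = "cells d n"
  note s = above_threshold[OF n] and l = last_size_bounds[OF n]
  have "201 \<le> real ?s" using s(1) exp_ge_add_one_self[of "200::real"] by simp
  then have s2: "2 \<le> ?s" by linarith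
  have ls: "exp 200 \<le> real (last_size d n)" using s(1) l(1) by linarith
  have cnt: "j < card {w. w < ?s ^ (24 * ?s) \<and> accept ?s w}" if "j < ?N div ?s - 1" for j
  proof -
    have "j < ?N" using that div_le_dividend[of ?N ?s] by linarith
    then show ?thesis using s(4) card_accept[OF s(1)] by linarith
  qed
  show ?thesis
  proof
    show "2 \<le> ?s" by (rule s2)
    show "even ?s" by simp
    show "even ?N" by (simp add: cells_def)
    show "1 \<le> ?N div ?s" by (rule l(4))
    show "(?N div ?s - 1) * ?s + ?s \<le> ?N" by (rule l(3))
    show "accept ?s (code_of n j)" if "j < ?N div ?s - 1" for j
      unfolding code_of_def by (rule nth_of(2)[OF cnt[OF that]])
    show "i = j" if "i < ?N div ?s - 1" "j < ?N div ?s - 1" "code_of n i = code_of n j" for i j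
      using nth_of_inj[OF cnt[OF that(1)] cnt[OF that(2)]] that(3) unfolding code_of_def by blast
    show "fit (pow_table (?N - (?N div ?s - 1) * ?s)) (?N - (?N div ?s - 1) * ?s) (last_code d n)"
      using first_of_fit[OF ls] unfolding last_code_def unfolding last_size_def regular_def .
  qed
qed

text \<open>For \<open>n \<le> d\<close> no vertex can have degree \<open>d\<close>, so the
  asymmetric graph of \<open>path_arc\<close> takes over.\<close>

definition the_arc :: "nat \<Rightarrow> nat \<Rightarrow> nat \<Rightarrow> nat \<Rightarrow> bool" where
  "the_arc d n u v \<longleftrightarrow> (if n \<le> d then path_arc n u v else arc (n - 28 * cells d n) d (wiring d n) u v)"

definition the_edges :: "nat \<Rightarrow> nat \<Rightarrow> nat set set" where
  "the_edges d n = graph_of n (the_arc d n)"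

lemma wiring_eq:
  assumes "threshold d < n"
  shows "wiring d n = component_family.T (2 * height n) (cells d n div (2 * height n)) (cells d n) (code_of n) (last_code d n)"
  unfolding wiring_def component_family.T_def[OF component_family_cells[OF assms]]
    component_family.L_def[OF component_family_cells[OF assms]] last_size_def regular_def ..

lemma cell_graph_wiring:
  assumes d: "30 \<le> d" "d < n"
  shows "cell_graph (cells d n) (n - 28 * cells d n) d (wiring d n)"
proof
  show "wiring d n i permutes {..<cells d n}" if "i \<le> 24" for i
  proof (cases "threshold d < n")
    case True
    show ?thesis unfolding wiring_eq[OF True]
      by (rule component_family.T_permutes[OF component_family_cells[OF True] that])
  next
    case False
    then have "cells d n = 0" by (simp add: cells_def)
    then have "wiring d n i = id" by (auto simp: wiring_def cell_map_def)
    then show ?thesis using permutes_id by simp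
  qed
  show "even (cells d n)" by (simp add: cells_def)
  show "30 \<le> d" by (rule d)
  show "d + 1 \<le> n - 28 * cells d n" by (rule cells_le(2)[OF d(2)])
qed

lemma n_the_edges:
  assumes d: "30 \<le> d" "d < n"
  shows "cell_graph.n (cells d n) (n - 28 * cells d n) = n"
    "cell_graph.E (cells d n) (n - 28 * cells d n) d (wiring d n) = the_edges d n"
proof -
  show 1: "cell_graph.n (cells d n) (n - 28 * cells d n) = n"
    unfolding cell_graph.n_def[OF cell_graph_wiring[OF d]] using cells_le(1)[of d n] by simp
  show "cell_graph.E (cells d n) (n - 28 * cells d n) d (wiring d n) = the_edges d n"
    unfolding cell_graph.E_def[OF cell_graph_wiring[OF d]] 1 the_edges_def the_arc_def using d by simp
qed

lemma robust_cells_wiring: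
  assumes d: "30 \<le> d" "d < n"
  shows "cell_graph.robust_cells (cells d n) (wiring d n) 700"
  unfolding cell_graph.robust_cells_def[OF cell_graph_wiring[OF d]]
proof (intro allI impI)
  fix G \<psi> assume G: "G \<subseteq> {..<cells d n}" "inj_on \<psi> G" "\<psi> ` G \<subseteq> {..<cells d n}"
    "\<forall>X\<in>G. \<forall>i\<le>24. wiring d n i X \<in> G \<longrightarrow> \<psi> (wiring d n i X) = wiring d n i (\<psi> X)"
    "\<forall>X\<in>G. \<forall>i\<le>24. (wiring d n i X = X) = (wiring d n i (\<psi> X) = \<psi> X)"
  show "card {X \<in> G. \<psi> X \<noteq> X} \<le> 700 * card ({..<cells d n} - G)"
  proof (cases "threshold d < n")
    case True
    show ?thesis
      using component_family.T_robust[OF component_family_cells[OF True] G(1-3)] G(4,5)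
      unfolding wiring_eq[OF True] by blast
  next
    case False
    then have "G = {}" using G(1) by (simp add: cells_def)
    then show ?thesis by simp
  qed
qed

lemma max_degree_the_edges: "30 \<le> d \<Longrightarrow> d < n \<Longrightarrow> max_degree {1..n} (the_edges d n) = d"
  using cell_graph.max_degree_E[OF cell_graph_wiring] n_the_edges by metis

text \<open>\<open>threshold d + d + 57\<close> bounds the block, 28 is the number of vertices of a
  cell, and 701 is one more than the constant of \<open>T_robust\<close>.\<close>

definition gap :: "nat \<Rightarrow> real" where
  "gap d = 1 / real (2 * (threshold d + d + 57 + 28 * 701))"

lemma robustly_self_ordered_the_edges:
  assumes d: "30 \<le> d" and n: "n \<notin> {2, 3, 4, 5}"
  shows "robustly_self_ordered (gap d) {1..n} (the_edges d n)"
proof (cases "d < n")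
  case True
  show ?thesis
    using cell_graph.robustly_self_ordered_E[OF cell_graph_wiring[OF d True] robust_cells_wiring[OF d True] cells_le(3)]
    unfolding n_the_edges[OF d True] gap_def by simp
next
  case False
  then have "the_arc d n = path_arc n" by (auto simp: the_arc_def fun_eq_iff)
  then have E: "the_edges d n = graph_of n (path_arc n)" by (simp add: the_edges_def)
  show ?thesis
  proof (cases "6 \<le> n")
    case True
    then have "robustly_self_ordered (1 / real (2 * (threshold d + d + 57 + 28 * 701))) {1..n} (the_edges d n)"
      unfolding E using False by (intro robustly_self_ordered_path) auto
    then show ?thesis by (simp add: gap_def)
  next
    case False
    then have n1: "n \<le> 1" using n by auto
    have "\<pi> = id" if "\<pi> permutes {1..n}" for \<pi>
    proof (cases "n = 0")
      case True
      then show ?thesis using that by simp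
    next
      case False
      then have "{1..n} = {1}" using n1 by auto
      with that have "\<pi> permutes {1}" by (simp only:)
      then show ?thesis by (simp only: permutes_sing)
    qed
    then have "{v \<in> {1..n}. \<pi> v \<noteq> v} = {}" if "\<pi> permutes {1..n}" for \<pi> using that by fastforce
    then have "card {v \<in> {1..n}. \<pi> v \<noteq> v} = 0" if "\<pi> permutes {1..n}" for \<pi>
      using that by (metis card.empty)
    then show ?thesis
      unfolding robustly_self_ordered_def by (simp only: of_nat_0 mult_zero_right of_nat_0_le_iff simp_thms cong: imp_cong)
  qed
qed

text \<open>The last component has at most \<open>2 * (2 * height n)\<close> cells of 28 vertices,
  which gives 112; the rest bounds the block.\<close>

lemma max_component_size_the_edges:
  assumes d: "30 \<le> d" and n: "threshold d < n"
  shows "max_component_size {1..n} (the_edges d n) \<le> threshold d + d + 57 + 112 * height n"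
proof -
  have dn: "d < n" using above_threshold(3)[OF n] by simp
  interpret F: component_family "2 * height n" "cells d n div (2 * height n)" "cells d n" "code_of n" "last_code d n"
    by (rule component_family_cells[OF n])
  interpret G: cell_graph "cells d n" "n - 28 * cells d n" d "wiring d n" by (rule cell_graph_wiring[OF d dn])
  have "max_component_size {1..G.n} G.E \<le> (n - 28 * cells d n) + 28 * (cells d n - F.L)"
  proof (rule G.max_component_size_E[where cl = F.cl])
    show "F.cl (wiring d n i X) = F.cl X" if "i \<le> 24" "X < cells d n" for i X
      unfolding wiring_eq[OF n] by (rule F.cl_T(2)[OF that])
  qed (rule F.cl_flip, rule F.card_component)
  moreover have "cells d n - F.L = last_size d n" by (simp add: F.L_def last_size_def regular_def)
  ultimately show ?thesis
    using last_size_bounds(2)[OF n] cells_le(3)[of n d] unfolding n_the_edges[OF d dn] by linarith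
qed

section \<open>Computing the family\<close>

lemma power_self_le: "n ^ n \<le> 3 ^ n * (fact n :: nat)"
proof (cases "n = 0")
  case False
  then have n: "0 < n" by simp
  have "ln (real n ^ n) \<le> ln (exp (real n) * fact n)"
    using ln_fact_ge[OF n] n by (simp add: ln_mult ln_realpow)
  then have "real n ^ n \<le> exp (real n) * fact n" using n by (subst (asm) ln_le_cancel_iff) auto
  also have "exp (real n) = exp 1 ^ n" by (simp flip: exp_of_nat_mult)
  also have "\<dots> * fact n \<le> 3 ^ n * fact n" using exp_le by (intro mult_right_mono power_mono) auto
  finally have "real (n ^ n) \<le> real (3 ^ n * fact n)" by simp
  then show ?thesis by (simp only: of_nat_le_iff)
qed simp

text \<open>Once \<open>h\<close> has passed \<open>c\<close>, every new factor of the factorial is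
  at least \<open>c\<close>; the first factors are covered by \<open>c ^ c\<close>.\<close>

lemma power_le_const_fact:
  fixes c :: nat
  assumes "1 \<le> c" shows "c ^ h \<le> c ^ c * fact h"
proof (induction h)
  case 0
  show ?case using assms by simp
next
  case (Suc h)
  show ?case
  proof (cases "Suc h \<le> c")
    case True
    have "c ^ Suc h \<le> c ^ c" using True assms by (rule power_increasing)
    also have "\<dots> = c ^ c * 1" by simp
    also have "\<dots> \<le> c ^ c * fact (Suc h)" using fact_ge_1 by (rule mult_le_mono2)
    finally show ?thesis .
  next
    case False
    then have "c * c ^ h \<le> Suc h * (c ^ c * fact h)" using Suc by (intro mult_le_mono) auto
    then show ?thesis by (simp only: power_Suc fact_Suc of_nat_id mult_ac)
  qed
qed

text \<open>With \<open>h = height n\<close>, \<open>(4 * h) ^ (4 * h) = 256 ^ h * (h ^ h) ^ 4 \<le>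
  20736 ^ h * fact h ^ 4\<close>, where 20736 is \<open>256 * 81\<close>. The exponential costs one
  more \<open>fact h\<close>, and \<open>fact h \<le> n\<close>.\<close>

lemma code_space_polynomial: "\<exists>K. \<forall>n x. x \<le> 4 * height n \<longrightarrow> x ^ (24 * x) \<le> (n + 2) ^ K"
proof -
  obtain C :: nat where C: "\<And>h. 20736 ^ h \<le> C * fact h"
    using power_le_const_fact[of 20736] by (meson one_le_numeral)
  have main: "x ^ (24 * x) \<le> (n + 2) ^ ((C + 5) * 24)" if x: "x \<le> 4 * height n" for n x
  proof (cases "x = 0")
    case False
    define h where "h = height n"
    have h: "1 \<le> h" using x False by (auto simp: h_def intro: Suc_leI gr0I)
    then have n1: "1 \<le> n" by (cases n) (auto simp: h_def height_def)
    have hn: "fact h \<le> n" unfolding h_def by (rule height(1)[OF n1])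
    have "x ^ x \<le> (4 * h) ^ x" using x by (intro power_mono) (auto simp: h_def)
    also have "\<dots> \<le> (4 * h) ^ (4 * h)" using x h by (intro power_increasing) (auto simp: h_def)
    also have "\<dots> = 256 ^ h * (h ^ h) ^ 4"
    proof -
      have "(4 * h) ^ (4 * h) = 4 ^ (4 * h) * h ^ (4 * h)" by (rule power_mult_distrib)
      moreover have "(4::nat) ^ (4 * h) = 256 ^ h" by (simp add: power_mult)
      moreover have "h ^ (4 * h) = (h ^ h) ^ 4" by (simp add: mult.commute flip: power_mult)
      ultimately show ?thesis by simp
    qed
    also have "\<dots> \<le> 256 ^ h * (3 ^ h * fact h) ^ 4"
      by (intro mult_le_mono2 power_mono power_self_le) simp
    also have "\<dots> = 20736 ^ h * fact h ^ 4"
    proof -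
      have "(3 ^ h * fact h) ^ 4 = ((3::nat) ^ h) ^ 4 * fact h ^ 4" by (rule power_mult_distrib)
      moreover have "((3::nat) ^ h) ^ 4 = (3 ^ 4) ^ h" by (simp only: power_mult[symmetric] mult.commute)
      then have "((3::nat) ^ h) ^ 4 = 81 ^ h" by simp
      moreover have "(256::nat) ^ h * 81 ^ h = 20736 ^ h" by (simp flip: power_mult_distrib)
      ultimately show ?thesis by (simp only: mult.assoc[symmetric])
    qed
    also have "\<dots> \<le> C * fact h * fact h ^ 4" using C by (rule mult_le_mono1)
    also have "\<dots> = C * fact h ^ 5" by (simp add: eval_nat_numeral)
    also have "\<dots> \<le> (n + 2) ^ C * (n + 2) ^ 5"
    proof (rule mult_le_mono)
      have "C < 2 ^ C" by (rule less_exp)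
      also have "\<dots> \<le> (n + 2) ^ C" by (rule power_mono) auto
      finally show "C \<le> (n + 2) ^ C" by simp
      show "fact h ^ 5 \<le> (n + 2) ^ 5" using hn by (intro power_mono) auto
    qed
    also have "\<dots> = (n + 2) ^ (C + 5)" by (simp only: power_add)
    finally have "x ^ x \<le> (n + 2) ^ (C + 5)" .
    then have "(x ^ x) ^ 24 \<le> ((n + 2) ^ (C + 5)) ^ 24" by (rule power_mono) simp
    then show ?thesis by (simp only: power_mult[symmetric] mult.commute[of 24])
  next
    case True
    then show ?thesis by simp
  qed
  then show ?thesis by blast
qed

lemma pow_table_le: "pow_table s i \<le> s ^ (24 * s)"
  by (cases "s = 0") (auto simp: pow_table_def intro: power_increasing)

lemma first_of_le: "first_of M P \<le> M"
  using card_mono[of "{..<M}" "{w. w < M \<and> (\<forall>v<w + 1. \<not> P v)}"] by (auto simp: first_of_def)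

lemma nth_of_le: "nth_of M P j \<le> M"
  using card_mono[of "{..<M}" "{w. w < M \<and> card {v. v < w + 1 \<and> P v} \<le> j}"] by (auto simp: nth_of_def)

lemma nth_of_cong:
  assumes "\<And>v. v < M \<Longrightarrow> P v = Q v" shows "nth_of M P j = nth_of M Q j"
proof -
  have "{v. v < w + 1 \<and> P v} = {v. v < w + 1 \<and> Q v}" if "w < M" for w using assms that by auto
  then have "{w. w < M \<and> card {v. v < w + 1 \<and> P v} \<le> j} = {w. w < M \<and> card {v. v < w + 1 \<and> Q v} \<le> j}" by auto
  then show ?thesis by (simp add: nth_of_def)
qed

lemma last_size_le: "last_size d n \<le> 4 * height n"
  using last_size_bounds(2)[of d n] by (cases "threshold d < n") (auto simp: last_size_def cells_def)

section \<open>The seven tables\<close>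

text \<open>Factorials are capped at \<open>n + 1\<close>, which keeps entries polynomial and does
  not affect comparison with \<open>n\<close>. Single numbers occupy index 0 of an array of their
  own.\<close>

definition tab :: "nat \<Rightarrow> nat \<Rightarrow> nat \<Rightarrow> nat \<Rightarrow> nat" where
  "tab d n a i =
    (if a = 0 then if i < n + 1 then min (n + 1) (fact i) else 0
     else if a = 1 then if i < 1 then height n else 0
     else if a = 2 then pow_table (2 * height n) i
     else if a = 3 then pow_table (last_size d n) i
     else if a = 4 then if i < (2 * height n) ^ (24 * (2 * height n)) then of_bool (accept (2 * height n) i) else 0
     else if a = 5 then if i < 1 then last_code d n else 0
     else if a = 6 then if i < n then code_of n i else 0
     else 0)"

lemma tab_simps:
  "tab d n 0 i = (if i < n + 1 then min (n + 1) (fact i) else 0)"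
  "tab d n 1 i = (if i < 1 then height n else 0)"
  "tab d n (Suc 0) i = (if i < 1 then height n else 0)"
  "tab d n 2 i = pow_table (2 * height n) i"
  "tab d n 3 i = pow_table (last_size d n) i"
  "tab d n 4 i = (if i < (2 * height n) ^ (24 * (2 * height n)) then of_bool (accept (2 * height n) i) else 0)"
  "tab d n 5 i = (if i < 1 then last_code d n else 0)"
  "tab d n 6 i = (if i < n then code_of n i else 0)"
  by (simp_all add: tab_def)

lemma height_le: "height n \<le> n"
  using card_mono[of "{..<n}" "{i. i < n \<and> fact (i + 1) \<le> n}"] by (auto simp: height_def)

lemmas code_defs = fit_def perms_test_def expanding_test_def rigid_test_def far_test_def inj_test_def
  near_test_def tup_def dig_def

text \<open>Array 1 holds the height at index 0.\<close>

definition last_size_expr :: "nat \<Rightarrow> nat \<Rightarrow> (nat \<Rightarrow> nat \<Rightarrow> nat) \<Rightarrow> nat" where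
  "last_size_expr d n A = cells d n - (cells d n div (2 * A 1 0) - 1) * (2 * A 1 0)"

lemma tables_1: "tables 1 (tab d)"
proof (rule tables_Suc[OF tables_0, where b = "\<lambda>n A. n + 1" and bnd = "\<lambda>n. n + 1" and p = 1
      and f = "\<lambda>n i A. if i = 0 then 1 else min (n + 1) (A 0 (i - 1) * i)"])
  show "cmp (\<lambda>\<eta> A. \<eta> 0 + 1)" by (intro cmp_intros)
  show "cmp (\<lambda>\<eta> A. if \<eta> 1 = 0 then 1 else min (\<eta> 0 + 1) (A 0 (\<eta> 1 - 1) * \<eta> 1))" by (intro cmp_intros)
  show "tab d n 0 i = (if i = 0 then 1 else min (n + 1)
      ((if (0::nat) < 0 \<or> (0::nat) = 0 \<and> i - 1 < i then tab d n 0 (i - 1) else 0) * i))" if i: "i < n + 1" for n i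
  proof (cases i)
    case (Suc j)
    \<comment> \<open>Capping commutes with multiplication by a positive number, so the recursion
      can run on capped values.\<close>
    have "min (n + 1) (fact j * Suc j) = min (n + 1) (min (n + 1) (fact j) * Suc j)"
    proof (cases "fact j \<le> n + 1")
      case False
      then have "(n + 1) * 1 \<le> fact j * Suc j" "(n + 1) * 1 \<le> (n + 1) * Suc j" by (intro mult_le_mono; simp)+
      then show ?thesis using False by (simp add: min_def)
    qed (simp add: min_def)
    then show ?thesis using Suc i by (simp add: tab_simps mult.commute)
  qed (use i in \<open>simp add: tab_simps\<close>)
qed (auto simp: tab_simps)

lemma tables_2: "tables 2 (tab d)"
proof (rule tables_Suc[OF tables_1, where b = "\<lambda>n A. 1" and bnd = "\<lambda>n. 1" and p = 1
      and f = "\<lambda>n i A. card {j. j < n \<and> A 0 (j + 1) \<le> n}"])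
  show "cmp (\<lambda>\<eta> A. card {j. j < \<eta> 0 \<and> A 0 (j + 1) \<le> \<eta> 0})" by (intro cmp_intros)
  show "tab d n 1 i = card {j. j < n \<and>
      (if (0::nat) < 1 \<or> (0::nat) = 1 \<and> j + 1 < i then tab d n 0 (j + 1) else 0) \<le> n}" if "i < 1" for n i
  proof -
    have "{j. j < n \<and> tab d n 0 (j + 1) \<le> n} = {j. j < n \<and> fact (j + 1) \<le> n}" by (auto simp: tab_simps min_def)
    then show ?thesis using that by (simp add: tab_simps height_def)
  qed
  show "tab d n 1 i \<le> (n + 2) ^ 1" for n i using height_le[of n] by (simp add: tab_simps)
qed (auto simp: tab_simps intro: cmp_intros)

lemma tables_3: "tables 3 (tab d)"
proof -
  obtain K where K: "\<And>n x. x \<le> 4 * height n \<Longrightarrow> x ^ (24 * x) \<le> (n + 2) ^ K" using code_space_polynomial by blast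
  show ?thesis
  proof (rule tables_Suc[OF tables_2, where b = "\<lambda>n A. 24 * (2 * A 1 0) + 1"
        and bnd = "\<lambda>n. 24 * (2 * height n) + 1" and p = K
        and f = "\<lambda>n i A. if i = 0 then 1 else A 2 (i - 1) * (2 * A 1 0)"])
    show "cmp (\<lambda>\<eta> A. 24 * (2 * A 1 0) + 1)" by (intro cmp_intros)
    show "cmp (\<lambda>\<eta> A. if \<eta> 1 = 0 then 1 else A 2 (\<eta> 1 - 1) * (2 * A 1 0))" by (intro cmp_intros)
    show "tab d n 2 i \<le> (n + 2) ^ K" for n i
      unfolding tab_simps by (rule order_trans[OF pow_table_le K]) simp
    show "tab d n 2 i = (if i = 0 then 1
        else (if (2::nat) < 2 \<or> (2::nat) = 2 \<and> i - 1 < i then tab d n 2 (i - 1) else 0) *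
          (2 * (if (1::nat) < 2 \<or> (1::nat) = 2 \<and> 0 < i then tab d n 1 0 else 0)))"
      if "i < 24 * (2 * height n) + 1" for n i
      using that by (cases i) (simp_all add: tab_simps pow_table_def)
  qed (auto simp: tab_simps pow_table_def)
qed

lemma tables_4: "tables 4 (tab d)"
proof -
  obtain K where K: "\<And>n x. x \<le> 4 * height n \<Longrightarrow> x ^ (24 * x) \<le> (n + 2) ^ K" using code_space_polynomial by blast
  show ?thesis
  proof (rule tables_Suc[OF tables_3, where b = "\<lambda>n A. 24 * last_size_expr d n A + 1"
        and bnd = "\<lambda>n. 24 * last_size d n + 1" and p = K
        and f = "\<lambda>n i A. if i = 0 then 1 else A 3 (i - 1) * last_size_expr d n A"])
    show "cmp (\<lambda>\<eta> A. 24 * last_size_expr d (\<eta> 0) A + 1)"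
      unfolding last_size_expr_def cells_def by (intro cmp_intros)
    show "cmp (\<lambda>\<eta> A. if \<eta> 1 = 0 then 1 else A 3 (\<eta> 1 - 1) * last_size_expr d (\<eta> 0) A)"
      unfolding last_size_expr_def cells_def by (intro cmp_intros)
    show "tab d n 3 i \<le> (n + 2) ^ K" for n i
      unfolding tab_simps by (rule order_trans[OF pow_table_le K[OF last_size_le]])
    show "tab d n 3 i = (if i = 0 then 1
        else (if (3::nat) < 3 \<or> (3::nat) = 3 \<and> i - 1 < i then tab d n 3 (i - 1) else 0) *
          last_size_expr d n (\<lambda>a j. if a < 3 \<or> a = 3 \<and> j < i then tab d n a j else 0))"
      if "i < 24 * last_size d n + 1" for n i
      using that by (cases i)
        (simp_all add: tab_simps pow_table_def last_size_expr_def last_size_def regular_def)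
  qed (auto simp: tab_simps pow_table_def last_size_expr_def last_size_def regular_def)
qed

text \<open>Acceptance of a code refers only to smaller codes, so the greedy choice is a
  course-of-values recursion in which table 4 reads its own earlier entries.\<close>

lemma tables_5: "tables 5 (tab d)"
proof (rule tables_Suc[OF tables_4, where b = "\<lambda>n A. A 2 (24 * (2 * A 1 0))"
      and bnd = "\<lambda>n. (2 * height n) ^ (24 * (2 * height n))" and p = 1
      and f = "\<lambda>n i A. of_bool (fit (A 2) (2 * A 1 0) i \<and>
        (\<forall>v<i. A 4 v = 1 \<longrightarrow> far_test (A 2) (2 * A 1 0) i v))"])
  show "cmp (\<lambda>\<eta> A. A 2 (24 * (2 * A 1 0)))" by (intro cmp_intros)
  show "cmp (\<lambda>\<eta> A. of_bool (fit (A 2) (2 * A 1 0) (\<eta> 1) \<and>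
        (\<forall>v<\<eta> 1. A 4 v = 1 \<longrightarrow> far_test (A 2) (2 * A 1 0) (\<eta> 1) v)))"
    unfolding code_defs by (intro cmp_intros)
  show "tab d n 4 i = of_bool (fit (\<lambda>j. if (2::nat) < 4 \<or> (2::nat) = 4 \<and> j < i then tab d n 2 j else 0)
        (2 * (if (1::nat) < 4 \<or> (1::nat) = 4 \<and> 0 < i then tab d n 1 0 else 0)) i \<and>
      (\<forall>v<i. (if (4::nat) < 4 \<or> (4::nat) = 4 \<and> v < i then tab d n 4 v else 0) = 1 \<longrightarrow>
        far_test (\<lambda>j. if (2::nat) < 4 \<or> (2::nat) = 4 \<and> j < i then tab d n 2 j else 0)
          (2 * (if (1::nat) < 4 \<or> (1::nat) = 4 \<and> 0 < i then tab d n 1 0 else 0)) i v))"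
    if i: "i < (2 * height n) ^ (24 * (2 * height n))" for n i
  proof -
    have "tab d n 4 v = 1 \<longleftrightarrow> accept (2 * height n) v" if "v < i" for v
      using that i by (simp add: tab_simps)
    then show ?thesis using i by (simp add: tab_simps(2-4) accept.simps[of _ i] tab_simps(6)[of _ _ i])
  qed
qed (auto simp: tab_simps pow_table_def)

lemma tables_6: "tables 6 (tab d)"
proof -
  obtain K where K: "\<And>n x. x \<le> 4 * height n \<Longrightarrow> x ^ (24 * x) \<le> (n + 2) ^ K" using code_space_polynomial by blast
  show ?thesis
  proof (rule tables_Suc[OF tables_5, where b = "\<lambda>n A. 1" and bnd = "\<lambda>n. 1" and p = K
        and f = "\<lambda>n i A. first_of (A 3 (24 * last_size_expr d n A)) (fit (A 3) (last_size_expr d n A))"])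
    show "cmp (\<lambda>\<eta> A. first_of (A 3 (24 * last_size_expr d (\<eta> 0) A)) (fit (A 3) (last_size_expr d (\<eta> 0) A)))"
      unfolding first_of_def code_defs last_size_expr_def cells_def by (intro cmp_intros)
    show "tab d n 5 i \<le> (n + 2) ^ K" for n i
      using order_trans[OF first_of_le K[OF last_size_le]] by (simp add: tab_simps last_code_def)
    show "tab d n 5 i = first_of
        (if (3::nat) < 5 \<or> (3::nat) = 5 \<and> 24 * last_size_expr d n (\<lambda>a j. if a < 5 \<or> a = 5 \<and> j < i then tab d n a j else 0) < i
         then tab d n 3 (24 * last_size_expr d n (\<lambda>a j. if a < 5 \<or> a = 5 \<and> j < i then tab d n a j else 0)) else 0)
        (fit (\<lambda>j. if (3::nat) < 5 \<or> (3::nat) = 5 \<and> j < i then tab d n 3 j else 0)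
          (last_size_expr d n (\<lambda>a j. if a < 5 \<or> a = 5 \<and> j < i then tab d n a j else 0)))"
      if "i < 1" for n i
    proof -
      have "last_size_expr d n (\<lambda>a j. if a < 5 \<or> a = 5 \<and> j < i then tab d n a j else 0) = last_size d n"
        by (simp add: last_size_expr_def last_size_def regular_def tab_simps)
      then show ?thesis using that by (simp add: tab_simps last_code_def pow_table_def[of _ "24 * _"])
    qed
  qed (auto simp: tab_simps intro: cmp_intros)
qed

lemma tables_7: "tables 7 (tab d)"
proof -
  obtain K where K: "\<And>n x. x \<le> 4 * height n \<Longrightarrow> x ^ (24 * x) \<le> (n + 2) ^ K" using code_space_polynomial by blast
  show ?thesis
  proof (rule tables_Suc[OF tables_6, where b = "\<lambda>n A. n" and bnd = "\<lambda>n. n" and p = K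
        and f = "\<lambda>n i A. nth_of (A 2 (24 * (2 * A 1 0))) (\<lambda>v. A 4 v = 1) i"])
    show "cmp (\<lambda>\<eta> A. \<eta> 0)" by (intro cmp_intros)
    show "cmp (\<lambda>\<eta> A. nth_of (A 2 (24 * (2 * A 1 0))) (\<lambda>v. A 4 v = 1) (\<eta> 1))"
      unfolding nth_of_def by (intro cmp_intros)
    show "tab d n 6 i \<le> (n + 2) ^ K" for n i
    proof -
      have "code_of n i \<le> (n + 2) ^ K" unfolding code_of_def by (rule order_trans[OF nth_of_le K]) simp
      then show ?thesis by (simp add: tab_simps)
    qed
    show "tab d n 6 i = nth_of
        (if (2::nat) < 6 \<or> (2::nat) = 6 \<and> 24 * (2 * (if (1::nat) < 6 \<or> (1::nat) = 6 \<and> 0 < i then tab d n 1 0 else 0)) < i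
         then tab d n 2 (24 * (2 * (if (1::nat) < 6 \<or> (1::nat) = 6 \<and> 0 < i then tab d n 1 0 else 0))) else 0)
        (\<lambda>v. (if (4::nat) < 6 \<or> (4::nat) = 6 \<and> v < i then tab d n 4 v else 0) = 1) i"
      if "i < n" for n i
    proof -
      have "nth_of ((2 * height n) ^ (24 * (2 * height n))) (\<lambda>v. tab d n 4 v = 1) i = code_of n i"
        unfolding code_of_def by (rule nth_of_cong) (simp add: tab_simps)
      then show ?thesis using that by (simp add: tab_simps(2-4,8) pow_table_def)
    qed
  qed (auto simp: tab_simps)
qed

text \<open>One index below \<open>n * n\<close> replaces row and column, as the output loop has a
  single counter.\<close>

lemma encode_graph_eq:
  "encode_graph n E = map (\<lambda>i. of_bool ({i div n + 1, i mod n + 1} \<in> E)) [0..<n * n]"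
proof -
  define g where "g i = (of_bool ({i div n + 1, i mod n + 1} \<in> E) :: nat)" for i
  have "concat (map (\<lambda>u. map (\<lambda>v. of_bool ({u, v} \<in> E)) [1..<n + 1]) [1..<m + 1]) = map g [0..<m * n]" for m
  proof (induction m)
    case (Suc m)
    have "map (\<lambda>v. of_bool ({Suc m, v} \<in> E)) [1..<n + 1] = map (\<lambda>j. g (j + m * n)) [0..<n]"
      by (rule nth_equalityI) (auto simp: g_def simp del: upt_Suc)
    also have "\<dots> = map g [m * n..<n + m * n]"
      by (simp add: map_add_upt[symmetric] del: map_add_upt)
    finally have "map (\<lambda>v. of_bool ({Suc m, v} \<in> E)) [1..<n + 1] = map g [m * n..<n + m * n]" .
    then show ?case using Suc.IH upt_add_eq_append[of 0 "m * n" n] by (simp add: add.commute)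
  qed simp
  then show ?thesis unfolding encode_graph_def g_def by blast
qed

definition arc_expr :: "nat \<Rightarrow> nat \<Rightarrow> (nat \<Rightarrow> nat \<Rightarrow> nat) \<Rightarrow> nat \<Rightarrow> nat \<Rightarrow> bool" where
  "arc_expr d n A u v \<longleftrightarrow> (if n \<le> d then path_arc n u v
     else arc (n - 28 * cells d n) d
       (cell_map (2 * A 1 0) (regular d n (2 * A 1 0)) (cells d n) (A 2) (A 3) (A 6) (A 5 0)) u v)"

lemma arc_expr_tab: "arc_expr d n (\<lambda>a i. if a < 7 then tab d n a i else 0) u v = the_arc d n u v"
proof -
  have reg: "regular d n (2 * height n) \<le> n"
  proof -
    have "regular d n (2 * height n) \<le> cells d n div (2 * height n) * (2 * height n)"
      unfolding regular_def by (intro mult_le_mono1) simp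
    also have "\<dots> \<le> cells d n" by (rule div_times_less_eq_dividend)
    also have "\<dots> \<le> n" using cells_le(1)[of d n] by simp
    finally show ?thesis .
  qed
  have "cell_map (2 * height n) (regular d n (2 * height n)) (cells d n) (pow_table (2 * height n))
      (pow_table (last_size d n)) (\<lambda>j. if j < n then code_of n j else 0) (last_code d n) = wiring d n"
  proof (intro ext)
    fix i X
    have "X div (2 * height n) < n" if "X < regular d n (2 * height n)"
      using that reg div_le_dividend[of X "2 * height n"] by linarith
    then show "cell_map (2 * height n) (regular d n (2 * height n)) (cells d n) (pow_table (2 * height n))
      (pow_table (last_size d n)) (\<lambda>j. if j < n then code_of n j else 0) (last_code d n) i X = wiring d n i X"
      unfolding wiring_def cell_map_def by simp
  qed
  then show ?thesis by (simp add: arc_expr_def the_arc_def tab_simps)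
qed

text \<open>Given the tables, adjacency is a bounded arithmetic expression in them, so
  \<open>cmp_intros\<close> succeeds after unfolding. Both directions of an arc are tested, since
  edges are unordered.\<close>

lemma polytime_the_edges: "polytime_on_unary (\<lambda>n. encode_graph n (the_edges d n))"
proof -
  let ?A = "\<lambda>n a i. if a < 7 then tab d n a i else 0"
  let ?f = "\<lambda>n i A. of_bool (i div n + 1 \<noteq> i mod n + 1 \<and>
    (arc_expr d n A (i div n + 1) (i mod n + 1) \<or> arc_expr d n A (i mod n + 1) (i div n + 1))) :: nat"
  have "polytime_on_unary (\<lambda>n. map (\<lambda>i. ?f n i (?A n)) [0..<n * n])"
  proof (rule polytime_on_unary_map[OF tables_7, where b = "\<lambda>n A. n * n" and f = ?f])
    show "cmp (\<lambda>\<eta> A. \<eta> 0 * \<eta> 0)" by (intro cmp_intros)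
    show "cmp (\<lambda>\<eta>. ?f (\<eta> 0) (\<eta> 1))"
      unfolding arc_expr_def arc_def path_arc_def block_arc_def cell_arc_def link_def cell_map_def role_def cell_def
        regular_def cells_def tup_def dig_def flip_def even_iff_mod_2_eq_zero
      by (intro cmp_intros)
  qed
  moreover have "map (\<lambda>i. ?f n i (?A n)) [0..<n * n] = encode_graph n (the_edges d n)" for n
    unfolding encode_graph_eq arc_expr_tab
  proof (rule map_cong[OF refl])
    fix i assume "i \<in> set [0..<n * n]"
    then have i: "i < n * n" "0 < n" by (auto intro: gr0I)
    then have "i div n < n" "i mod n < n" by (auto simp: less_mult_imp_div_less)
    then have "i div n + 1 \<in> {1..n}" "i mod n + 1 \<in> {1..n}" by (auto simp: Suc_le_eq)
    then show "of_bool (i div n + 1 \<noteq> i mod n + 1 \<and>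
        (the_arc d n (i div n + 1) (i mod n + 1) \<or> the_arc d n (i mod n + 1) (i div n + 1))) =
      (of_bool ({i div n + 1, i mod n + 1} \<in> the_edges d n) :: nat)"
      unfolding the_edges_def edge_graph_of_iff by simp
  qed
  ultimately show ?thesis by simp
qed

text \<open>With \<open>l = ln n\<close>: if the height is at most \<open>sqrt l\<close>, then
  \<open>ln l \<le> 2 * sqrt l\<close> suffices. Otherwise \<open>ln h \<ge> ln l / 2\<close>, and
  \<open>h * (ln h - 1) \<le> ln (fact h) \<le> l\<close>; here \<open>ln l \<ge> 4\<close> gives
  \<open>ln h - 1 \<ge> ln l / 4\<close>.\<close>

lemma height_asymptotic:
  assumes n: "1 \<le> n" and l: "4 \<le> ln (ln (real n))"
  shows "real (height n) \<le> 4 * (ln (real n) / ln (ln (real n)))" "1 \<le> ln (real n) / ln (ln (real n))"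
proof -
  define l where "l = ln (real n)"
  define h where "h = real (height n)"
  have "0 \<le> l" using n by (simp add: l_def)
  moreover have "l \<noteq> 0" using l by (auto simp: l_def)
  ultimately have l0: "0 < l" by simp
  have ll: "4 \<le> ln l" using l by (simp add: l_def)
  have "ln l \<le> l" using ln_le_minus_one[OF l0] by simp
  then show "1 \<le> ln (real n) / ln (ln (real n))" using ll by (simp add: l_def)
  have sq: "0 < sqrt l" "sqrt l * sqrt l = l" using l0 by auto
  have lsq: "ln l = 2 * ln (sqrt l)" using l0 by (simp add: ln_sqrt)
  have "h * ln l \<le> 4 * l"
  proof (cases "h \<le> sqrt l")
    case True
    have "ln (sqrt l) \<le> sqrt l" using ln_le_minus_one[OF sq(1)] by simp
    then have "ln l \<le> 2 * sqrt l" using lsq by simp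
    moreover have "0 \<le> sqrt l" "0 \<le> ln l" using sq(1) ll by linarith+
    ultimately have "h * ln l \<le> sqrt l * (2 * sqrt l)" by (intro mult_mono[OF True])
    also have "\<dots> = 2 * l" using sq(2) by simp
    finally show ?thesis using l0 by simp
  next
    case False
    then have "0 < h" using sq(1) by linarith
    then have h0: "0 < height n" by (simp add: h_def)
    have "h * ln h - h \<le> ln (fact (height n))" unfolding h_def by (rule ln_fact_ge[OF h0])
    also have "\<dots> \<le> l"
    proof -
      have "(fact (height n) :: real) \<le> real n"
        using of_nat_mono[OF height(1)[OF n], where 'a = real] by (simp only: of_nat_fact)
      then show ?thesis unfolding l_def using n by (subst ln_le_cancel_iff) auto
    qed
    finally have "h * (ln h - 1) \<le> l" by (simp add: algebra_simps)
    moreover have "ln (sqrt l) \<le> ln h" using False sq(1) \<open>0 < h\<close> by (subst ln_le_cancel_iff) auto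
    then have "ln l / 4 \<le> ln h - 1" using lsq ll by simp
    then have "h * (ln l / 4) \<le> h * (ln h - 1)" by (intro mult_left_mono) (auto simp: h_def)
    ultimately show ?thesis by simp
  qed
  then have "h \<le> 4 * l / ln l" using ll by (simp add: pos_le_divide_eq)
  then show "real (height n) \<le> 4 * (ln (real n) / ln (ln (real n)))" by (simp add: h_def l_def)
qed

text \<open>The quotient of logarithms is eventually at least 1 and absorbs the bounded block; 448
  is 112 times the constant 4 of \<open>height_asymptotic\<close>.\<close>

lemma component_size_bigo:
  assumes d: "30 \<le> d"
  shows "(\<lambda>n. real (max_component_size {1..n} (the_edges d n))) \<in> O(\<lambda>n. ln (real n) / ln (ln (real n)))"
proof (rule bigoI[where c = "real (threshold d + d + 57 + 448)"])
  have "eventually (\<lambda>n. 4 \<le> ln (ln (real n))) sequentially" by real_asymp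
  then show "eventually (\<lambda>n. norm (real (max_component_size {1..n} (the_edges d n))) \<le>
      real (threshold d + d + 57 + 448) * norm (ln (real n) / ln (ln (real n)))) sequentially"
    using eventually_gt_at_top[of "threshold d"]
  proof eventually_elim
    case (elim n)
    define g where "g = ln (real n) / ln (ln (real n))"
    have n1: "1 \<le> n" using elim by simp
    have h: "real (height n) \<le> 4 * g" and g1: "1 \<le> g"
      using height_asymptotic[OF n1 elim(1)] by (auto simp: g_def)
    have "real (max_component_size {1..n} (the_edges d n)) \<le> real (threshold d + d + 57 + 112 * height n)"
      using max_component_size_the_edges[OF d elim(2)] by (rule of_nat_mono)
    also have "\<dots> = real (threshold d + d + 57) * 1 + 112 * real (height n)" by simp
    also have "\<dots> \<le> real (threshold d + d + 57) * g + 112 * (4 * g)"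
      using h g1 by (intro add_mono mult_left_mono) auto
    also have "\<dots> = real (threshold d + d + 57 + 448) * g" by (simp add: algebra_simps)
    finally show ?case using g1 by (simp add: g_def[symmetric])
  qed
qed

theorem theorem4p2:
  shows "\<exists>d0 :: nat. \<forall>d \<ge> d0. \<exists>(\<gamma> :: real) (E :: nat \<Rightarrow> nat set set).
    \<gamma> > 0 \<and>
    (\<forall>n. graph {1..n} (E n)) \<and>
    (\<forall>n > d. max_degree {1..n} (E n) = d) \<and>
    (\<forall>n. n \<notin> {2, 3, 4, 5} \<longrightarrow> robustly_self_ordered \<gamma> {1..n} (E n)) \<and>
    polytime_on_unary (\<lambda>n. encode_graph n (E n)) \<and>
    (\<lambda>n. real (max_component_size {1..n} (E n))) \<in> O(\<lambda>n. ln (real n) / ln (ln (real n)))"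
proof (rule exI[of _ 30], intro allI impI)
  \<comment> \<open>30 lies above all role degrees, so the block centre is recognised by its degree
    \<open>d\<close>.\<close>
  fix d :: nat assume d: "30 \<le> d"
  show "\<exists>(\<gamma> :: real) (E :: nat \<Rightarrow> nat set set).
    \<gamma> > 0 \<and>
    (\<forall>n. graph {1..n} (E n)) \<and>
    (\<forall>n > d. max_degree {1..n} (E n) = d) \<and>
    (\<forall>n. n \<notin> {2, 3, 4, 5} \<longrightarrow> robustly_self_ordered \<gamma> {1..n} (E n)) \<and>
    polytime_on_unary (\<lambda>n. encode_graph n (E n)) \<and>
    (\<lambda>n. real (max_component_size {1..n} (E n))) \<in> O(\<lambda>n. ln (real n) / ln (ln (real n)))"
  proof (intro exI[of _ "gap d"] exI[of _ "the_edges d"] conjI allI impI)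
    show "gap d > 0" by (simp add: gap_def)
    show "graph {1..n} (the_edges d n)" for n unfolding the_edges_def by (rule graph_graph_of)
    show "max_degree {1..n} (the_edges d n) = d" if "d < n" for n by (rule max_degree_the_edges[OF d that])
    show "robustly_self_ordered (gap d) {1..n} (the_edges d n)" if "n \<notin> {2, 3, 4, 5}" for n
      by (rule robustly_self_ordered_the_edges[OF d that])
    show "polytime_on_unary (\<lambda>n. encode_graph n (the_edges d n))" by (rule polytime_the_edges)
    show "(\<lambda>n. real (max_component_size {1..n} (the_edges d n))) \<in> O(\<lambda>n. ln (real n) / ln (ln (real n)))"
      by (rule component_size_bigo[OF d])
  qed
qed

end
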